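(* Let $\mathbb{K}\in\{\mathbb{R},\mathbb{C}\}$, let $\mathfrak{g}=\mathfrak{g}_{1}\oplus\mathfrak{g}_0\oplus\mathfrak{g}_{-1}$ be a finite dimensional 3-graded $\mathbb{K}$-Lie superalgebra, $\mathfrak{k}=\mathfrak{g}_0\oplus\mathfrak{g}_1$, and let $X_1,\dots,X_{r+s}$ be a homogeneous basis of $\mathfrak{g}_{-1}$ with $X_i$ even for $i\le r$ and odd for $i>r$. Let $\lambda:\mathfrak{g}_0\to\mathbb{K}$ be a character. The action $\pi$ of $\mathfrak{g}$ on $S(\mathfrak{g}_{-1})$, obtained by transporting the $\mathfrak{g}$-module $U(\mathfrak{g})\otimes_{U(\mathfrak{k})}\mathbb{K}_\lambda$ along the vector space isomorphism $S(\mathfrak{g}_{-1})\to U(\mathfrak{g})\otimes_{U(\mathfrak{k})}\mathbb{K}_\lambda$, $Y\mapsto\sigma(Y)\otimes1$, takes values in the Weyl superalgebra $\mathscr{A}(\mathfrak{g}_{-1})$ and is given by: (i) for $X\in\mathfrak{g}_{-1}$: $\pi(X)=X$; (ii) for $X\in\mathfrak{g}_0$: $\pi(X)=\lambda(X)+\sum_{i=1}^{r+s}[X,X_i]\,\partial^i$; (iii) for $X\in\mathfrak{g}_{1}$: $\pi(X)=\sum_{i=1}^{r+s}\lambda([X,X_i])\,\partial^i+\frac12\sum_{i,j=1}^{r+s}[[X,X_i],X_j]\,\partial^j\partial^i$.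
   Context: 3-graded means $\mathfrak{g}=\mathfrak{g}_1\oplus\mathfrak{g}_0\oplus\mathfrak{g}_{-1}$ as super vector spaces with $[\mathfrak{g}_i,\mathfrak{g}_j]\subset\mathfrak{g}_{i+j}$ (where $\mathfrak{g}_k=0$ for $|k|>1$). A character is an even Lie superalgebra morphism to $\mathbb{K}$; $\lambda$ is extended to $\mathfrak{k}$ by $\lambda(\mathfrak{g}_1)=0$, and $\mathbb{K}_\lambda$ is the 1-dimensional $\mathfrak{k}$-module with $Xv=\lambda(X)v$. $S(V)$ is the supersymmetric algebra of a super vector space $V$; $\sigma:S(\mathfrak{g}_{-1})\to U(\mathfrak{g}_{-1})\subset U(\mathfrak{g})$ is the (super) symmetrisation isomorphism (here $\mathfrak{g}_{-1}$ is supercommutative). $\partial^i$ is the unique super derivation of $S(\mathfrak{g}_{-1})$ with $\partial^iX_j=\delta_{ij}$; elements of $\mathfrak{g}_{-1}$ act on $S(\mathfrak{g}_{-1})$ by left multiplication; $\mathscr{A}(V)$ is the subalgebra of $\mathrm{End}_{\mathbb{K}}(S(V))$ generated by multiplications by elements of $V$ and the super derivations of $S(V)$. *)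

theory Defs
  imports
    Complex_Main
    "HOL-Library.Z2"
    "HOL-Library.Poly_Mapping"
    "HOL-Algebra.QuotRing"
    "HOL-Algebra.Module"
    "HOL-Algebra.Generated_Groups"
    "HOL-Algebra.Free_Abelian_Groups"
    "HOL-Combinatorics.Permutations"
begin

section \<open>Lie superalgebras\<close>

text \<open>
  Parities live in \<^typ>\<open>bit\<close>, the field with two elements, so that they add modulo 2.
  A super vector space is a vector space on a whole type with parity components
  \<open>P 0\<close> (even) and \<open>P 1\<close> (odd).
\<close>

definition direct_sum ::
    "('k::field \<Rightarrow> 'g::ab_group_add \<Rightarrow> 'g) \<Rightarrow> 'i set \<Rightarrow> ('i \<Rightarrow> 'g set) \<Rightarrow> 'g set \<Rightarrow> bool" where
  "direct_sum sc I W U \<longleftrightarrow>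
     (\<forall>i\<in>I. module.subspace sc (W i)) \<and> bij_betw (\<lambda>f. \<Sum>i\<in>I. f i) (Pi\<^sub>E I W) U"

definition ksign :: "bit \<Rightarrow> bit \<Rightarrow> 'k::ring_1" where
  "ksign p q = (if p = 1 \<and> q = 1 then - 1 else 1)"

locale super_vector_space = vector_space sc
  for sc :: "'k::field \<Rightarrow> 'g::ab_group_add \<Rightarrow> 'g" +
  fixes P :: "bit \<Rightarrow> 'g set"
  assumes parity_decomposition: "direct_sum sc {0, 1} P UNIV"

locale lie_superalgebra = super_vector_space sc P
  for sc :: "'k::field \<Rightarrow> 'g::ab_group_add \<Rightarrow> 'g" and P +
  fixes br :: "'g \<Rightarrow> 'g \<Rightarrow> 'g"
  assumes br_linear_right: "\<And>x. Vector_Spaces.linear sc sc (\<lambda>y. br x y)"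
    and br_linear_left: "\<And>y. Vector_Spaces.linear sc sc (\<lambda>x. br x y)"
    and br_parity: "\<And>p q x y. x \<in> P p \<Longrightarrow> y \<in> P q \<Longrightarrow> br x y \<in> P (p + q)"
    and br_skew: "\<And>p q x y. x \<in> P p \<Longrightarrow> y \<in> P q \<Longrightarrow> br x y = - sc (ksign p q) (br y x)"
    and br_jacobi: "\<And>p q x y z. x \<in> P p \<Longrightarrow> y \<in> P q \<Longrightarrow>
          br x (br y z) = br (br x y) z + sc (ksign p q) (br y (br x z))"

locale three_graded_lie_superalgebra = lie_superalgebra sc P br
  for sc :: "'k::field \<Rightarrow> 'g::ab_group_add \<Rightarrow> 'g" and P br +
  fixes W :: "int \<Rightarrow> 'g set"
  assumes grading_decomposition: "direct_sum sc {-1, 0, 1} W UNIV"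
    and grading_parity: "\<And>k. direct_sum sc {0, 1} (\<lambda>p. W k \<inter> P p) (W k)"
    and grading_bound: "\<And>k. k \<notin> {-1, 0, 1} \<Longrightarrow> W k = {0}"
    and grading_br: "\<And>k l x y. x \<in> W k \<Longrightarrow> y \<in> W l \<Longrightarrow> br x y \<in> W (k + l)"

text \<open>The subalgebra of elements of degree 0 and 1.\<close>

definition kpart :: "(int \<Rightarrow> 'g::ab_group_add set) \<Rightarrow> 'g set" where
  "kpart W = {a + b | a b. a \<in> W 0 \<and> b \<in> W 1}"

text \<open>
  A character of the subalgebra \<open>H\<close>, given by a function that is only relevant on \<open>H\<close>.
  The bracket of the one-dimensional purely even Lie superalgebra is zero, hence the last clause.
\<close>

definition lie_character ::
    "('k::field \<Rightarrow> 'g::ab_group_add \<Rightarrow> 'g) \<Rightarrow> (bit \<Rightarrow> 'g set) \<Rightarrow> ('g \<Rightarrow> 'g \<Rightarrow> 'g)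
      \<Rightarrow> 'g set \<Rightarrow> ('g \<Rightarrow> 'k) \<Rightarrow> bool" where
  "lie_character sc P br H lam \<longleftrightarrow>
     (\<forall>x\<in>H. \<forall>y\<in>H. lam (x + y) = lam x + lam y) \<and>
     (\<forall>c. \<forall>x\<in>H. lam (sc c x) = c * lam x) \<and>
     (\<forall>x\<in>H \<inter> P 1. lam x = 0) \<and>
     (\<forall>x\<in>H. \<forall>y\<in>H. lam (br x y) = 0)"

text \<open>The extension by zero on degree 1 of a character of the degree 0 part.\<close>

definition extend_char ::
    "(int \<Rightarrow> 'g::ab_group_add set) \<Rightarrow> ('g \<Rightarrow> 'k) \<Rightarrow> 'g \<Rightarrow> 'k" where
  "extend_char W lam x = lam (THE a. a \<in> W 0 \<and> x - a \<in> W 1)"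

definition homogeneous_basis ::
    "('k::field \<Rightarrow> 'g::ab_group_add \<Rightarrow> 'g) \<Rightarrow> (bit \<Rightarrow> 'g set) \<Rightarrow> 'g set
      \<Rightarrow> nat \<Rightarrow> nat \<Rightarrow> (nat \<Rightarrow> 'g) \<Rightarrow> bool" where
  "homogeneous_basis sc P V r s X \<longleftrightarrow>
     inj_on X {1..r + s} \<and>
     \<not> module.dependent sc (X ` {1..r + s}) \<and>
     module.span sc (X ` {1..r + s}) = V \<and>
     (\<forall>i\<in>{1..r}. X i \<in> P 0) \<and>
     (\<forall>i\<in>{r + 1..r + s}. X i \<in> P 1)"


section \<open>Supersymmetric and universal enveloping algebras\<close>

text \<open>
  With concatenation as addition on lists, the library's convolution product makes
  \<open>'g list \<Rightarrow>\<^sub>0 'k\<close> the free associative unital algebra on the underlying set of \<open>'g\<close>.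
\<close>

instantiation list :: (type) monoid_add
begin

definition zero_list_def: "(0 :: 'a list) = []"

definition plus_list_def: "(xs :: 'a list) + ys = xs @ ys"

instance
  by standard (simp_all add: zero_list_def plus_list_def)

end

definition free_algebra :: "'g set \<Rightarrow> ('g list \<Rightarrow>\<^sub>0 'k::ring_1) ring" where
  "free_algebra V =
     \<lparr>carrier = {p. Poly_Mapping.keys p \<subseteq> lists V}, monoid.mult = (*), one = 1, ring.zero = 0, add = (+)\<rparr>"

text \<open>
  Dividing the free algebra on the set \<open>V\<close> by the linearity relations gives the tensor algebra
  of the vector space \<open>V\<close>; the supersymmetric algebra of \<open>V\<close> and the universal enveloping algebra
  of \<open>H\<close> are obtained by dividing out the supercommutator relations as well.
  Here \<open>single xs c\<close> is \<open>c\<close> times the monomial \<open>xs\<close>.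
\<close>

definition linear_rels ::
    "('k::field \<Rightarrow> 'g::ab_group_add \<Rightarrow> 'g) \<Rightarrow> 'g set \<Rightarrow> ('g list \<Rightarrow>\<^sub>0 'k) set" where
  "linear_rels sc V =
     {Poly_Mapping.single [x + y] 1 - Poly_Mapping.single [x] 1 - Poly_Mapping.single [y] 1
        | x y. x \<in> V \<and> y \<in> V} \<union>
     {Poly_Mapping.single [sc c x] 1 - Poly_Mapping.single [x] c | c x. x \<in> V}"

definition sym_ideal ::
    "('k::field \<Rightarrow> 'g::ab_group_add \<Rightarrow> 'g) \<Rightarrow> (bit \<Rightarrow> 'g set) \<Rightarrow> 'g set \<Rightarrow> ('g list \<Rightarrow>\<^sub>0 'k) set" where
  "sym_ideal sc P V = genideal (free_algebra V) (linear_rels sc V \<union>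
     {Poly_Mapping.single [x, y] 1 - Poly_Mapping.single [y, x] (ksign p q)
        | x y p q. x \<in> V \<inter> P p \<and> y \<in> V \<inter> P q})"

definition env_ideal ::
    "('k::field \<Rightarrow> 'g::ab_group_add \<Rightarrow> 'g) \<Rightarrow> (bit \<Rightarrow> 'g set) \<Rightarrow> ('g \<Rightarrow> 'g \<Rightarrow> 'g)
      \<Rightarrow> 'g set \<Rightarrow> ('g list \<Rightarrow>\<^sub>0 'k) set" where
  "env_ideal sc P br H = genideal (free_algebra H) (linear_rels sc H \<union>
     {Poly_Mapping.single [x, y] 1 - Poly_Mapping.single [y, x] (ksign p q)
          - Poly_Mapping.single [br x y] 1
        | x y p q. x \<in> H \<inter> P p \<and> y \<in> H \<inter> P q})"

text \<open>
  Quotients of the free algebra are algebras over the ground field; the \<^const>\<open>smult\<close> component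
  is multiplication by the class of a constant.
\<close>

definition quot_algebra ::
    "'g set \<Rightarrow> ('g list \<Rightarrow>\<^sub>0 'k::field) set \<Rightarrow> ('k, ('g list \<Rightarrow>\<^sub>0 'k) set) module" where
  "quot_algebra V J = ring.extend (free_algebra V Quot J)
     \<lparr>smult = (\<lambda>c A. rcoset_mult (free_algebra V) J
                       (J +>\<^bsub>free_algebra V\<^esub> Poly_Mapping.single [] c) A)\<rparr>"

definition sym_algebra ::
    "('k::field \<Rightarrow> 'g::ab_group_add \<Rightarrow> 'g) \<Rightarrow> (bit \<Rightarrow> 'g set) \<Rightarrow> 'g set
      \<Rightarrow> ('k, ('g list \<Rightarrow>\<^sub>0 'k) set) module" where
  "sym_algebra sc P V = quot_algebra V (sym_ideal sc P V)"

definition env_algebra ::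
    "('k::field \<Rightarrow> 'g::ab_group_add \<Rightarrow> 'g) \<Rightarrow> (bit \<Rightarrow> 'g set) \<Rightarrow> ('g \<Rightarrow> 'g \<Rightarrow> 'g) \<Rightarrow> 'g set
      \<Rightarrow> ('k, ('g list \<Rightarrow>\<^sub>0 'k) set) module" where
  "env_algebra sc P br H = quot_algebra H (env_ideal sc P br H)"

definition sym_class ::
    "('k::field \<Rightarrow> 'g::ab_group_add \<Rightarrow> 'g) \<Rightarrow> (bit \<Rightarrow> 'g set) \<Rightarrow> 'g set
      \<Rightarrow> ('g list \<Rightarrow>\<^sub>0 'k) \<Rightarrow> ('g list \<Rightarrow>\<^sub>0 'k) set" where
  "sym_class sc P V p = sym_ideal sc P V +>\<^bsub>free_algebra V\<^esub> p"

definition env_class ::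
    "('k::field \<Rightarrow> 'g::ab_group_add \<Rightarrow> 'g) \<Rightarrow> (bit \<Rightarrow> 'g set) \<Rightarrow> ('g \<Rightarrow> 'g \<Rightarrow> 'g) \<Rightarrow> 'g set
      \<Rightarrow> ('g list \<Rightarrow>\<^sub>0 'k) \<Rightarrow> ('g list \<Rightarrow>\<^sub>0 'k) set" where
  "env_class sc P br H p = env_ideal sc P br H +>\<^bsub>free_algebra H\<^esub> p"

text \<open>The canonical maps from \<open>V\<close> and \<open>H\<close> into these algebras.\<close>

definition sym_gen ::
    "('k::field \<Rightarrow> 'g::ab_group_add \<Rightarrow> 'g) \<Rightarrow> (bit \<Rightarrow> 'g set) \<Rightarrow> 'g set
      \<Rightarrow> 'g \<Rightarrow> ('g list \<Rightarrow>\<^sub>0 'k) set" where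
  "sym_gen sc P V x = sym_class sc P V (Poly_Mapping.single [x] 1)"

definition env_gen ::
    "('k::field \<Rightarrow> 'g::ab_group_add \<Rightarrow> 'g) \<Rightarrow> (bit \<Rightarrow> 'g set) \<Rightarrow> ('g \<Rightarrow> 'g \<Rightarrow> 'g) \<Rightarrow> 'g set
      \<Rightarrow> 'g \<Rightarrow> ('g list \<Rightarrow>\<^sub>0 'k) set" where
  "env_gen sc P br H x = env_class sc P br H (Poly_Mapping.single [x] 1)"

text \<open>Linear maps between carriers, made undefined off the domain so that they are determined there.\<close>

definition linear_maps ::
    "('k, 'a) module \<Rightarrow> ('k, 'b) module \<Rightarrow> ('a \<Rightarrow> 'b) set" where
  "linear_maps S T = {f \<in> carrier S \<rightarrow>\<^sub>E carrier T.
     (\<forall>A\<in>carrier S. \<forall>B\<in>carrier S. f (A \<oplus>\<^bsub>S\<^esub> B) = f A \<oplus>\<^bsub>T\<^esub> f B) \<and>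
     (\<forall>c. \<forall>A\<in>carrier S. f (c \<odot>\<^bsub>S\<^esub> A) = c \<odot>\<^bsub>T\<^esub> f A)}"

text \<open>\<open>homogeneous_list P V xs ps\<close>: the entries of \<open>xs\<close> are homogeneous of parities \<open>ps\<close>.\<close>

definition homogeneous_list :: "(bit \<Rightarrow> 'g set) \<Rightarrow> 'g set \<Rightarrow> 'g list \<Rightarrow> bit list \<Rightarrow> bool" where
  "homogeneous_list P V xs ps \<longleftrightarrow> list_all2 (\<lambda>x p. x \<in> V \<inter> P p) xs ps"

text \<open>
  \<open>koszul_sign ps t\<close> is the sign for which \<open>x\<^sub>0 \<cdots> x\<^sub>n = koszul_sign ps t x\<^bsub>t 0\<^esub> \<cdots> x\<^bsub>t n\<^esub>\<close>
  holds for supercommuting \<open>x\<^sub>i\<close> of parity \<open>ps ! i\<close>.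
\<close>

definition koszul_sign :: "bit list \<Rightarrow> (nat \<Rightarrow> nat) \<Rightarrow> 'k::comm_ring_1" where
  "koszul_sign ps t =
     (\<Prod>(i, j) \<in> {(i, j). i < j \<and> j < length ps \<and> t i > t j}. ksign (ps ! t i) (ps ! t j))"

definition symmetrised ::
    "'g list \<Rightarrow> bit list \<Rightarrow> ('g list \<Rightarrow>\<^sub>0 'k::field_char_0)" where
  "symmetrised xs ps = Poly_Mapping.single [] (1 / fact (length xs)) *
     (\<Sum>t | t permutes {..<length xs}. Poly_Mapping.single (permute_list t xs) (koszul_sign ps t))"

text \<open>The symmetrisation map from the supersymmetric algebra of \<open>V\<close> to the enveloping algebra of
  the whole Lie superalgebra.\<close>

definition symmetrisation ::
    "('k::field_char_0 \<Rightarrow> 'g::ab_group_add \<Rightarrow> 'g) \<Rightarrow> (bit \<Rightarrow> 'g set) \<Rightarrow> ('g \<Rightarrow> 'g \<Rightarrow> 'g) \<Rightarrow> 'g set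
      \<Rightarrow> ('g list \<Rightarrow>\<^sub>0 'k) set \<Rightarrow> ('g list \<Rightarrow>\<^sub>0 'k) set" where
  "symmetrisation sc P br V =
     (THE f. f \<in> linear_maps (sym_algebra sc P V) (env_algebra sc P br UNIV) \<and>
        (\<forall>xs ps. homogeneous_list P V xs ps \<longrightarrow>
           f (sym_class sc P V (Poly_Mapping.single xs 1)) =
           env_class sc P br UNIV (symmetrised xs ps)))"


section \<open>Super derivations and the Weyl superalgebra\<close>

definition sym_part ::
    "('k::field \<Rightarrow> 'g::ab_group_add \<Rightarrow> 'g) \<Rightarrow> (bit \<Rightarrow> 'g set) \<Rightarrow> 'g set
      \<Rightarrow> bit \<Rightarrow> ('g list \<Rightarrow>\<^sub>0 'k) set set" where
  "sym_part sc P V p = generate (add_monoid (sym_algebra sc P V))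
     {sym_class sc P V (Poly_Mapping.single xs c) | xs ps c.
        homogeneous_list P V xs ps \<and> sum_list ps = p}"

definition super_derivation ::
    "('k::field \<Rightarrow> 'g::ab_group_add \<Rightarrow> 'g) \<Rightarrow> (bit \<Rightarrow> 'g set) \<Rightarrow> 'g set
      \<Rightarrow> bit \<Rightarrow> (('g list \<Rightarrow>\<^sub>0 'k) set \<Rightarrow> ('g list \<Rightarrow>\<^sub>0 'k) set) \<Rightarrow> bool" where
  "super_derivation sc P V p D \<longleftrightarrow>
     (let S = sym_algebra sc P V in
        D \<in> linear_maps S S \<and>
        (\<forall>q. \<forall>A\<in>sym_part sc P V q. D A \<in> sym_part sc P V (p + q)) \<and>
        (\<forall>q. \<forall>A\<in>sym_part sc P V q. \<forall>B\<in>carrier S.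
           D (A \<otimes>\<^bsub>S\<^esub> B) = D A \<otimes>\<^bsub>S\<^esub> B \<oplus>\<^bsub>S\<^esub> ksign p q \<odot>\<^bsub>S\<^esub> (A \<otimes>\<^bsub>S\<^esub> D B)))"

text \<open>The derivation dual to the \<open>i\<close>-th of the basis vectors \<open>X 1, \<dots>, X n\<close>.\<close>

definition partial_deriv ::
    "('k::field \<Rightarrow> 'g::ab_group_add \<Rightarrow> 'g) \<Rightarrow> (bit \<Rightarrow> 'g set) \<Rightarrow> 'g set \<Rightarrow> nat \<Rightarrow> (nat \<Rightarrow> 'g)
      \<Rightarrow> nat \<Rightarrow> ('g list \<Rightarrow>\<^sub>0 'k) set \<Rightarrow> ('g list \<Rightarrow>\<^sub>0 'k) set" where
  "partial_deriv sc P V n X i =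
     (THE D. (\<exists>p. super_derivation sc P V p D) \<and>
        (\<forall>j\<in>{1..n}. D (sym_gen sc P V (X j)) =
           (if i = j then \<one>\<^bsub>sym_algebra sc P V\<^esub> else \<zero>\<^bsub>sym_algebra sc P V\<^esub>)))"

text \<open>
  The unital subalgebra of the endomorphism algebra generated by multiplications and super
  derivations. Homogeneous super derivations suffice, since sums are taken.
\<close>

inductive_set weyl_algebra ::
    "('k::field \<Rightarrow> 'g::ab_group_add \<Rightarrow> 'g) \<Rightarrow> (bit \<Rightarrow> 'g set) \<Rightarrow> 'g set
      \<Rightarrow> (('g list \<Rightarrow>\<^sub>0 'k) set \<Rightarrow> ('g list \<Rightarrow>\<^sub>0 'k) set) set"
  for sc P V where
  ident: "(\<lambda>Y\<in>carrier (sym_algebra sc P V). Y) \<in> weyl_algebra sc P V"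
| mult: "x \<in> V \<Longrightarrow>
    (\<lambda>Y\<in>carrier (sym_algebra sc P V). sym_gen sc P V x \<otimes>\<^bsub>sym_algebra sc P V\<^esub> Y)
      \<in> weyl_algebra sc P V"
| deriv: "super_derivation sc P V p D \<Longrightarrow> D \<in> weyl_algebra sc P V"
| add: "D \<in> weyl_algebra sc P V \<Longrightarrow> E \<in> weyl_algebra sc P V \<Longrightarrow>
    (\<lambda>Y\<in>carrier (sym_algebra sc P V). D Y \<oplus>\<^bsub>sym_algebra sc P V\<^esub> E Y) \<in> weyl_algebra sc P V"
| smult: "D \<in> weyl_algebra sc P V \<Longrightarrow>
    (\<lambda>Y\<in>carrier (sym_algebra sc P V). c \<odot>\<^bsub>sym_algebra sc P V\<^esub> D Y) \<in> weyl_algebra sc P V"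
| comp: "D \<in> weyl_algebra sc P V \<Longrightarrow> E \<in> weyl_algebra sc P V \<Longrightarrow>
    compose (carrier (sym_algebra sc P V)) D E \<in> weyl_algebra sc P V"


section \<open>The induced module\<close>

text \<open>
  The action of the enveloping algebra of the subalgebra \<open>H\<close> on the one-dimensional module
  defined by a character \<open>lam\<close> of \<open>H\<close>: a class acts as multiplication by the common value of
  \<open>eval_char lam\<close> on its representatives.
\<close>

definition eval_char :: "('g \<Rightarrow> 'k) \<Rightarrow> ('g list \<Rightarrow>\<^sub>0 'k::comm_ring_1) \<Rightarrow> 'k" where
  "eval_char lam p =
     (\<Sum>w\<in>Poly_Mapping.keys p. Poly_Mapping.lookup p w * prod_list (map lam w))"

definition char_action :: "('g \<Rightarrow> 'k) \<Rightarrow> ('g list \<Rightarrow>\<^sub>0 'k::comm_ring_1) set \<Rightarrow> 'k \<Rightarrow> 'k" where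
  "char_action lam A v = the_elem (eval_char lam ` A) * v"

text \<open>The map induced by the inclusion of a subalgebra, from its enveloping algebra to the
  enveloping algebra of the whole Lie superalgebra.\<close>

definition env_incl ::
    "('k::field \<Rightarrow> 'g::ab_group_add \<Rightarrow> 'g) \<Rightarrow> (bit \<Rightarrow> 'g set) \<Rightarrow> ('g \<Rightarrow> 'g \<Rightarrow> 'g)
      \<Rightarrow> ('g list \<Rightarrow>\<^sub>0 'k) set \<Rightarrow> ('g list \<Rightarrow>\<^sub>0 'k) set" where
  "env_incl sc P br A = env_ideal sc P br UNIV <+>\<^bsub>free_algebra UNIV\<^esub> A"

text \<open>
  The tensor product over the noncommutative ring \<open>env_algebra sc P br H\<close> is the free abelian group
  on all pairs modulo biadditivity and balancedness. As the constants belong to that ring, it is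
  automatically bilinear over the ground field.
\<close>

definition tensor_free ::
    "('k::field \<Rightarrow> 'g::ab_group_add \<Rightarrow> 'g) \<Rightarrow> (bit \<Rightarrow> 'g set) \<Rightarrow> ('g \<Rightarrow> 'g \<Rightarrow> 'g)
      \<Rightarrow> ((('g list \<Rightarrow>\<^sub>0 'k) set \<times> 'k) \<Rightarrow>\<^sub>0 int) monoid" where
  "tensor_free sc P br = free_Abelian_group (carrier (env_algebra sc P br UNIV) \<times> UNIV)"

definition tensor_rels ::
    "('k::field \<Rightarrow> 'g::ab_group_add \<Rightarrow> 'g) \<Rightarrow> (bit \<Rightarrow> 'g set) \<Rightarrow> ('g \<Rightarrow> 'g \<Rightarrow> 'g) \<Rightarrow> 'g set
      \<Rightarrow> ('g \<Rightarrow> 'k) \<Rightarrow> ((('g list \<Rightarrow>\<^sub>0 'k) set \<times> 'k) \<Rightarrow>\<^sub>0 int) set" where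
  "tensor_rels sc P br H lam =
     (let U = env_algebra sc P br UNIV in
        {frag_of (u \<oplus>\<^bsub>U\<^esub> u', v) - frag_of (u, v) - frag_of (u', v)
          | u u' v. u \<in> carrier U \<and> u' \<in> carrier U} \<union>
        {frag_of (u, v + v') - frag_of (u, v) - frag_of (u, v') | u v v'. u \<in> carrier U} \<union>
        {frag_of (u \<otimes>\<^bsub>U\<^esub> env_incl sc P br a, v) - frag_of (u, char_action lam a v)
          | u a v. u \<in> carrier U \<and> a \<in> carrier (env_algebra sc P br H)})"

definition tensor_sub ::
    "('k::field \<Rightarrow> 'g::ab_group_add \<Rightarrow> 'g) \<Rightarrow> (bit \<Rightarrow> 'g set) \<Rightarrow> ('g \<Rightarrow> 'g \<Rightarrow> 'g) \<Rightarrow> 'g set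
      \<Rightarrow> ('g \<Rightarrow> 'k) \<Rightarrow> ((('g list \<Rightarrow>\<^sub>0 'k) set \<times> 'k) \<Rightarrow>\<^sub>0 int) set" where
  "tensor_sub sc P br H lam = generate (tensor_free sc P br) (tensor_rels sc P br H lam)"

definition pure_tensor ::
    "('k::field \<Rightarrow> 'g::ab_group_add \<Rightarrow> 'g) \<Rightarrow> (bit \<Rightarrow> 'g set) \<Rightarrow> ('g \<Rightarrow> 'g \<Rightarrow> 'g) \<Rightarrow> 'g set
      \<Rightarrow> ('g \<Rightarrow> 'k) \<Rightarrow> ('g list \<Rightarrow>\<^sub>0 'k) set \<Rightarrow> 'k
      \<Rightarrow> ((('g list \<Rightarrow>\<^sub>0 'k) set \<times> 'k) \<Rightarrow>\<^sub>0 int) set" where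
  "pure_tensor sc P br H lam u v = tensor_sub sc P br H lam #>\<^bsub>tensor_free sc P br\<^esub> frag_of (u, v)"

text \<open>The left action of the enveloping algebra, \<open>a (u \<otimes> v) = (a u) \<otimes> v\<close>.\<close>

definition tensor_action ::
    "('k::field \<Rightarrow> 'g::ab_group_add \<Rightarrow> 'g) \<Rightarrow> (bit \<Rightarrow> 'g set) \<Rightarrow> ('g \<Rightarrow> 'g \<Rightarrow> 'g) \<Rightarrow> 'g set
      \<Rightarrow> ('g \<Rightarrow> 'k) \<Rightarrow> ('g list \<Rightarrow>\<^sub>0 'k) set
      \<Rightarrow> ((('g list \<Rightarrow>\<^sub>0 'k) set \<times> 'k) \<Rightarrow>\<^sub>0 int) set
      \<Rightarrow> ((('g list \<Rightarrow>\<^sub>0 'k) set \<times> 'k) \<Rightarrow>\<^sub>0 int) set" where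
  "tensor_action sc P br H lam a A = tensor_sub sc P br H lam <#>\<^bsub>tensor_free sc P br\<^esub>
     (frag_extend (\<lambda>(u, v). frag_of (a \<otimes>\<^bsub>env_algebra sc P br UNIV\<^esub> u, v)) ` A)"

text \<open>As usual for \<^typ>\<open>('a, 'b) module\<close> records, the multiplicative fields are irrelevant.\<close>

definition induced_module ::
    "('k::field \<Rightarrow> 'g::ab_group_add \<Rightarrow> 'g) \<Rightarrow> (bit \<Rightarrow> 'g set) \<Rightarrow> ('g \<Rightarrow> 'g \<Rightarrow> 'g) \<Rightarrow> 'g set
      \<Rightarrow> ('g \<Rightarrow> 'k) \<Rightarrow> ('k, ((('g list \<Rightarrow>\<^sub>0 'k) set \<times> 'k) \<Rightarrow>\<^sub>0 int) set) module" where
  "induced_module sc P br H lam =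
     (let M = tensor_free sc P br Mod tensor_sub sc P br H lam in
       \<lparr>carrier = carrier M, monoid.mult = undefined, one = undefined,
        ring.zero = \<one>\<^bsub>M\<^esub>, add = (\<otimes>\<^bsub>M\<^esub>),
        smult = (\<lambda>c. tensor_action sc P br H lam
                       (env_class sc P br UNIV (Poly_Mapping.single [] c)))\<rparr>)"

text \<open>The map \<open>Y \<mapsto> \<sigma>(Y) \<otimes> 1\<close> and the action transported along it.\<close>

definition induced_iso ::
    "('k::field_char_0 \<Rightarrow> 'g::ab_group_add \<Rightarrow> 'g) \<Rightarrow> (bit \<Rightarrow> 'g set) \<Rightarrow> ('g \<Rightarrow> 'g \<Rightarrow> 'g)
      \<Rightarrow> (int \<Rightarrow> 'g set) \<Rightarrow> ('g \<Rightarrow> 'k) \<Rightarrow> ('g list \<Rightarrow>\<^sub>0 'k) set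
      \<Rightarrow> ((('g list \<Rightarrow>\<^sub>0 'k) set \<times> 'k) \<Rightarrow>\<^sub>0 int) set" where
  "induced_iso sc P br W lam =
     (\<lambda>Y\<in>carrier (sym_algebra sc P (W (-1))).
        pure_tensor sc P br (kpart W) (extend_char W lam) (symmetrisation sc P br (W (-1)) Y) 1)"

definition induced_rep ::
    "('k::field_char_0 \<Rightarrow> 'g::ab_group_add \<Rightarrow> 'g) \<Rightarrow> (bit \<Rightarrow> 'g set) \<Rightarrow> ('g \<Rightarrow> 'g \<Rightarrow> 'g)
      \<Rightarrow> (int \<Rightarrow> 'g set) \<Rightarrow> ('g \<Rightarrow> 'k) \<Rightarrow> 'g
      \<Rightarrow> ('g list \<Rightarrow>\<^sub>0 'k) set \<Rightarrow> ('g list \<Rightarrow>\<^sub>0 'k) set" where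
  "induced_rep sc P br W lam x =
     (\<lambda>Y\<in>carrier (sym_algebra sc P (W (-1))).
        the_inv_into (carrier (sym_algebra sc P (W (-1)))) (induced_iso sc P br W lam)
          (tensor_action sc P br (kpart W) (extend_char W lam) (env_gen sc P br UNIV x)
            (induced_iso sc P br W lam Y)))"

end

theory Submission
  imports Defs
begin

text \<open>
  No Poincare-Birkhoff-Witt theorem is needed. The right-hand sides of the three formulas define
  operators on the supersymmetric algebra. Their commutators with multiplication by an element of
  \<open>V = W (-1)\<close> follow from the Leibniz rule. For two elements of degree 0 or 1, the difference between
  the two sides of the bracket relation therefore supercommutes with multiplication by \<open>V\<close> and kills
  the unit, hence vanishes, so the formulas define a representation of the Lie superalgebra.
  Evaluating its enveloping algebra on the unit kills the relations of the tensor product and gives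
  a left inverse of \<open>Y \<mapsto> \<sigma>(Y) \<otimes> 1\<close>. The same commutation rules hold in the induced module, so there
  \<open>x \<sigma>(Y) \<otimes> 1\<close> is the image of the formula applied to \<open>Y\<close>, which gives surjectivity and the
  transported action. The symmetrisation map causes no difficulty because \<open>V\<close> is supercommutative, so
  \<open>\<sigma>\<close> is induced by the inclusion of \<open>V\<close>.
\<close>

section \<open>Free algebras and their quotients\<close>

text \<open>The computations take place in free algebras, where the letter x + y differs from the
  sum of the letters x and y, so the operators represent the Lie superalgebra only modulo the
  symmetric ideal. Parity is tracked by twisting letters instead of by signs, which makes the
  Leibniz rule hold for all polynomials, homogeneous or not. The bracket relation is obtained by
  descent on degree. Testing it for x, y against z in V brings in the relations for the pairs x,
  [y,z] and y, [x,z], whose total degree is one lower; hence the order (0,0), (0,1), (1,1), starting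
  from pairs with one member in V. The triple brackets left over cancel by the Jacobi identity. The
  factor 1/2 in degree 1 has this source: applying two derivatives to y q leaves two sums in which y
  is consumed, and these coincide because [[x,u],v] is supersymmetric in u, v, which is Jacobi
  together with [u,v] = 0. Characteristic zero also supplies the 1/n! of the symmetriser and the
  projections onto parity components.\<close>

abbreviation monom :: "'g list \<Rightarrow> 'g list \<Rightarrow>\<^sub>0 'k::field"
  where "monom w \<equiv> Poly_Mapping.single w 1"

abbreviation const :: "'k::field \<Rightarrow> 'g list \<Rightarrow>\<^sub>0 'k"
  where "const c \<equiv> Poly_Mapping.single [] c"

definition polys :: "'g set \<Rightarrow> ('g list \<Rightarrow>\<^sub>0 'k::field) set"
  where "polys V = {p. Poly_Mapping.keys p \<subseteq> lists V}"

lemma single_mult_list [simp]: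
  "Poly_Mapping.single u a * Poly_Mapping.single v b = Poly_Mapping.single (u @ v) (a * b)"
  by (simp add: mult_single plus_list_def)

lemma const_one [simp]: "const 1 = 1"
  using single_one[where 'a = "'g list"] by (simp add: zero_list_def)

lemma const_add: "const (a + b) = const a + const b"
  by (simp add: single_add)

lemma poly_mapping_sum_single: "p = (\<Sum>w\<in>Poly_Mapping.keys p. Poly_Mapping.single w (Poly_Mapping.lookup p w))"
proof (rule poly_mapping_eqI)
  fix k
  show "Poly_Mapping.lookup p k =
      Poly_Mapping.lookup (\<Sum>w\<in>Poly_Mapping.keys p. Poly_Mapping.single w (Poly_Mapping.lookup p w)) k"
    by (cases "k \<in> Poly_Mapping.keys p")
      (auto simp: lookup_sum lookup_single when_def in_keys_iff)
qed

lemma single_polys: "w \<in> lists V \<Longrightarrow> Poly_Mapping.single w c \<in> polys V"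
  by (auto simp: polys_def)

lemma const_polys: "const c \<in> polys V"
  by (auto simp: polys_def)

lemma one_polys: "1 \<in> polys V"
  using const_polys[of 1] by simp

lemma zero_polys: "0 \<in> polys V"
  by (simp add: polys_def)

lemma polys_add: "p \<in> polys V \<Longrightarrow> q \<in> polys V \<Longrightarrow> p + q \<in> polys V"
  using Poly_Mapping.keys_add[of p q] by (auto simp: polys_def)

lemma polys_uminus: "p \<in> polys V \<Longrightarrow> - p \<in> polys V"
  by (simp add: polys_def)

lemma polys_diff: "p \<in> polys V \<Longrightarrow> q \<in> polys V \<Longrightarrow> p - q \<in> polys V"
  using polys_add[of p V "- q"] polys_uminus[of q V] by simp

lemma polys_mult: "p \<in> polys V \<Longrightarrow> q \<in> polys V \<Longrightarrow> p * q \<in> polys V"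
  using Poly_Mapping.keys_mult[of p q] by (fastforce simp: plus_list_def polys_def)

lemma polys_sum: "(\<And>i. i \<in> I \<Longrightarrow> f i \<in> polys V) \<Longrightarrow> (\<Sum>i\<in>I. f i) \<in> polys V"
  by (induction I rule: infinite_finite_induct) (auto intro: polys_add zero_polys)

lemmas polys_intros = polys_add polys_uminus polys_diff polys_mult polys_sum
  const_polys one_polys zero_polys single_polys

lemma polys_UNIV: "p \<in> polys UNIV"
  by (simp add: polys_def)

text \<open>Claims about polynomials are reduced to words. Scaling is phrased as left multiplication
  by a constant, the form in which the linear operators below are stated; the zero polynomial is
  covered as 0 times the empty word.\<close>

lemma polys_induct [consumes 1, case_names monom scale add]:
  assumes "p \<in> polys V"
    and "\<And>w. w \<in> lists V \<Longrightarrow> Q (monom w)"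
    and scale: "\<And>c q. q \<in> polys V \<Longrightarrow> Q q \<Longrightarrow> Q (const c * q)"
    and add: "\<And>q q'. q \<in> polys V \<Longrightarrow> q' \<in> polys V \<Longrightarrow> Q q \<Longrightarrow> Q q' \<Longrightarrow> Q (q + q')"
  shows "Q p"
proof -
  have single: "Q (Poly_Mapping.single w c)" if "w \<in> lists V" for w c
    using scale[of "monom w" c] assms(2)[OF that] single_polys[OF that, of 1] by simp
  have zero: "Q 0"
    using single[of "[]" 0] by simp
  have "Q (\<Sum>w\<in>A. Poly_Mapping.single w (Poly_Mapping.lookup p w))" if "finite A" "A \<subseteq> lists V" for A
    using that
  proof (induction A rule: finite_induct)
    case empty
    then show ?case using zero by simp
  next
    case (insert w A)
    then have "(\<Sum>w\<in>A. Poly_Mapping.single w (Poly_Mapping.lookup p w)) \<in> polys V"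
      by (intro polys_sum single_polys) auto
    then show ?case
      using insert single[of w] by (auto intro!: add single_polys)
  qed
  from this[of "Poly_Mapping.keys p"] show ?thesis
    using assms(1) poly_mapping_sum_single[of p] by (simp add: polys_def)
qed

lemmas poly_mapping_list_induct = polys_induct[OF polys_UNIV, case_names monom scale add]

lemma const_commute: "const c * p = p * const c"
proof (induction p rule: poly_mapping_list_induct)
  case (scale d q)
  have "const c * (const d * q) = const d * (const c * q)"
    by (simp only: mult.assoc[symmetric] single_mult_list) (simp add: mult.commute)
  also have "\<dots> = const d * q * const c"
    by (simp add: scale mult.assoc)
  finally show ?case .
qed (simp_all add: mult.commute algebra_simps)

lemma free_algebra_simps [simp]:
  "carrier (free_algebra V) = polys V" "\<zero>\<^bsub>free_algebra V\<^esub> = 0" "\<one>\<^bsub>free_algebra V\<^esub> = 1"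
  "p \<oplus>\<^bsub>free_algebra V\<^esub> q = p + q" "p \<otimes>\<^bsub>free_algebra V\<^esub> q = p * q"
  by (simp_all add: free_algebra_def polys_def)

lemma ring_free_algebra: "ring (free_algebra V :: ('g list \<Rightarrow>\<^sub>0 'k::field) ring)" (is "ring ?F")
proof (rule ringI)
  show "abelian_group ?F"
  proof (rule abelian_groupI)
    fix x assume "x \<in> carrier ?F"
    then show "\<exists>y\<in>carrier ?F. y \<oplus>\<^bsub>?F\<^esub> x = \<zero>\<^bsub>?F\<^esub>"
      by (intro bexI[of _ "- x"]) (auto intro: polys_uminus)
  qed (auto simp: add_ac intro: polys_add zero_polys)
  show "Group.monoid ?F"
    by standard (auto simp: mult.assoc intro: polys_mult one_polys)
qed (auto simp: algebra_simps)

lemma free_algebra_a_inv: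
  assumes p: "p \<in> polys V"
  shows "\<ominus>\<^bsub>free_algebra V :: ('g list \<Rightarrow>\<^sub>0 'k::field) ring\<^esub> p = - p"
proof -
  interpret ring "free_algebra V :: ('g list \<Rightarrow>\<^sub>0 'k) ring" by (rule ring_free_algebra)
  show ?thesis
    using p polys_uminus[OF p] by (intro minus_equality) auto
qed

section \<open>Quotients of the free algebra by an ideal, used for S(V), U(g) and U(k)\<close>

locale free_quotient =
  fixes V :: "'g set" and J :: "('g list \<Rightarrow>\<^sub>0 'k::field) set"
  assumes ideal_J: "ideal J (free_algebra V)"
begin

sublocale R: ideal J "free_algebra V"
  by (rule ideal_J)

abbreviation cls where "cls p \<equiv> J +>\<^bsub>free_algebra V\<^esub> p"

abbreviation A where "A \<equiv> quot_algebra V J"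

lemma J_polys: "p \<in> J \<Longrightarrow> p \<in> polys V"
  using R.a_subset by auto

lemma J_zero: "0 \<in> J"
  using additive_subgroup.zero_closed[OF R.is_additive_subgroup] by simp

lemma J_add: "p \<in> J \<Longrightarrow> q \<in> J \<Longrightarrow> p + q \<in> J"
  using additive_subgroup.a_closed[OF R.is_additive_subgroup] by simp

lemma J_mult_left: "p \<in> J \<Longrightarrow> q \<in> polys V \<Longrightarrow> q * p \<in> J"
  using R.I_l_closed by simp

lemma J_mult_right: "p \<in> J \<Longrightarrow> q \<in> polys V \<Longrightarrow> p * q \<in> J"
  using R.I_r_closed by simp

lemma J_scale: "p \<in> J \<Longrightarrow> const c * p \<in> J"
  by (rule J_mult_left) (auto simp: const_polys)

lemma J_uminus: "p \<in> J \<Longrightarrow> - p \<in> J"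
  using J_scale[of p "-1"] by (simp add: single_uminus)

lemma J_diff: "p \<in> J \<Longrightarrow> q \<in> J \<Longrightarrow> p - q \<in> J"
  using J_add[of p "- q"] J_uminus[of q] by simp

lemma J_sum: "(\<And>i. i \<in> I \<Longrightarrow> f i \<in> J) \<Longrightarrow> (\<Sum>i\<in>I. f i) \<in> J"
  by (induction I rule: infinite_finite_induct) (auto intro: J_add J_zero)

text \<open>Congruence of representatives replaces equality of cosets: it chains in calculations and
  asks for no carrier condition on \<open>p\<close> and \<open>q\<close> individually.\<close>

definition eqv :: "('g list \<Rightarrow>\<^sub>0 'k) \<Rightarrow> ('g list \<Rightarrow>\<^sub>0 'k) \<Rightarrow> bool"
  where "eqv p q \<longleftrightarrow> p - q \<in> J"

lemma eqv_refl [simp, intro]: "eqv p p"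
  by (simp add: eqv_def J_zero)

lemma eqv_sym: "eqv p q \<Longrightarrow> eqv q p"
  using J_uminus[of "p - q"] by (simp add: eqv_def)

lemma eqv_trans [trans]: "eqv p q \<Longrightarrow> eqv q t \<Longrightarrow> eqv p t"
  using J_add[of "p - q" "q - t"] by (simp add: eqv_def)

lemma eqv_eq_trans [trans]: "eqv p q \<Longrightarrow> q = t \<Longrightarrow> eqv p t" "p = q \<Longrightarrow> eqv q t \<Longrightarrow> eqv p t"
  by simp_all

lemma eqv_add: "eqv p q \<Longrightarrow> eqv p' q' \<Longrightarrow> eqv (p + p') (q + q')"
  using J_add[of "p - q" "p' - q'"] by (simp add: eqv_def algebra_simps)

lemma eqv_uminus: "eqv p q \<Longrightarrow> eqv (- p) (- q)"
  using J_uminus[of "p - q"] by (simp add: eqv_def algebra_simps)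

lemma eqv_diff: "eqv p q \<Longrightarrow> eqv p' q' \<Longrightarrow> eqv (p - p') (q - q')"
  using eqv_add[of p q "- p'" "- q'"] eqv_uminus[of p' q'] by simp

lemma eqv_sum: "(\<And>i. i \<in> I \<Longrightarrow> eqv (f i) (g i)) \<Longrightarrow> eqv (\<Sum>i\<in>I. f i) (\<Sum>i\<in>I. g i)"
  by (induction I rule: infinite_finite_induct) (auto intro: eqv_add)

lemma eqv_mult_left: "eqv p q \<Longrightarrow> t \<in> polys V \<Longrightarrow> eqv (t * p) (t * q)"
  using J_mult_left[of "p - q" t] by (simp add: eqv_def algebra_simps)

lemma eqv_mult_right: "eqv p q \<Longrightarrow> t \<in> polys V \<Longrightarrow> eqv (p * t) (q * t)"
  using J_mult_right[of "p - q" t] by (simp add: eqv_def algebra_simps)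

lemma eqv_scale: "eqv p q \<Longrightarrow> eqv (const c * p) (const c * q)"
  by (rule eqv_mult_left) (auto simp: const_polys)

lemma eqv_J: "eqv p q \<Longrightarrow> q \<in> J \<Longrightarrow> p \<in> J"
  using J_add[of "p - q" q] by (simp add: eqv_def)

lemma eqv_0: "eqv p 0 \<longleftrightarrow> p \<in> J"
  by (simp add: eqv_def)

lemma cls_eq: "cls p = (\<lambda>j. j + p) ` J"
  by (auto simp: a_r_coset_def' )

lemma mem_cls: "q \<in> cls p \<longleftrightarrow> eqv q p"
  by (auto simp: cls_eq eqv_def image_iff) (metis diff_add_cancel)

lemma cls_eq_iff: "cls p = cls q \<longleftrightarrow> eqv p q"
  by (auto simp: set_eq_iff mem_cls intro: eqv_trans eqv_sym)

lemma carrier_A: "carrier A = cls ` polys V"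
  by (auto simp: quot_algebra_def ring.defs FactRing_def A_RCOSETS_def')

lemma cls_in_A [simp]: "p \<in> polys V \<Longrightarrow> cls p \<in> carrier A"
  by (auto simp: carrier_A)

lemma carrier_AE:
  assumes "Y \<in> carrier A"
  obtains p where "p \<in> polys V" "Y = cls p"
  using assms by (auto simp: carrier_A)

lemma zero_A: "\<zero>\<^bsub>A\<^esub> = cls 0"
  by (auto simp: quot_algebra_def ring.defs FactRing_def cls_eq)

lemma one_A: "\<one>\<^bsub>A\<^esub> = cls 1"
  by (auto simp: quot_algebra_def ring.defs FactRing_def)

lemma add_A:
  assumes "p \<in> polys V" "q \<in> polys V"
  shows "cls p \<oplus>\<^bsub>A\<^esub> cls q = cls (p + q)"
proof -
  have "abelian_subgroup J (free_algebra V)" ..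
  from abelian_subgroup.a_rcos_sum[OF this, of p q] show ?thesis
    using assms by (simp add: quot_algebra_def ring.defs FactRing_def)
qed

lemma mult_A: "p \<in> polys V \<Longrightarrow> q \<in> polys V \<Longrightarrow> cls p \<otimes>\<^bsub>A\<^esub> cls q = cls (p * q)"
  using R.rcoset_mult_add[of p q] by (simp add: quot_algebra_def ring.defs FactRing_def)

lemma scale_A: "p \<in> polys V \<Longrightarrow> c \<odot>\<^bsub>A\<^esub> cls p = cls (const c * p)"
  using R.rcoset_mult_add[of "const c" p] const_polys[of c V] by (simp add: quot_algebra_def ring.defs)

lemma ring_A: "ring A"
proof -
  interpret Q: ring "free_algebra V Quot J" by (rule R.quotient_is_ring)
  show ?thesis
  proof (rule ringI)
    show "abelian_group A"
      by (rule abelian_groupI)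
        (auto simp: quot_algebra_def ring.defs Q.a_assoc Q.a_comm Q.a_lcomm intro: Q.l_neg)
  qed (auto simp: quot_algebra_def ring.defs Q.m_assoc Q.l_distr Q.r_distr intro!: Group.monoid.intro)
qed

lemma finsum_A:
  assumes "\<And>i. i \<in> I \<Longrightarrow> f i \<in> polys V" "finite I"
  shows "(\<Oplus>\<^bsub>A\<^esub>i\<in>I. cls (f i)) = cls (\<Sum>i\<in>I. f i)"
proof -
  interpret A: ring A by (rule ring_A)
  show ?thesis
    using assms(2,1)
  proof (induction I rule: finite_induct)
    case empty
    then show ?case by (simp add: zero_A)
  next
    case (insert x F)
    then have "(\<Sum>i\<in>F. f i) \<in> polys V"
      by (intro polys_sum) auto
    moreover have "f x \<in> polys V" "\<And>i. i \<in> F \<Longrightarrow> cls (f i) \<in> carrier A"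
      using insert by (auto)
    moreover have "(\<Oplus>\<^bsub>A\<^esub>i\<in>F. cls (f i)) = cls (\<Sum>i\<in>F. f i)"
      using insert by (auto)
    ultimately show ?case
      using insert.hyps by (simp add: add_A Pi_def)
  qed
qed

end

section \<open>Ideals generated by relations\<close>

lemma genideal_free_algebra:
  fixes R :: "('g list \<Rightarrow>\<^sub>0 'k::field) set"
  assumes "R \<subseteq> polys V"
  shows "free_quotient V (genideal (free_algebra V) R)"
proof -
  interpret ring "free_algebra V :: ('g list \<Rightarrow>\<^sub>0 'k) ring" by (rule ring_free_algebra)
  show ?thesis
    using genideal_ideal[of R] assms by (simp add: free_quotient_def)
qed

text \<open>The members of the ideal that satisfy \<open>Q\<close> form an ideal containing the
  generators, and the generated ideal is the least one.\<close>

lemma genideal_free_algebra_induct [consumes 2, case_names rel zero add left right]: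
  fixes R :: "('g list \<Rightarrow>\<^sub>0 'k::field) set"
  assumes p: "p \<in> genideal (free_algebra V) R" and R: "R \<subseteq> polys V"
    and rel: "\<And>p. p \<in> R \<Longrightarrow> Q p"
    and zero: "Q 0"
    and add: "\<And>p q. p \<in> genideal (free_algebra V) R \<Longrightarrow> q \<in> genideal (free_algebra V) R \<Longrightarrow>
      Q p \<Longrightarrow> Q q \<Longrightarrow> Q (p + q)"
    and left: "\<And>p q. p \<in> genideal (free_algebra V) R \<Longrightarrow> q \<in> polys V \<Longrightarrow> Q p \<Longrightarrow> Q (q * p)"
    and right: "\<And>p q. p \<in> genideal (free_algebra V) R \<Longrightarrow> q \<in> polys V \<Longrightarrow> Q p \<Longrightarrow> Q (p * q)"
  shows "Q p"
proof -
  interpret free_quotient V "genideal (free_algebra V) R"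
    by (rule genideal_free_algebra[OF R])
  let ?J = "genideal (free_algebra V) R"
  let ?I = "{p \<in> ?J. Q p}"
  \<comment> \<open>Negation is multiplication by the constant -1, so it is covered by
    \<open>left\<close>.\<close>
  have neg: "- q \<in> ?I" if "q \<in> ?I" for q
    using that left[of q "const (-1)"] J_uminus[of q] const_polys[of "-1" V]
    by (simp add: single_uminus)
  have "ideal ?I (free_algebra V)"
  proof (rule idealI)
    show "subgroup ?I (add_monoid (free_algebra V))"
    proof (rule subgroup.intro)
      fix x assume x: "x \<in> ?I"
      then have "x \<in> polys V" using J_polys[of x] by blast
      then show "inv\<^bsub>add_monoid (free_algebra V)\<^esub> x \<in> ?I"
        using neg[OF x] free_algebra_a_inv[of x V] by (simp add: a_inv_def)
    qed (use J_polys in \<open>auto intro: add zero J_add J_zero\<close>)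
  qed (auto intro: left right J_mult_left J_mult_right ring_free_algebra)
  moreover have "R \<subseteq> ?I"
    using rel R.genideal_self[of R] R by auto
  ultimately have "?J \<subseteq> ?I"
    by (rule R.genideal_minimal)
  then show ?thesis using p by auto
qed

section \<open>Direct sums, parity and grading\<close>

lemma ksign_square [simp]: "ksign p q * ksign p q = (1 :: 'a::ring_1)"
  by (simp add: ksign_def)

lemma ksign_square' [simp]: "ksign p q * (ksign p q * x) = (x :: 'a::ring_1)"
  by (simp add: ksign_def)

lemma ksign_sym: "ksign p q = ksign q p"
  by (auto simp: ksign_def)

lemma ksign_0 [simp]: "ksign 0 q = 1" "ksign p 0 = 1"
  by (auto simp: ksign_def)

lemma ksign_add_left: "ksign (p + p') q = ksign p q * (ksign p' q :: 'a::ring_1)"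
  by (cases p; cases p'; cases q) (auto simp: ksign_def)

lemma ksign_add_right: "ksign q (p + p') = ksign q p * (ksign q p' :: 'a::ring_1)"
  by (cases p; cases p'; cases q) (auto simp: ksign_def)

text \<open>Chosen among all functions, without the extensionality of \<open>Pi\<^sub>E\<close>;
  uniqueness on \<open>I\<close> is recovered by restricting in
  \<open>direct_sum_unique\<close>.\<close>

definition summand :: "'i set \<Rightarrow> ('i \<Rightarrow> 'g::ab_group_add set) \<Rightarrow> 'g \<Rightarrow> 'i \<Rightarrow> 'g"
  where "summand I W x = (SOME f. (\<forall>i\<in>I. f i \<in> W i) \<and> (\<Sum>i\<in>I. f i) = x)"

context vector_space
begin

lemma direct_sum_unique:
  assumes "direct_sum scale I W U" "\<And>i. i \<in> I \<Longrightarrow> f i \<in> W i" "\<And>i. i \<in> I \<Longrightarrow> g i \<in> W i"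
    and "(\<Sum>i\<in>I. f i) = (\<Sum>i\<in>I. g i)" "i \<in> I"
  shows "f i = g i"
proof -
  have "inj_on (\<lambda>f. \<Sum>i\<in>I. f i) (Pi\<^sub>E I W)"
    using assms(1) by (simp add: direct_sum_def bij_betw_def)
  moreover have "restrict f I \<in> Pi\<^sub>E I W" "restrict g I \<in> Pi\<^sub>E I W"
    using assms(2,3) by auto
  moreover have "(\<Sum>i\<in>I. restrict f I i) = (\<Sum>i\<in>I. restrict g I i)"
    using assms(4) by simp
  ultimately have "restrict f I = restrict g I"
    unfolding inj_on_def by blast
  then show ?thesis
    using assms(5) by (metis restrict_apply')
qed

lemma summand:
  assumes "direct_sum scale I W U" "x \<in> U"
  shows "i \<in> I \<Longrightarrow> summand I W x i \<in> W i" and "(\<Sum>i\<in>I. summand I W x i) = x"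
proof -
  have "x \<in> (\<lambda>f. \<Sum>i\<in>I. f i) ` Pi\<^sub>E I W"
    using assms by (simp add: direct_sum_def bij_betw_def)
  then have "\<exists>f. (\<forall>i\<in>I. f i \<in> W i) \<and> (\<Sum>i\<in>I. f i) = x"
    by auto
  from someI_ex[OF this] show "i \<in> I \<Longrightarrow> summand I W x i \<in> W i" "(\<Sum>i\<in>I. summand I W x i) = x"
    by (auto simp: summand_def)
qed

lemma summand_unique:
  assumes "direct_sum scale I W U" "x \<in> U" "\<And>i. i \<in> I \<Longrightarrow> f i \<in> W i" "(\<Sum>i\<in>I. f i) = x" "i \<in> I"
  shows "summand I W x i = f i"
  using direct_sum_unique[OF assms(1), of "summand I W x" f i] summand[OF assms(1,2)] assms(3-5)
  by auto

lemma direct_sum_subspace: "direct_sum scale I W U \<Longrightarrow> i \<in> I \<Longrightarrow> subspace (W i)"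
  by (simp add: direct_sum_def)

lemma linear_summand:
  assumes "direct_sum scale I W UNIV" "i \<in> I"
  shows "Vector_Spaces.linear scale scale (\<lambda>x. summand I W x i)"
proof -
  note [simp] = summand[OF assms(1) UNIV_I]
  have "summand I W (x + y) i = summand I W x i + summand I W y i" for x y
    by (rule summand_unique[OF assms(1) UNIV_I _ _ assms(2)])
      (auto simp: sum.distrib intro: subspace_add direct_sum_subspace[OF assms(1)])
  moreover have "summand I W (scale c x) i = scale c (summand I W x i)" for c x
    by (rule summand_unique[OF assms(1) UNIV_I _ _ assms(2)])
      (auto simp: scale_sum_right[symmetric] intro: subspace_scale direct_sum_subspace[OF assms(1)])
  ultimately show ?thesis
    by (simp add: Vector_Spaces.linear_iff vector_space_axioms)
qed

lemma summand_mem: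
  assumes "direct_sum scale I W U" "x \<in> W i" "i \<in> I" "j \<in> I" "finite I"
  shows "summand I W x j = (if j = i then x else 0)"
proof (rule summand_unique[OF assms(1) _ _ _ assms(4)])
  let ?f = "\<lambda>j. if j = i then x else 0"
  show W: "\<And>k. k \<in> I \<Longrightarrow> ?f k \<in> W k"
    using assms subspace_0[OF direct_sum_subspace[OF assms(1)]] by auto
  show sum: "(\<Sum>k\<in>I. ?f k) = x"
    using assms by simp
  have "restrict ?f I \<in> Pi\<^sub>E I W"
    using W by auto
  then have "(\<Sum>k\<in>I. restrict ?f I k) \<in> U"
    using assms(1) bij_betwE[of "\<lambda>f. \<Sum>i\<in>I. f i" "Pi\<^sub>E I W" U] unfolding direct_sum_def by blast
  then show "x \<in> U"
    using sum by simp
qed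

end

section \<open>The data of the theorem: parity, grading, coordinates and character\<close>

locale graded_induction_data = three_graded_lie_superalgebra sc P br W
  for sc :: "'k::field_char_0 \<Rightarrow> 'g::ab_group_add \<Rightarrow> 'g" and P br W +
  fixes r s :: nat and X :: "nat \<Rightarrow> 'g" and lam :: "'g \<Rightarrow> 'k"
  assumes basis: "homogeneous_basis sc P (W (-1)) r s X"
    and character: "lie_character sc P br (W 0) lam"
begin

abbreviation V where "V \<equiv> W (-1)"

definition ppart where "ppart p x = summand {0, 1} P x p"

definition gpart where "gpart k x = summand {-1, 0, 1} W x k"

lemma P_subspace: "subspace (P p)"
  by (cases p) (auto intro: direct_sum_subspace[OF parity_decomposition])

lemma W_subspace: "subspace (W k)"
  using direct_sum_subspace[OF grading_decomposition] grading_bound[of k]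
  by (cases "k \<in> {-1, 0, 1}") (auto simp: subspace_single_0)

lemma ppart_in: "ppart p x \<in> P p"
  unfolding ppart_def by (rule summand[OF parity_decomposition]) (cases p; auto)+

lemma ppart_sum: "ppart 0 x + ppart 1 x = x"
  using summand(2)[OF parity_decomposition, of x] by (simp add: ppart_def)

lemma ppart_linear: "Vector_Spaces.linear sc sc (ppart p)"
  unfolding ppart_def by (rule linear_summand[OF parity_decomposition]) (cases p; auto)

lemma ppart_P: "x \<in> P q \<Longrightarrow> ppart p x = (if p = q then x else 0)"
  unfolding ppart_def by (rule summand_mem[OF parity_decomposition]) (cases p; cases q; auto)+

text \<open>The decomposition of \<open>x\<close> inside \<open>W k\<close> is also a parity
  decomposition in the whole space, so uniqueness identifies the two.\<close>

lemma ppart_W: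
  assumes "x \<in> W k"
  shows "ppart p x \<in> W k"
proof -
  let ?f = "summand {0, 1} (\<lambda>p. W k \<inter> P p) x"
  note d = summand[OF grading_parity assms]
  have "ppart p x = ?f p"
    unfolding ppart_def
    by (rule summand_unique[OF parity_decomposition]) (use d in \<open>cases p; auto\<close>)+
  then show ?thesis
    using d(1)[of p] by (cases p) auto
qed

lemma gpart_in: "k \<in> {-1, 0, 1} \<Longrightarrow> gpart k x \<in> W k"
  unfolding gpart_def by (rule summand[OF grading_decomposition]) auto

lemma gpart_sum: "gpart (-1) x + gpart 0 x + gpart 1 x = x"
  using summand(2)[OF grading_decomposition, of x] by (simp add: gpart_def algebra_simps)

lemma gpart_linear: "k \<in> {-1, 0, 1} \<Longrightarrow> Vector_Spaces.linear sc sc (gpart k)"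
  unfolding gpart_def by (rule linear_summand[OF grading_decomposition])

lemma gpart_W: "x \<in> W l \<Longrightarrow> l \<in> {-1, 0, 1} \<Longrightarrow> k \<in> {-1, 0, 1} \<Longrightarrow> gpart k x = (if k = l then x else 0)"
  unfolding gpart_def by (rule summand_mem[OF grading_decomposition]) auto

text \<open>Projecting all graded components of \<open>x\<close> to parity \<open>p\<close> gives a
  second graded decomposition of \<open>x\<close>; by uniqueness it is the original one.\<close>

lemma gpart_P:
  assumes "x \<in> P p" "k \<in> {-1, 0, 1}"
  shows "gpart k x \<in> P p"
proof -
  have "gpart k x = ppart p (gpart k x)"
    unfolding gpart_def
  proof (rule summand_unique[OF grading_decomposition _ _ _ assms(2)])
    have "(\<Sum>i\<in>{-1, 0, 1}. ppart p (gpart i x)) = ppart p (gpart (-1) x + gpart 0 x + gpart 1 x)"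
      by (simp add: Vector_Spaces.linear_iff[THEN iffD1, OF ppart_linear] algebra_simps)
    also have "\<dots> = x"
      using assms(1) by (simp add: gpart_sum ppart_P)
    finally show "(\<Sum>i\<in>{-1, 0, 1}. ppart p (summand {-1, 0, 1} W x i)) = x"
      by (simp add: gpart_def)
  qed (use ppart_W gpart_in in \<open>auto simp: gpart_def\<close>)
  then show ?thesis
    using ppart_in[of p "gpart k x"] by simp
qed

lemma br_simps:
  "br (x + y) z = br x z + br y z" "br z (x + y) = br z x + br z y"
  "br (sc c x) z = sc c (br x z)" "br z (sc c x) = sc c (br z x)"
  "br 0 z = 0" "br z 0 = 0" "br (- x) z = - br x z" "br z (- x) = - br z x"
proof -
  note l = br_linear_left[of z, unfolded Vector_Spaces.linear_iff]
    and r = br_linear_right[of z, unfolded Vector_Spaces.linear_iff]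
  show "br (x + y) z = br x z + br y z" "br z (x + y) = br z x + br z y"
    "br (sc c x) z = sc c (br x z)" "br z (sc c x) = sc c (br z x)"
    using l r by auto
  have "br (sc 0 x) z = sc 0 (br x z)" "br z (sc 0 x) = sc 0 (br z x)"
    "br (sc (-1) x) z = sc (-1) (br x z)" "br z (sc (-1) x) = sc (-1) (br z x)"
    using l r by blast+
  then show "br 0 z = 0" "br z 0 = 0" "br (- x) z = - br x z" "br z (- x) = - br z x"
    by simp_all
qed

text \<open>The bracket would have degree -2, outside the grading. This supercommutativity of
  \<open>V\<close> underlies both \<open>br_br_swap\<close> and \<open>JS_JU\<close>.\<close>

lemma br_V: "x \<in> V \<Longrightarrow> y \<in> V \<Longrightarrow> br x y = 0"
  using grading_br[of x "-1" y "-1"] grading_bound[of "-2"] by simp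

lemma br_W11: "x \<in> W 1 \<Longrightarrow> y \<in> W 1 \<Longrightarrow> br x y = 0"
  using grading_br[of x 1 y 1] grading_bound[of 2] by simp

text \<open>With \<open>twist p\<close> in place of the Koszul sign, the sign rule for moving a factor of parity \<open>p\<close> past
  \<open>x\<close> holds without assuming that \<open>x\<close> is homogeneous.\<close>

definition twist :: "bit \<Rightarrow> 'g \<Rightarrow> 'g"
  where "twist p x = ppart 0 x + sc (ksign p 1) (ppart 1 x)"

lemma twist_linear: "Vector_Spaces.linear sc sc (twist p)"
  using ppart_linear[of 0] ppart_linear[of 1]
  by (auto simp: twist_def Vector_Spaces.linear_iff algebra_simps)

lemma twist_add: "twist p (x + y) = twist p x + twist p y"
  and twist_scale: "twist p (sc c x) = sc c (twist p x)"
  using twist_linear[of p] by (auto simp: Vector_Spaces.linear_iff)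

lemma twist_P: "x \<in> P q \<Longrightarrow> twist p x = sc (ksign p q) x"
  by (cases q) (auto simp: twist_def ppart_P)

lemma twist_W: "x \<in> W k \<Longrightarrow> twist p x \<in> W k"
  by (auto simp: twist_def intro!: subspace_add subspace_scale W_subspace ppart_W)

lemma twist_0: "twist 0 x = x"
  by (simp add: twist_def ppart_sum)

lemma P_scale: "x \<in> P p \<Longrightarrow> sc c x \<in> P p"
  by (rule subspace_scale[OF P_subspace])

lemma W_scale: "x \<in> W k \<Longrightarrow> sc c x \<in> W k"
  by (rule subspace_scale[OF W_subspace])

lemma W_add: "x \<in> W k \<Longrightarrow> y \<in> W k \<Longrightarrow> x + y \<in> W k"
  by (rule subspace_add[OF W_subspace])

text \<open>On homogeneous components twists multiply by signs, and signs are multiplicative in the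
  parity. In particular equal twists cancel, which is how they disappear from the commutator
  computations.\<close>

lemma twist_twist: "twist p (twist q x) = twist (p + q) x"
proof -
  have "twist p (twist q (ppart a x)) = twist (p + q) (ppart a x)" for a
    by (simp only: twist_P[OF ppart_in] twist_scale scale_scale ksign_add_left mult.commute)
  then have "twist p (twist q (ppart 0 x + ppart 1 x)) = twist (p + q) (ppart 0 x + ppart 1 x)"
    by (simp only: twist_add)
  then show ?thesis
    by (simp add: ppart_sum)
qed

text \<open>The parity of \<open>X i\<close>, and hence of the partial derivative dual to
  it.\<close>

definition ip :: "nat \<Rightarrow> bit" where "ip i = (if i \<le> r then 0 else 1)"

definition coord :: "nat \<Rightarrow> 'g \<Rightarrow> 'k" where "coord i x = representation (X ` {1..r + s}) x (X i)"

lemma basis_facts: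
  "inj_on X {1..r + s}" "independent (X ` {1..r + s})" "span (X ` {1..r + s}) = V"
  "i \<in> {1..r + s} \<Longrightarrow> X i \<in> P (ip i)" "i \<in> {1..r + s} \<Longrightarrow> X i \<in> V"
  using basis span_base[of "X i" "X ` {1..r + s}"] by (auto simp: homogeneous_basis_def ip_def)

lemma coord_expand:
  assumes "x \<in> V"
  shows "(\<Sum>i\<in>{1..r + s}. sc (coord i x) (X i)) = x"
proof -
  have "(\<Sum>i\<in>{1..r + s}. sc (coord i x) (X i)) =
      (\<Sum>b\<in>X ` {1..r + s}. sc (representation (X ` {1..r + s}) x b) b)"
    using basis_facts(1) by (simp add: sum.reindex coord_def)
  also have "\<dots> = x"
    by (rule sum_representation_eq) (use assms basis_facts in auto)
  finally show ?thesis .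
qed

lemma coord_add: "x \<in> V \<Longrightarrow> y \<in> V \<Longrightarrow> coord i (x + y) = coord i x + coord i y"
  using basis_facts by (simp add: coord_def representation_add)

lemma coord_scale: "x \<in> V \<Longrightarrow> coord i (sc c x) = c * coord i x"
  using basis_facts by (simp add: coord_def representation_scale)

lemma coord_X: "i \<in> {1..r + s} \<Longrightarrow> j \<in> {1..r + s} \<Longrightarrow> coord i (X j) = (if i = j then 1 else 0)"
  using basis_facts by (auto simp: coord_def representation_basis dest: inj_onD)

lemma coord_sum: "(\<And>j. j \<in> I \<Longrightarrow> f j \<in> V) \<Longrightarrow> coord i (\<Sum>j\<in>I. f j) = (\<Sum>j\<in>I. coord i (f j))"
proof (induction I rule: infinite_finite_induct)
  case (insert x F)
  then show ?case
    using subspace_sum[OF W_subspace, of F f "-1"] by (simp add: coord_add)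
qed (use coord_scale[of 0 i 0] subspace_0[OF W_subspace] in \<open>auto simp: coord_def representation_zero\<close>)

lemma twist_sum: "twist p (\<Sum>j\<in>I. f j) = (\<Sum>j\<in>I. twist p (f j))"
  by (induction I rule: infinite_finite_induct)
    (auto simp: twist_add, use twist_scale[of p 0 0] in auto)

text \<open>In a homogeneous basis the twist is diagonal.\<close>

lemma coord_twist:
  assumes "x \<in> V" "i \<in> {1..r + s}"
  shows "coord i (twist p x) = ksign p (ip i) * coord i x"
proof -
  have "twist p x = (\<Sum>j\<in>{1..r + s}. sc (coord j x * ksign p (ip j)) (X j))"
    by (subst coord_expand[OF assms(1), symmetric])
      (auto simp: twist_sum twist_scale twist_P[OF basis_facts(4)] intro!: sum.cong)
  then have "coord i (twist p x) = (\<Sum>j\<in>{1..r + s}. coord i (sc (coord j x * ksign p (ip j)) (X j)))"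
    using basis_facts(5) W_scale by (simp only: coord_sum)
  also have "\<dots> = (\<Sum>j\<in>{1..r + s}. coord j x * ksign p (ip j) * (if i = j then 1 else 0))"
    using basis_facts(5) assms(2) by (intro sum.cong) (auto simp: coord_scale coord_X)
  also have "\<dots> = ksign p (ip i) * coord i x"
    using assms(2) by (simp add: if_distrib[of "(*) _"] cong: if_cong)
  finally show ?thesis .
qed

text \<open>Computing the coordinate of \<open>twist 1 x\<close> in two ways gives it the sign of
  \<open>x\<close> and the sign of \<open>X i\<close>. These are opposite, so the coordinate equals
  its own negative.\<close>

lemma coord_parity:
  assumes "x \<in> V" "x \<in> P a" "i \<in> {1..r + s}" "a \<noteq> ip i"
  shows "coord i x = 0"
proof -
  have "ksign 1 a * coord i x = ksign 1 (ip i) * coord i x"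
    using coord_twist[OF assms(1,3), of 1] assms(1,2) by (simp add: twist_P coord_scale)
  then show ?thesis
    using assms(4) by (cases a; cases "ip i") (auto simp: ksign_def)
qed

lemma lam_add: "x \<in> W 0 \<Longrightarrow> y \<in> W 0 \<Longrightarrow> lam (x + y) = lam x + lam y"
  and lam_scale: "x \<in> W 0 \<Longrightarrow> lam (sc c x) = c * lam x"
  and lam_odd: "x \<in> W 0 \<Longrightarrow> x \<in> P 1 \<Longrightarrow> lam x = 0"
  and lam_br: "x \<in> W 0 \<Longrightarrow> y \<in> W 0 \<Longrightarrow> lam (br x y) = 0"
  using character by (auto simp: lie_character_def)

lemma lam_0: "lam 0 = 0"
  using lam_scale[of 0 0] subspace_0[OF W_subspace, of 0] by simp

lemma lam_sum: "(\<And>j. j \<in> I \<Longrightarrow> f j \<in> W 0) \<Longrightarrow> lam (\<Sum>j\<in>I. f j) = (\<Sum>j\<in>I. lam (f j))"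
proof (induction I rule: infinite_finite_induct)
  case (insert x F)
  then show ?case
    using subspace_sum[OF W_subspace, of F f 0] by (simp add: lam_add)
qed (auto simp: lam_0)

lemma br_sum_right: "br x (\<Sum>j\<in>I. f j) = (\<Sum>j\<in>I. br x (f j))"
  by (induction I rule: infinite_finite_induct) (auto simp: br_simps)

lemma br_sum_left: "br (\<Sum>j\<in>I. f j) x = (\<Sum>j\<in>I. br (f j) x)"
  by (induction I rule: infinite_finite_induct) (auto simp: br_simps)

lemma br_expand: "y \<in> V \<Longrightarrow> br x y = (\<Sum>i\<in>{1..r + s}. sc (coord i y) (br x (X i)))"
  using arg_cong[OF coord_expand[of y], of "br x"] by (simp add: br_sum_right br_simps)

end

section \<open>Derivations and the model of the induced module\<close>

definition lin :: "('g list \<Rightarrow> 'g list \<Rightarrow>\<^sub>0 'k) \<Rightarrow> ('g list \<Rightarrow>\<^sub>0 'k) \<Rightarrow> 'g list \<Rightarrow>\<^sub>0 'k::field"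
  where "lin f p = (\<Sum>w\<in>Poly_Mapping.keys p. const (Poly_Mapping.lookup p w) * f w)"

lemma lin_superset:
  assumes "finite A" "Poly_Mapping.keys p \<subseteq> A"
  shows "lin f p = (\<Sum>w\<in>A. const (Poly_Mapping.lookup p w) * f w)"
  unfolding lin_def by (rule sum.mono_neutral_left) (use assms in \<open>auto simp: in_keys_iff\<close>)

lemma lin_add: "lin f (p + q) = lin f p + lin f q"
proof -
  let ?A = "Poly_Mapping.keys p \<union> Poly_Mapping.keys q"
  have "Poly_Mapping.keys (p + q) \<subseteq> ?A"
    by (rule Poly_Mapping.keys_add)
  then show ?thesis
    by (simp add: lin_superset[of ?A] lookup_add const_add sum.distrib distrib_right)
qed

lemma lin_single [simp]: "lin f (Poly_Mapping.single w c) = const c * f w"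
  by (subst lin_superset[of "{w}"]) auto

lemma lin_1 [simp]: "lin f 1 = f []"
  using lin_single[of f "[]" 1] by simp

lemma lin_0 [simp]: "lin f 0 = 0"
  by (simp add: lin_def)

lemma lookup_const_mult [simp]: "Poly_Mapping.lookup (const c * p) w = c * Poly_Mapping.lookup p w"
proof -
  have "const c * p = (\<Sum>w\<in>Poly_Mapping.keys p. Poly_Mapping.single w (c * Poly_Mapping.lookup p w))"
    by (subst poly_mapping_sum_single[of p]) (simp add: sum_distrib_left)
  then show ?thesis
    by (auto simp: lookup_sum lookup_single when_def in_keys_iff)
qed

lemma lin_scale: "lin f (const c * p) = const c * lin f p"
proof -
  have "lin f (const c * p) = (\<Sum>w\<in>Poly_Mapping.keys p. const (c * Poly_Mapping.lookup p w) * f w)"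
    by (subst lin_superset[of "Poly_Mapping.keys p"]) (auto simp: in_keys_iff)
  also have "\<dots> = (\<Sum>w\<in>Poly_Mapping.keys p. const c * (const (Poly_Mapping.lookup p w) * f w))"
    by (simp add: mult.assoc[symmetric])
  finally show ?thesis
    by (simp add: lin_def sum_distrib_left)
qed

lemma lin_uminus: "lin f (- p) = - lin f p"
  using lin_scale[of f "-1" p] by (simp add: single_uminus)

lemma lin_diff: "lin f (p - q) = lin f p - lin f q"
  using lin_add[of f p "- q"] by (simp add: lin_uminus)

lemma lpolys:
  assumes "p \<in> polys U" "\<And>w. w \<in> lists U \<Longrightarrow> f w \<in> polys V"
  shows "lin f p \<in> polys V"
  using assms(1)
  by (induction rule: polys_induct)
    (auto simp: lin_add lin_scale assms(2) intro: polys_intros)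

lemma const_left_commute: "p * (const c * q) = const c * (p * q)"
  by (metis const_commute mult.assoc)

lemma const_sum: "const (\<Sum>i\<in>I. f i) = (\<Sum>i\<in>I. const (f i))"
  by (induction I rule: infinite_finite_induct) (auto simp: single_add)

lemma sum_left_commute_const: "(\<Sum>i\<in>I. const c * f i) = const c * (\<Sum>i\<in>I. f i)"
  by (simp add: sum_distrib_left)

text \<open>A skew derivation on words: its Leibniz rule is twisted by the map \<open>\<tau>\<close>
  of letters. With \<open>\<xi>\<close> a coordinate and \<open>\<tau>\<close> a parity twist it
  lifts a partial derivative, the twist playing the part of the Koszul sign.\<close>

fun dword :: "('g \<Rightarrow> 'k::field) \<Rightarrow> ('g \<Rightarrow> 'g) \<Rightarrow> 'g list \<Rightarrow> 'g list \<Rightarrow>\<^sub>0 'k" where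
  "dword \<xi> \<tau> [] = 0"
| "dword \<xi> \<tau> (y # w) = Poly_Mapping.single w (\<xi> y) + monom [\<tau> y] * dword \<xi> \<tau> w"

definition derivation where "derivation \<xi> \<tau> = lin (dword \<xi> \<tau>)"

definition substitute where "substitute \<tau> = lin (\<lambda>w. monom (map \<tau> w))"

lemma substitute_mult: "substitute \<tau> (p * q) = substitute \<tau> p * substitute \<tau> q"
proof (induction p rule: poly_mapping_list_induct)
  case (monom u)
  show ?case
  proof (induction q rule: poly_mapping_list_induct)
    case (scale c q)
    then show ?case
      unfolding substitute_def by (simp only: const_left_commute lin_scale)
  qed (simp_all add: substitute_def lin_add algebra_simps)
next
  case (scale c q)
  then show ?case
    unfolding substitute_def by (simp only: mult.assoc lin_scale)
qed (simp_all add: substitute_def lin_add algebra_simps)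

lemma dword_append:
  "dword \<xi> \<tau> (u @ v) = dword \<xi> \<tau> u * monom v + monom (map \<tau> u) * dword \<xi> \<tau> v"
proof (induction u)
  case (Cons y u)
  have "monom [\<tau> y] * (monom (map \<tau> u) * z) = monom (\<tau> y # map \<tau> u) * z" for z :: "'a list \<Rightarrow>\<^sub>0 'b"
    by (simp add: mult.assoc[symmetric])
  with Cons show ?case
    by (simp add: algebra_simps)
qed simp

text \<open>Both sides are bilinear, so the twisted Leibniz rule comes down to two words, where it
  is \<open>dword_append\<close>.\<close>

lemma derivation_mult:
  "derivation \<xi> \<tau> (p * q) = derivation \<xi> \<tau> p * q + substitute \<tau> p * derivation \<xi> \<tau> q"
proof (induction p rule: poly_mapping_list_induct)
  case (monom u)
  show ?case
  proof (induction q rule: poly_mapping_list_induct)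
    case (scale c q)
    then show ?case
      unfolding derivation_def substitute_def
      by (simp only: const_left_commute lin_scale distrib_left)
  next
    case (add q q')
    then show ?case
      by (simp add: derivation_def lin_add algebra_simps)
  qed (simp add: derivation_def substitute_def dword_append)
next
  case (scale c q)
  then show ?case
    unfolding derivation_def substitute_def by (simp only: mult.assoc lin_scale distrib_left)
next
  case (add p p')
  then show ?case
    by (simp add: derivation_def substitute_def lin_add algebra_simps)
qed

lemma substitute_polys:
  assumes "p \<in> polys V" "\<And>x. x \<in> V \<Longrightarrow> \<tau> x \<in> V"
  shows "substitute \<tau> p \<in> polys V"
  unfolding substitute_def
  by (rule lpolys[OF assms(1)]) (auto intro!: single_polys assms(2))

lemma derivation_polys:
  assumes "p \<in> polys V" "\<And>x. x \<in> V \<Longrightarrow> \<tau> x \<in> V"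
  shows "derivation \<xi> \<tau> p \<in> polys V"
proof -
  have "dword \<xi> \<tau> w \<in> polys V" if "w \<in> lists V" for w
    using that by (induction w) (auto intro!: polys_intros assms(2) simp del: single_mult_list)
  then show ?thesis
    unfolding derivation_def by (rule lpolys[OF assms(1)])
qed

lemma derivation_letter:
  "derivation \<xi> \<tau> (monom [y] * q) = const (\<xi> y) * q + monom [\<tau> y] * derivation \<xi> \<tau> q"
  using derivation_mult[of \<xi> \<tau> "monom [y]" q] by (simp add: derivation_def substitute_def)

lemma linear_rels_polys:
  assumes "module.subspace sc V" "Modules.module sc"
  shows "linear_rels sc V \<subseteq> polys V"
  using module.subspace_add[OF assms(2,1)] module.subspace_scale[OF assms(2,1)]
  by (auto simp: linear_rels_def intro!: polys_intros)

section \<open>The supersymmetric algebra as a congruence on words in V\<close>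

context graded_induction_data
begin

lemma sym_rels_polys: "linear_rels sc V \<union>
     {monom [x, y] - Poly_Mapping.single [y, x] (ksign p q)
        | x y p q. x \<in> V \<inter> P p \<and> y \<in> V \<inter> P q} \<subseteq> polys V"
  using linear_rels_polys[OF W_subspace module_axioms, of "-1"] by (auto intro!: polys_intros)

sublocale S: free_quotient V "sym_ideal sc P V"
  unfolding sym_ideal_def by (rule genideal_free_algebra[OF sym_rels_polys])

abbreviation JS where "JS \<equiv> sym_ideal sc P V"

notation S.eqv (infix "\<doteq>" 50)

lemma JS_induct [consumes 1, case_names plus scale comm zero add left right]:
  assumes "p \<in> JS"
    and "\<And>x y. x \<in> V \<Longrightarrow> y \<in> V \<Longrightarrow> Q (monom [x + y] - monom [x] - monom [y])"
    and "\<And>c x. x \<in> V \<Longrightarrow> Q (monom [sc c x] - Poly_Mapping.single [x] c)"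
    and "\<And>x y p q. x \<in> V \<Longrightarrow> x \<in> P p \<Longrightarrow> y \<in> V \<Longrightarrow> y \<in> P q \<Longrightarrow>
      Q (monom [x, y] - Poly_Mapping.single [y, x] (ksign p q))"
    and "Q 0"
    and "\<And>p q. p \<in> JS \<Longrightarrow> q \<in> JS \<Longrightarrow> Q p \<Longrightarrow> Q q \<Longrightarrow> Q (p + q)"
    and "\<And>p q. p \<in> JS \<Longrightarrow> q \<in> polys V \<Longrightarrow> Q p \<Longrightarrow> Q (q * p)"
    and "\<And>p q. p \<in> JS \<Longrightarrow> q \<in> polys V \<Longrightarrow> Q p \<Longrightarrow> Q (p * q)"
  shows "Q p"
  using assms(1) unfolding sym_ideal_def
proof (induction rule: genideal_free_algebra_induct[OF _ sym_rels_polys, consumes 1, case_names rel zero add left right])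
  case (rel p)
  then show ?case
    using assms(2-4) by (auto simp: linear_rels_def)
qed (use assms(5-) in \<open>auto simp: sym_ideal_def\<close>)

lemma JS_rel:
  assumes "p \<in> linear_rels sc V \<union>
     {monom [x, y] - Poly_Mapping.single [y, x] (ksign p q)
        | x y p q. x \<in> V \<inter> P p \<and> y \<in> V \<inter> P q}"
  shows "p \<in> JS"
  unfolding sym_ideal_def using sym_rels_polys S.R.genideal_self assms
  by (metis (no_types, lifting) free_algebra_simps(1) subsetD)

lemma letter_add: "x \<in> V \<Longrightarrow> y \<in> V \<Longrightarrow> monom [x + y] \<doteq> monom [x] + monom [y]"
  unfolding S.eqv_def diff_diff_eq[symmetric] by (rule JS_rel) (auto simp: linear_rels_def)

lemma letter_scale: "x \<in> V \<Longrightarrow> monom [sc c x] \<doteq> const c * monom [x]"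
  unfolding S.eqv_def by (rule JS_rel) (auto simp: linear_rels_def)

lemma letter_comm:
  "x \<in> V \<Longrightarrow> x \<in> P p \<Longrightarrow> y \<in> V \<Longrightarrow> y \<in> P q \<Longrightarrow>
    monom [x] * monom [y] \<doteq> const (ksign p q) * (monom [y] * monom [x])"
  unfolding S.eqv_def by (rule JS_rel) auto

lemma letter_polys: "x \<in> V \<Longrightarrow> monom [x] \<in> polys V"
  by (simp add: single_polys)

text \<open>The letter 0 is a word of length one, not the zero polynomial; only its class vanishes.
  Letters that are zero brackets therefore have to be discarded modulo the ideal.\<close>

lemma letter_zero: "monom [0] \<doteq> 0"
  using letter_scale[of 0 0] subspace_0[OF W_subspace] by simp

lemma letter_sum:
  "finite I \<Longrightarrow> (\<And>i. i \<in> I \<Longrightarrow> f i \<in> V) \<Longrightarrow> monom [\<Sum>i\<in>I. sc (c i) (f i)] \<doteq> (\<Sum>i\<in>I. const (c i) * monom [f i])"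
proof (induction I rule: finite_induct)
  case (insert x F)
  then have V: "f x \<in> V" "(\<Sum>i\<in>F. sc (c i) (f i)) \<in> V"
    by (auto intro!: subspace_sum[OF W_subspace] W_scale)
  have "monom [sc (c x) (f x) + (\<Sum>i\<in>F. sc (c i) (f i))]
      \<doteq> monom [sc (c x) (f x)] + monom [\<Sum>i\<in>F. sc (c i) (f i)]"
    by (rule letter_add) (use V W_scale in auto)
  also have "\<dots> \<doteq> const (c x) * monom [f x] + (\<Sum>i\<in>F. const (c i) * monom [f i])"
    using insert by (intro S.eqv_add letter_scale) auto
  finally show ?case
    using insert by simp
qed (simp add: letter_zero)

text \<open>Only \<open>x\<close> has to be homogeneous: \<open>y\<close> is split into parity
  components, each of which picks up its own sign, and the signs reassemble into the twist.\<close>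

lemma letter_swap:
  assumes "x \<in> V" "x \<in> P p" "y \<in> V"
  shows "monom [x] * monom [y] \<doteq> monom [twist p y] * monom [x]"
proof -
  note V = ppart_W[OF assms(3)]
  have "monom [x] * monom [y] \<doteq> monom [x] * (monom [ppart 0 y] + monom [ppart 1 y])"
    using letter_add[of "ppart 0 y" "ppart 1 y"] V assms
    by (intro S.eqv_mult_left letter_polys) (auto simp: ppart_sum)
  also have "\<dots> = monom [x] * monom [ppart 0 y] + monom [x] * monom [ppart 1 y]"
    by (simp only: distrib_left)
  also have "\<dots> \<doteq> const (ksign p 0) * (monom [ppart 0 y] * monom [x])
      + const (ksign p 1) * (monom [ppart 1 y] * monom [x])"
    using assms V ppart_in by (intro S.eqv_add letter_comm) auto
  also have "\<dots> = (monom [ppart 0 y] + const (ksign p 1) * monom [ppart 1 y]) * monom [x]"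
    by (simp only: distrib_right mult.assoc ksign_0 const_one mult_1_left)
  also have "\<dots> \<doteq> (monom [ppart 0 y] + monom [sc (ksign p 1) (ppart 1 y)]) * monom [x]"
    using assms V by (intro S.eqv_mult_right S.eqv_add letter_polys S.eqv_sym[OF letter_scale]) auto
  also have "\<dots> \<doteq> monom [twist p y] * monom [x]"
    unfolding twist_def
    using assms V W_scale by (intro S.eqv_mult_right letter_polys S.eqv_sym[OF letter_add]) auto
  finally show ?thesis .
qed

definition tw where "tw p = substitute (twist p)"

text \<open>A lift of the i-th partial derivative to noncommutative polynomials;
  \<open>drv_JS\<close> makes it well defined on classes.\<close>

definition drv where "drv i = derivation (coord i) (twist (ip i))"

lemma tw_linear: "tw p (a + b) = tw p a + tw p b" "tw p (const c * a) = const c * tw p a"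
  "tw p (a - b) = tw p a - tw p b" "tw p 0 = 0"
  by (simp_all add: tw_def substitute_def lin_add lin_scale lin_diff)

lemma drv_linear: "drv i (a + b) = drv i a + drv i b" "drv i (const c * a) = const c * drv i a"
  "drv i (a - b) = drv i a - drv i b" "drv i 0 = 0"
  by (simp_all add: drv_def derivation_def lin_add lin_scale lin_diff)

lemma tw_mult: "tw p (a * b) = tw p a * tw p b"
  by (simp add: tw_def substitute_mult)

lemma drv_mult: "drv i (a * b) = drv i a * b + tw (ip i) a * drv i b"
  by (simp add: drv_def tw_def derivation_mult)

lemma drv_letter: "drv i (monom [y] * q) = const (coord i y) * q + monom [twist (ip i) y] * drv i q"
  by (simp add: drv_def derivation_letter)

lemma tw_polys: "a \<in> polys V \<Longrightarrow> tw p a \<in> polys V"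
  unfolding tw_def by (rule substitute_polys) (auto intro: twist_W)

lemma drv_polys: "a \<in> polys V \<Longrightarrow> drv i a \<in> polys V"
  unfolding drv_def by (rule derivation_polys) (auto intro: twist_W)

text \<open>The twist is linear and preserves \<open>V\<close> and the parity of homogeneous
  letters, so defining relations go to defining relations.\<close>

lemma tw_JS: "a \<in> JS \<Longrightarrow> tw p a \<in> JS"
proof (induction rule: JS_induct)
  case (plus x y)
  then show ?case
    using letter_add[of "twist p x" "twist p y"] twist_W[of _ "-1" p]
    by (simp add: tw_def substitute_def lin_diff lin_add twist_add S.eqv_def algebra_simps)
next
  case (scale c x)
  then show ?case
    using letter_scale[of "twist p x" c] twist_W[of _ "-1" p]
    by (simp add: tw_def substitute_def lin_diff twist_scale S.eqv_def algebra_simps)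
next
  case (comm x y a b)
  then show ?case
    using letter_comm[of "twist p x" a "twist p y" b] twist_W[of _ "-1" p]
    by (simp add: tw_def substitute_def lin_diff S.eqv_def algebra_simps twist_P P_scale W_scale)
qed (auto simp: tw_linear tw_mult intro: S.J_zero S.J_add S.J_mult_left S.J_mult_right tw_polys)

text \<open>The linear relations are differentiated to zero outright. For a supercommutator, a
  coordinate is nonzero only if its letter has the parity of \<open>X i\<close>, and then the twist
  of the other letter reproduces exactly the sign in the relation.\<close>

lemma drv_JS:
  assumes i: "i \<in> {1..r + s}" and "a \<in> JS"
  shows "drv i a \<in> JS"
  using assms(2)
proof (induction rule: JS_induct)
  case (plus x y)
  then show ?case
    by (simp add: drv_def derivation_def lin_diff lin_add coord_add S.J_zero single_add)
next
  case (scale c x)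
  then show ?case
    by (simp add: drv_def derivation_def lin_diff coord_scale S.J_zero)
next
  case (comm x y a b)
  have eq: "drv i (monom [x, y] - Poly_Mapping.single [y, x] (ksign a b)) =
      const (coord i x) * (monom [y] - const (ksign a b) * monom [twist (ip i) y]) +
      const (coord i y) * (monom [twist (ip i) x] - const (ksign a b) * monom [x])"
    by (simp add: drv_def derivation_def lin_diff algebra_simps)
  have 1: "const (coord i x) * (monom [y] - const (ksign a b) * monom [twist (ip i) y]) \<in> JS"
  proof (cases "a = ip i")
    case True
    have "const (ksign a b) * monom [twist (ip i) y] \<doteq> const (ksign a b) * (const (ksign a b) * monom [y])"
      unfolding twist_P[OF comm(4)] True[symmetric]
      by (intro S.eqv_scale letter_scale comm)
    also have "\<dots> = monom [y]"
      by simp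
    finally show ?thesis
      using S.eqv_sym by (auto simp: S.eqv_def intro: S.J_scale)
  qed (use coord_parity[of x a i] comm i in \<open>auto simp: S.J_zero\<close>)
  have 2: "const (coord i y) * (monom [twist (ip i) x] - const (ksign a b) * monom [x]) \<in> JS"
  proof (cases "b = ip i")
    case True
    then show ?thesis
      using letter_scale[of x "ksign a b"] comm
      by (auto simp: twist_P ksign_sym[of "ip i" a] S.eqv_def intro: S.J_scale)
  qed (use coord_parity[of y b i] comm i in \<open>auto simp: S.J_zero\<close>)
  show ?case
    unfolding eq by (rule S.J_add[OF 1 2])
next
  case (left p q)
  then show ?case
    unfolding drv_mult by (intro S.J_add S.J_mult_left drv_polys tw_polys)
next
  case (right p q)
  then show ?case
    unfolding drv_mult by (intro S.J_add S.J_mult_right tw_JS drv_polys)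
qed (auto simp: drv_linear intro: S.J_zero S.J_add)

section \<open>The operators of the three formulas and their commutators with letters of V\<close>

abbreviation I where "I \<equiv> {1..r + s}"

definition act0 where
  "act0 x q = const (lam x) * q + (\<Sum>i\<in>I. monom [br x (X i)] * drv i q)"

definition act1 where
  "act1 x q = (\<Sum>i\<in>I. const (lam (br x (X i))) * drv i q) +
     const (1 / 2) * (\<Sum>i\<in>I. \<Sum>j\<in>I. monom [br (br x (X i)) (X j)] * drv j (drv i q))"

text \<open>One operator for an arbitrary element, whose graded components are fed to the three
  formulas. It acts on representatives; \<open>act_JS\<close> lets it pass to classes.\<close>

definition act where
  "act x q = monom [gpart (-1) x] * q + act0 (gpart 0 x) q + act1 (gpart 1 x) q"

lemma br_V_closed:
  "x \<in> W 0 \<Longrightarrow> y \<in> V \<Longrightarrow> br x y \<in> V" "y \<in> V \<Longrightarrow> x \<in> W 0 \<Longrightarrow> br y x \<in> V"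
  "x \<in> W 1 \<Longrightarrow> y \<in> V \<Longrightarrow> br x y \<in> W 0" "y \<in> V \<Longrightarrow> x \<in> W 1 \<Longrightarrow> br y x \<in> W 0"
  "x \<in> W 0 \<Longrightarrow> y \<in> W 0 \<Longrightarrow> br x y \<in> W 0"
  "x \<in> W 0 \<Longrightarrow> y \<in> W 1 \<Longrightarrow> br x y \<in> W 1" "y \<in> W 1 \<Longrightarrow> x \<in> W 0 \<Longrightarrow> br y x \<in> W 1"
  using grading_br[of x 0 y "-1"] grading_br[of y "-1" x 0] grading_br[of x 1 y "-1"]
    grading_br[of y "-1" x 1] grading_br[of x 0 y 0] grading_br[of x 0 y 1] grading_br[of y 1 x 0]
  by auto

lemmas V_closed = br_V_closed(1,3) basis_facts(5) twist_W

lemma act_polys: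
  "x \<in> W 0 \<Longrightarrow> q \<in> polys V \<Longrightarrow> act0 x q \<in> polys V"
  "x \<in> W 1 \<Longrightarrow> q \<in> polys V \<Longrightarrow> act1 x q \<in> polys V"
  "q \<in> polys V \<Longrightarrow> act x q \<in> polys V"
proof -
  show 0: "act0 x q \<in> polys V" if "x \<in> W 0" "q \<in> polys V" for x q
  proof -
    have "monom [br x (X i)] \<in> polys V" if "i \<in> I" for i
      using \<open>x \<in> W 0\<close> basis_facts(5)[OF that] by (intro letter_polys br_V_closed(1))
    then show ?thesis
      unfolding act0_def
      by (intro polys_add polys_sum polys_mult const_polys drv_polys that) auto
  qed
  show 1: "act1 x q \<in> polys V" if "x \<in> W 1" "q \<in> polys V" for x q
  proof -
    have "monom [br (br x (X i)) (X j)] \<in> polys V" if "i \<in> I" "j \<in> I" for i j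
      using \<open>x \<in> W 1\<close> basis_facts(5)[OF that(1)] basis_facts(5)[OF that(2)]
      by (intro letter_polys br_V_closed(1,3))
    then show ?thesis
      unfolding act1_def
      by (intro polys_add polys_sum polys_mult const_polys drv_polys that) auto
  qed
  show "act x q \<in> polys V" if "q \<in> polys V" for x q
    unfolding act_def
    by (intro polys_add polys_mult 0 1 letter_polys that gpart_in) auto
qed

lemma act_linear:
  "act x (p + q) = act x p + act x q" "act x (const c * p) = const c * act x p"
  "act x 0 = 0" "act x (p - q) = act x p - act x q"
proof -
  show add: "act x (p + q) = act x p + act x q" for p q
    unfolding act_def act0_def act1_def
    by (simp add: drv_linear distrib_left sum.distrib)
  show scale: "act x (const c * p) = const c * act x p" for c p
    unfolding act_def act0_def act1_def
    by (simp only: drv_linear const_left_commute[of _ c] sum_left_commute_const distrib_left)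
  show "act x 0 = 0"
    using add[of 0 0] by simp
  show "act x (p - q) = act x p - act x q"
    using add[of p "const (-1) * q"] scale[of "-1" q] by (simp add: single_uminus)
qed

lemma act_JS:
  assumes "q \<in> JS"
  shows "act x q \<in> JS"
proof -
  have g: "gpart k x \<in> W k" if "k \<in> {-1, 0, 1}" for k
    by (rule gpart_in[OF that])
  have "monom [br (gpart 0 x) (X i)] \<in> polys V" if "i \<in> I" for i
    using g[of 0] basis_facts(5)[OF that] by (intro letter_polys br_V_closed(1)) auto
  moreover have "monom [br (br (gpart 1 x) (X i)) (X j)] \<in> polys V" if "i \<in> I" "j \<in> I" for i j
    using g[of 1] basis_facts(5)[OF that(1)] basis_facts(5)[OF that(2)]
    by (intro letter_polys br_V_closed(1,3)) auto
  moreover have "monom [gpart (-1) x] \<in> polys V"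
    using g[of "-1"] by (intro letter_polys) auto
  ultimately show ?thesis
    unfolding act_def act0_def act1_def
    by (intro S.J_add S.J_scale S.J_sum S.J_mult_left drv_JS assms) auto
qed

lemma act_eqv: "p \<doteq> q \<Longrightarrow> act x p \<doteq> act x q"
  using act_JS[of "p - q" x] by (simp add: S.eqv_def act_linear)

lemma letter_scale_sum:
  assumes "finite K" "\<And>i. i \<in> K \<Longrightarrow> f i \<in> V"
  shows "(\<Sum>i\<in>K. monom [f i] * const (c i)) \<doteq> monom [\<Sum>i\<in>K. sc (c i) (f i)]"
  using S.eqv_sym[OF letter_sum[OF assms]] by (simp add: mult.commute)

text \<open>In the Leibniz rule for \<open>y q\<close>, the terms differentiating \<open>y\<close>
  reassemble into the letter [x,y] by expanding \<open>y\<close> in the basis; in the others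
  \<open>y\<close> is moved to the front past the coefficients [x,X_i].\<close>

lemma act0_letter:
  assumes x: "x \<in> W 0" "x \<in> P p" and y: "y \<in> V" and q: "q \<in> polys V"
  shows "act0 x (monom [y] * q) \<doteq> monom [twist p y] * act0 x q + monom [br x y] * q"
proof -
  \<comment> \<open>For odd \<open>x\<close> the character vanishes, for even \<open>x\<close> the
    twist is trivial.\<close>
  have 1: "const (lam x) * (monom [y] * q) = monom [twist p y] * (const (lam x) * q)"
  proof (cases "p = 0")
    case True
    then show ?thesis by (simp only: twist_0 const_left_commute)
  next
    case False
    then show ?thesis using x by (simp add: lam_odd)
  qed
  have 2: "(\<Sum>i\<in>I. monom [br x (X i)] * (const (coord i y) * q)) \<doteq> monom [br x y] * q"
  proof -
    have "(\<Sum>i\<in>I. monom [br x (X i)] * (const (coord i y) * q))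
        = (\<Sum>i\<in>I. monom [br x (X i)] * const (coord i y)) * q"
      unfolding sum_distrib_right mult.assoc ..
    also have "\<dots> \<doteq> monom [\<Sum>i\<in>I. sc (coord i y) (br x (X i))] * q"
      by (intro S.eqv_mult_right letter_scale_sum V_closed x q) auto
    also have "(\<Sum>i\<in>I. sc (coord i y) (br x (X i))) = br x y"
      by (rule br_expand[OF y, symmetric])
    finally show ?thesis .
  qed
  have 3: "(\<Sum>i\<in>I. monom [br x (X i)] * (monom [twist (ip i) y] * drv i q))
      \<doteq> monom [twist p y] * (\<Sum>i\<in>I. monom [br x (X i)] * drv i q)"
    unfolding sum_distrib_left
  proof (rule S.eqv_sum)
    fix i assume i: "i \<in> I"
    have "monom [br x (X i)] * monom [twist (ip i) y]
        \<doteq> monom [twist (p + ip i) (twist (ip i) y)] * monom [br x (X i)]"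
      by (intro letter_swap V_closed br_parity basis_facts(4) x y i)
    \<comment> \<open>The twist from the Leibniz rule cancels the part of the swap sign due to
      \<open>X i\<close>, leaving a sign independent of \<open>i\<close>.\<close>
    also have "twist (p + ip i) (twist (ip i) y) = twist p y"
      unfolding twist_twist by (cases p; cases "ip i") auto
    finally have "monom [br x (X i)] * monom [twist (ip i) y] * drv i q
        \<doteq> monom [twist p y] * monom [br x (X i)] * drv i q"
      by (intro S.eqv_mult_right drv_polys q)
    then show "monom [br x (X i)] * (monom [twist (ip i) y] * drv i q)
        \<doteq> monom [twist p y] * (monom [br x (X i)] * drv i q)"
      by (simp only: mult.assoc)
  qed
  have "act0 x (monom [y] * q) = const (lam x) * (monom [y] * q)
      + ((\<Sum>i\<in>I. monom [br x (X i)] * (const (coord i y) * q))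
      + (\<Sum>i\<in>I. monom [br x (X i)] * (monom [twist (ip i) y] * drv i q)))"
    unfolding act0_def drv_letter by (simp only: distrib_left sum.distrib)
  also have "\<dots> \<doteq> monom [twist p y] * (const (lam x) * q)
      + (monom [br x y] * q + monom [twist p y] * (\<Sum>i\<in>I. monom [br x (X i)] * drv i q))"
    unfolding 1 by (intro S.eqv_add 2 3) simp
  also have "\<dots> = monom [twist p y] * act0 x q + monom [br x y] * q"
    unfolding act0_def by (simp only: distrib_left add_ac)
  finally show ?thesis .
qed

text \<open>Since [u,v] = 0, the Jacobi identity for [x,[u,v]] makes the double bracket
  supersymmetric in \<open>u\<close> and \<open>v\<close>. The twist carries the sign, so
  \<open>v\<close> may be inhomogeneous.\<close>

lemma br_br_swap:
  assumes x: "x \<in> W 1" "x \<in> P p" and u: "u \<in> V" "u \<in> P a" and v: "v \<in> V"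
  shows "br (br x u) (twist a v) = br (br x v) u"
proof -
  have hom: "sc (ksign a c) (br (br x u) v) = br (br x v) u" if v: "v \<in> V" "v \<in> P c" for v c
  proof -
    have "br x (br u v) = br (br x u) v + sc (ksign p a) (br u (br x v))"
      by (rule br_jacobi[OF x(2) u(2)])
    moreover have "br u (br x v) = - sc (ksign a (p + c)) (br (br x v) u)"
      by (rule br_skew[OF u(2) br_parity[OF x(2) v(2)]])
    ultimately have "br (br x u) v = sc (ksign p a * ksign a (p + c)) (br (br x v) u)"
      using br_V[OF u(1) v(1)] by (simp add: br_simps add_eq_0_iff)
    also have "ksign p a * ksign a (p + c) = (ksign a c :: 'k)"
      by (simp only: ksign_add_right ksign_sym[of p a] ksign_square')
    finally show ?thesis
      by simp
  qed
  have hom': "br (br x u) (twist a (ppart c v)) = br (br x (ppart c v)) u" for c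
    using hom[OF ppart_W[OF v] ppart_in, of c] by (simp add: twist_P[OF ppart_in] br_simps)
  have "br (br x u) (twist a (ppart 0 v + ppart 1 v)) = br (br x (ppart 0 v + ppart 1 v)) u"
    by (simp only: twist_add br_simps hom')
  then show ?thesis
    by (simp only: ppart_sum)
qed

text \<open>Two derivatives of \<open>y q\<close> give three sums. The two in which \<open>y\<close>
  is consumed both equal the derivative part of \<open>act0 (br x y) q\<close>, and the factor 1/2
  counts them once; in the third \<open>y\<close> passes to the front. The first-order term of the
  formula contributes the character value on [x,y].\<close>

lemma act1_letter:
  assumes x: "x \<in> W 1" "x \<in> P p" and y: "y \<in> V" and q: "q \<in> polys V"
  shows "act1 x (monom [y] * q) \<doteq> monom [twist p y] * act1 x q + act0 (br x y) q"
proof -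
  let ?B = "\<lambda>i j. monom [br (br x (X i)) (X j)]"
  let ?E = "\<Sum>i\<in>I. monom [br (br x y) (X i)] * drv i q"
  have BV: "br (br x (X i)) z \<in> V" if "i \<in> I" "z \<in> V" for i z
    by (intro V_closed x that)
  have lam1: "(\<Sum>i\<in>I. const (lam (br x (X i))) * (const (coord i y) * q)) = const (lam (br x y)) * q"
  proof -
    have "lam (br x y) = (\<Sum>i\<in>I. lam (br x (X i)) * coord i y)"
      unfolding br_expand[OF y, of x]
    proof (subst lam_sum)
      have W: "br x (X i) \<in> W 0" if "i \<in> I" for i
        by (intro V_closed x that)
      show "sc (coord i y) (br x (X i)) \<in> W 0" if "i \<in> I" for i
        by (intro W_scale W that)
      show "(\<Sum>i\<in>I. lam (sc (coord i y) (br x (X i)))) = (\<Sum>i\<in>I. lam (br x (X i)) * coord i y)"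
        by (intro sum.cong refl) (simp only: lam_scale[OF W] mult.commute)
    qed
    then have "const (lam (br x y)) = (\<Sum>i\<in>I. const (lam (br x (X i)) * coord i y))"
      by (simp add: const_sum)
    then have "const (lam (br x y)) * q = (\<Sum>i\<in>I. const (lam (br x (X i)) * coord i y)) * q"
      by (rule arg_cong[where f = "\<lambda>z. z * q"])
    also have "\<dots> = (\<Sum>i\<in>I. const (lam (br x (X i))) * (const (coord i y) * q))"
      unfolding sum_distrib_right mult.assoc[symmetric] by simp
    finally show ?thesis ..
  qed
  \<comment> \<open>If the parities of \<open>x\<close> and \<open>X i\<close> differ, [x,X_i] is
    odd and the character kills both sides; if they agree, the two twists are the same.\<close>
  have lam2: "const (lam (br x (X i))) * (monom [twist (ip i) y] * drv i q)
      = monom [twist p y] * (const (lam (br x (X i))) * drv i q)" if i: "i \<in> I" for i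
  proof (cases "p = ip i")
    case True
    then show ?thesis by (simp only: const_left_commute)
  next
    case False
    have "br x (X i) \<in> P 1"
      using br_parity[OF x(2) basis_facts(4)[OF i]] False by (cases p; cases "ip i") auto
    then show ?thesis
      using V_closed(2)[OF x(1) basis_facts(5)[OF i]] by (simp add: lam_odd)
  qed
  have lam: "(\<Sum>i\<in>I. const (lam (br x (X i))) * drv i (monom [y] * q))
      = const (lam (br x y)) * q + monom [twist p y] * (\<Sum>i\<in>I. const (lam (br x (X i))) * drv i q)"
    unfolding drv_letter distrib_left sum.distrib lam1
    using lam2 by (simp add: sum_distrib_left)
  have dd: "drv j (drv i (monom [y] * q)) = const (coord i y) * drv j q
      + const (coord j (twist (ip i) y)) * drv i q
      + monom [twist (ip j) (twist (ip i) y)] * drv j (drv i q)" for i j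
    unfolding drv_letter drv_linear by (simp only: drv_letter add_ac)
  \<comment> \<open>Summing over i contracts the inner slot of the double bracket with the
    coordinates of \<open>y\<close>.\<close>
  have T1: "(\<Sum>i\<in>I. \<Sum>j\<in>I. ?B i j * (const (coord i y) * drv j q)) \<doteq> ?E"
  proof -
    have "(\<Sum>i\<in>I. \<Sum>j\<in>I. ?B i j * (const (coord i y) * drv j q))
        = (\<Sum>j\<in>I. (\<Sum>i\<in>I. ?B i j * const (coord i y)) * drv j q)"
      by (subst sum.swap) (simp only: sum_distrib_right mult.assoc)
    also have "\<dots> \<doteq> (\<Sum>j\<in>I. monom [\<Sum>i\<in>I. sc (coord i y) (br (br x (X i)) (X j))] * drv j q)"
      by (intro S.eqv_sum S.eqv_mult_right letter_scale_sum BV basis_facts(5) drv_polys q) auto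
    also have "\<dots> = ?E"
      unfolding br_expand[OF y, of x] by (simp only: br_sum_left br_simps)
    finally show ?thesis .
  qed
  \<comment> \<open>Summing over j puts the twisted \<open>y\<close> into the outer slot;
    \<open>br_br_swap\<close> moves it to the inner one, which matches the first sum.\<close>
  have T2: "(\<Sum>i\<in>I. \<Sum>j\<in>I. ?B i j * (const (coord j (twist (ip i) y)) * drv i q)) \<doteq> ?E"
  proof (rule S.eqv_sum)
    fix i assume i: "i \<in> I"
    have "(\<Sum>j\<in>I. ?B i j * (const (coord j (twist (ip i) y)) * drv i q))
        = (\<Sum>j\<in>I. ?B i j * const (coord j (twist (ip i) y))) * drv i q"
      by (simp only: sum_distrib_right mult.assoc)
    also have "\<dots> \<doteq> monom [\<Sum>j\<in>I. sc (coord j (twist (ip i) y)) (br (br x (X i)) (X j))] * drv i q"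
      by (intro S.eqv_mult_right letter_scale_sum BV basis_facts(5) drv_polys q i) auto
    also have "(\<Sum>j\<in>I. sc (coord j (twist (ip i) y)) (br (br x (X i)) (X j)))
        = br (br x (X i)) (twist (ip i) y)"
      by (rule br_expand[symmetric]) (intro twist_W y)
    also have "\<dots> = br (br x y) (X i)"
      by (intro br_br_swap[OF x] basis_facts(4,5) i y)
    finally show "(\<Sum>j\<in>I. ?B i j * (const (coord j (twist (ip i) y)) * drv i q))
        \<doteq> monom [br (br x y) (X i)] * drv i q" .
  qed
  have T3: "(\<Sum>i\<in>I. \<Sum>j\<in>I. ?B i j * (monom [twist (ip j) (twist (ip i) y)] * drv j (drv i q)))
      \<doteq> monom [twist p y] * (\<Sum>i\<in>I. \<Sum>j\<in>I. ?B i j * drv j (drv i q))"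
    unfolding sum_distrib_left
  proof (intro S.eqv_sum)
    fix i j assume i: "i \<in> I" and j: "j \<in> I"
    have "?B i j * monom [twist (ip j) (twist (ip i) y)]
        \<doteq> monom [twist (p + ip i + ip j) (twist (ip j) (twist (ip i) y))] * ?B i j"
      by (intro letter_swap BV br_parity basis_facts(4,5) x y i j twist_W)
    also have "twist (p + ip i + ip j) (twist (ip j) (twist (ip i) y)) = twist p y"
      unfolding twist_twist by (cases p; cases "ip i"; cases "ip j") auto
    finally have "?B i j * monom [twist (ip j) (twist (ip i) y)] * drv j (drv i q)
        \<doteq> monom [twist p y] * ?B i j * drv j (drv i q)"
      by (intro S.eqv_mult_right drv_polys q)
    then show "?B i j * (monom [twist (ip j) (twist (ip i) y)] * drv j (drv i q))
        \<doteq> monom [twist p y] * (?B i j * drv j (drv i q))"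
      by (simp only: mult.assoc)
  qed
  have "act1 x (monom [y] * q) =
      const (lam (br x y)) * q + monom [twist p y] * (\<Sum>i\<in>I. const (lam (br x (X i))) * drv i q)
      + const (1 / 2) * ((\<Sum>i\<in>I. \<Sum>j\<in>I. ?B i j * (const (coord i y) * drv j q))
        + (\<Sum>i\<in>I. \<Sum>j\<in>I. ?B i j * (const (coord j (twist (ip i) y)) * drv i q))
        + (\<Sum>i\<in>I. \<Sum>j\<in>I. ?B i j * (monom [twist (ip j) (twist (ip i) y)] * drv j (drv i q))))"
    unfolding act1_def lam dd by (simp only: distrib_left sum.distrib)
  also have "\<dots> \<doteq> const (lam (br x y)) * q + monom [twist p y] * (\<Sum>i\<in>I. const (lam (br x (X i))) * drv i q)
      + const (1 / 2) * (?E + ?E + monom [twist p y] * (\<Sum>i\<in>I. \<Sum>j\<in>I. ?B i j * drv j (drv i q)))"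
    by (intro S.eqv_add S.eqv_scale T1 T2 T3 S.eqv_refl)
  also have "\<dots> = monom [twist p y] * act1 x q + act0 (br x y) q"
  proof -
    have "const (1 / 2) * (?E + ?E) = (const (1 / 2) + const (1 / 2)) * ?E"
      by (simp only: distrib_left distrib_right)
    also have "\<dots> = ?E"
      by (simp add: single_add[symmetric])
    finally have half: "const (1 / 2) * (?E + ?E) = ?E" .
    have comm: "const (1 / 2) * (monom [twist p y] * z) = monom [twist p y] * (const (1 / 2) * z)" for z
      by (rule const_left_commute[symmetric])
    show ?thesis
      unfolding act1_def act0_def distrib_left[of "const (1 / 2)" "?E + ?E"] half comm
      by (simp only: distrib_left[of "monom [twist p y]"] add_ac)
  qed
  finally show ?thesis .
qed

end

lemma const_minus_1 [simp]: "const (- 1) * p = - p"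
  by (simp add: single_uminus)

lemma const_const_mult: "const a * (const b * p) = const (a * b) * p"
  by (simp add: mult.assoc[symmetric])

section \<open>Linearity of the operators in the Lie superalgebra element\<close>

context graded_induction_data
begin

lemma gpart_intros:
  "gpart (-1) x \<in> V" "gpart 0 x \<in> W 0" "gpart 1 x \<in> W 1"
  by (auto intro: gpart_in)

lemma gpart_add: "k \<in> {-1, 0, 1} \<Longrightarrow> gpart k (x + y) = gpart k x + gpart k y"
  and gpart_scale: "k \<in> {-1, 0, 1} \<Longrightarrow> gpart k (sc c x) = sc c (gpart k x)"
  using gpart_linear[of k] by (auto simp: Vector_Spaces.linear_iff)

lemma zero_W [simp]: "0 \<in> W k" and zero_P [simp]: "0 \<in> P p"
  by (rule subspace_0[OF W_subspace], rule subspace_0[OF P_subspace])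

text \<open>The coefficient letters [x + y,X_i] have to be split by the relations of the symmetric
  algebra, hence only a congruence. The same applies to the three lemmas that follow.\<close>

lemma act0_add:
  assumes "x \<in> W 0" "y \<in> W 0" "q \<in> polys V"
  shows "act0 (x + y) q \<doteq> act0 x q + act0 y q"
proof -
  have "act0 (x + y) q \<doteq> const (lam x + lam y) * q
      + (\<Sum>i\<in>I. (monom [br x (X i)] + monom [br y (X i)]) * drv i q)"
    unfolding act0_def br_simps lam_add[OF assms(1,2)]
    by (intro S.eqv_add S.eqv_sum S.eqv_mult_right letter_add drv_polys V_closed assms S.eqv_refl)
  also have "\<dots> = act0 x q + act0 y q"
    unfolding act0_def by (simp add: const_add distrib_right sum.distrib)
  finally show ?thesis .
qed

lemma act0_scale:
  assumes "x \<in> W 0" "q \<in> polys V"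
  shows "act0 (sc c x) q \<doteq> const c * act0 x q"
proof -
  have "act0 (sc c x) q \<doteq> const (c * lam x) * q
      + (\<Sum>i\<in>I. const c * monom [br x (X i)] * drv i q)"
    unfolding act0_def br_simps lam_scale[OF assms(1)]
    by (intro S.eqv_add S.eqv_sum S.eqv_mult_right letter_scale drv_polys V_closed assms S.eqv_refl)
  also have "\<dots> = const c * act0 x q"
    unfolding act0_def distrib_left sum_distrib_left by (simp only: mult.assoc const_const_mult)
  finally show ?thesis .
qed

lemma act1_add:
  assumes x: "x \<in> W 1" and y: "y \<in> W 1" and q: "q \<in> polys V"
  shows "act1 (x + y) q \<doteq> act1 x q + act1 y q"
proof -
  have L: "lam (br x (X i) + br y (X i)) = lam (br x (X i)) + lam (br y (X i))" if "i \<in> I" for i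
    by (intro lam_add V_closed x y that)
  have "act1 (x + y) q = (\<Sum>i\<in>I. const (lam (br x (X i)) + lam (br y (X i))) * drv i q)
      + const (1 / 2) * (\<Sum>i\<in>I. \<Sum>j\<in>I. monom [br (br x (X i)) (X j) + br (br y (X i)) (X j)]
          * drv j (drv i q))"
    unfolding act1_def br_simps
    by (intro arg_cong2[where f = "(+)"] sum.cong refl) (simp only: L)
  also have "\<dots> \<doteq> (\<Sum>i\<in>I. const (lam (br x (X i)) + lam (br y (X i))) * drv i q)
      + const (1 / 2) * (\<Sum>i\<in>I. \<Sum>j\<in>I. (monom [br (br x (X i)) (X j)] + monom [br (br y (X i)) (X j)])
          * drv j (drv i q))"
    by (intro S.eqv_add S.eqv_scale S.eqv_sum S.eqv_mult_right letter_add drv_polys V_closed x y q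
        S.eqv_refl)
  also have "\<dots> = act1 x q + act1 y q"
    unfolding act1_def by (simp add: const_add distrib_right distrib_left sum.distrib)
  finally show ?thesis .
qed

lemma act1_scale:
  assumes x: "x \<in> W 1" and q: "q \<in> polys V"
  shows "act1 (sc c x) q \<doteq> const c * act1 x q"
proof -
  have L: "lam (sc c (br x (X i))) = c * lam (br x (X i))" if "i \<in> I" for i
    by (intro lam_scale V_closed x that)
  have "act1 (sc c x) q = (\<Sum>i\<in>I. const (c * lam (br x (X i))) * drv i q)
      + const (1 / 2) * (\<Sum>i\<in>I. \<Sum>j\<in>I. monom [sc c (br (br x (X i)) (X j))] * drv j (drv i q))"
    unfolding act1_def br_simps
    by (intro arg_cong2[where f = "(+)"] sum.cong refl) (simp only: L)
  also have "\<dots> \<doteq> (\<Sum>i\<in>I. const (c * lam (br x (X i))) * drv i q)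
      + const (1 / 2) * (\<Sum>i\<in>I. \<Sum>j\<in>I. const c * monom [br (br x (X i)) (X j)] * drv j (drv i q))"
    by (intro S.eqv_add S.eqv_scale S.eqv_sum S.eqv_mult_right letter_scale drv_polys V_closed x q
        S.eqv_refl)
  also have "\<dots> = const c * act1 x q"
    unfolding act1_def distrib_left sum_distrib_left
    by (simp only: mult.assoc const_const_mult mult.commute[of c])
  finally show ?thesis .
qed

lemma act_add:
  assumes q: "q \<in> polys V"
  shows "act (x + y) q \<doteq> act x q + act y q"
proof -
  have "act (x + y) q \<doteq> (monom [gpart (-1) x] + monom [gpart (-1) y]) * q
      + (act0 (gpart 0 x) q + act0 (gpart 0 y) q) + (act1 (gpart 1 x) q + act1 (gpart 1 y) q)"
    unfolding act_def gpart_add[of "-1", simplified] gpart_add[of 0, simplified] gpart_add[of 1, simplified]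
    by (intro S.eqv_add S.eqv_mult_right letter_add act0_add act1_add gpart_intros q)
  also have "\<dots> = act x q + act y q"
    unfolding act_def by (simp add: distrib_right)
  finally show ?thesis .
qed

lemma act_scale:
  assumes q: "q \<in> polys V"
  shows "act (sc c x) q \<doteq> const c * act x q"
proof -
  have "act (sc c x) q \<doteq> const c * monom [gpart (-1) x] * q
      + const c * act0 (gpart 0 x) q + const c * act1 (gpart 1 x) q"
    unfolding act_def gpart_scale[of "-1", simplified] gpart_scale[of 0, simplified]
      gpart_scale[of 1, simplified]
    by (intro S.eqv_add S.eqv_mult_right letter_scale act0_scale act1_scale gpart_intros q)
  also have "\<dots> = const c * act x q"
    unfolding act_def by (simp only: distrib_left mult.assoc)
  finally show ?thesis .
qed

lemma act_zero_left: "q \<in> polys V \<Longrightarrow> act 0 q \<doteq> 0"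
  and act0_zero_left: "q \<in> polys V \<Longrightarrow> act0 0 q \<doteq> 0"
  and act1_zero_left: "q \<in> polys V \<Longrightarrow> act1 0 q \<doteq> 0"
  using act_scale[of q 0 0] act0_scale[of 0 q 0] act1_scale[of 0 q 0] by auto

lemma act_V:
  assumes "y \<in> V" "q \<in> polys V"
  shows "act y q \<doteq> monom [y] * q"
proof -
  have "act y q \<doteq> monom [y] * q + 0 + 0"
    unfolding act_def using assms
    by (intro S.eqv_add) (auto simp: gpart_W intro: act0_zero_left act1_zero_left)
  then show ?thesis by simp
qed

lemma letter_zero_mult: "q \<in> polys V \<Longrightarrow> monom [0] * q \<doteq> 0"
  using S.eqv_mult_right[OF letter_zero] by simp

lemma act_W0:
  assumes "x \<in> W 0" "q \<in> polys V"
  shows "act x q \<doteq> act0 x q"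
proof -
  have "act x q \<doteq> 0 + act0 x q + 0"
    unfolding act_def using assms
    by (intro S.eqv_add) (auto simp: gpart_W intro: letter_zero_mult act1_zero_left)
  then show ?thesis by simp
qed

lemma act_W1:
  assumes "x \<in> W 1" "q \<in> polys V"
  shows "act x q \<doteq> act1 x q"
proof -
  have "act x q \<doteq> 0 + 0 + act1 x q"
    unfolding act_def using assms
    by (intro S.eqv_add) (auto simp: gpart_W intro: letter_zero_mult act0_zero_left)
  then show ?thesis by simp
qed

text \<open>For \<open>x\<close> of degree 0 the bracket [x,y] lies in \<open>V\<close> and acts as
  a letter; for \<open>x\<close> of degree 1 it has degree 0 and acts by \<open>act0\<close>. So
  both letter rules say that the commutator with \<open>y\<close> is the action of [x,y].\<close>

lemma act_letter:
  assumes x: "x \<in> W k" "x \<in> P p" "0 \<le> k" and y: "y \<in> V" and q: "q \<in> polys V"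
  shows "act x (monom [y] * q) \<doteq> monom [twist p y] * act x q + act (br x y) q"
proof -
  have yq: "monom [y] * q \<in> polys V" and t: "monom [twist p y] \<in> polys V"
    by (intro polys_mult letter_polys twist_W y q)+
  have 0: "act x (monom [y] * q) \<doteq> monom [twist p y] * act x q + act (br x y) q" if x0: "x \<in> W 0"
  proof -
    have "act x (monom [y] * q) \<doteq> act0 x (monom [y] * q)"
      by (rule act_W0[OF x0 yq])
    also have "\<dots> \<doteq> monom [twist p y] * act0 x q + monom [br x y] * q"
      by (rule act0_letter[OF x0 x(2) y q])
    also have "\<dots> \<doteq> monom [twist p y] * act x q + act (br x y) q"
      by (intro S.eqv_add S.eqv_mult_left[OF _ t] S.eqv_sym[OF act_W0] S.eqv_sym[OF act_V]
          br_V_closed(1) x0 q y)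
    finally show ?thesis .
  qed
  have 1: "act x (monom [y] * q) \<doteq> monom [twist p y] * act x q + act (br x y) q" if x1: "x \<in> W 1"
  proof -
    have "act x (monom [y] * q) \<doteq> act1 x (monom [y] * q)"
      by (rule act_W1[OF x1 yq])
    also have "\<dots> \<doteq> monom [twist p y] * act1 x q + act0 (br x y) q"
      by (rule act1_letter[OF x1 x(2) y q])
    also have "\<dots> \<doteq> monom [twist p y] * act x q + act (br x y) q"
      by (intro S.eqv_add S.eqv_mult_left[OF _ t] S.eqv_sym[OF act_W0] S.eqv_sym[OF act_W1]
          br_V_closed(3) x1 q y)
    finally show ?thesis .
  qed
  \<comment> \<open>For k > 1 the space \<open>W k\<close> is zero, and 0 lies in
    \<open>W 0\<close>.\<close>
  have "x \<in> W 0 \<or> x \<in> W 1"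
    using x grading_bound[of k] by (cases "k \<in> {-1, 0, 1}") auto
  then show ?thesis
    using 0 1 by blast
qed

lemma act_letter_homogeneous:
  assumes x: "x \<in> W k" "x \<in> P p" "0 \<le> k" and y: "y \<in> V" "y \<in> P c" and q: "q \<in> polys V"
  shows "act x (monom [y] * q) \<doteq> const (ksign p c) * (monom [y] * act x q) + act (br x y) q"
proof -
  have "act x (monom [y] * q) \<doteq> monom [twist p y] * act x q + act (br x y) q"
    by (rule act_letter[OF x y(1) q])
  also have "\<dots> \<doteq> const (ksign p c) * monom [y] * act x q + act (br x y) q"
    unfolding twist_P[OF y(2)]
    by (intro S.eqv_add S.eqv_mult_right letter_scale act_polys y q S.eqv_refl)
  finally show ?thesis
    by (simp only: mult.assoc)
qed

section \<open>The bracket relation as an identity of operators modulo the symmetric ideal\<close>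

definition commutes where
  "commutes x p y q \<longleftrightarrow> (\<forall>f\<in>polys V.
     act x (act y f) \<doteq> const (ksign p q) * act y (act x f) + act (br x y) f)"

lemma commutesD: "commutes x p y q \<Longrightarrow> f \<in> polys V \<Longrightarrow>
    act x (act y f) \<doteq> const (ksign p q) * act y (act x f) + act (br x y) f"
  by (simp add: commutes_def)

text \<open>Multiplying by the sign, which squares to 1, and using skew symmetry of the bracket
  exchanges the roles. Additivity is then required in one argument only.\<close>

lemma commutes_sym:
  assumes "commutes x p y q" "x \<in> P p" "y \<in> P q"
  shows "commutes y q x p"
  unfolding commutes_def
proof
  fix f :: "'g list \<Rightarrow>\<^sub>0 'k" assume f: "f \<in> polys V"
  have b: "br y x = sc (- ksign p q) (br x y)"
    using br_skew[OF assms(3,2)] by (simp add: ksign_sym[of p q])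
  have "const (ksign q p) * act x (act y f) + act (br y x) f
      \<doteq> const (ksign p q) * (const (ksign p q) * act y (act x f) + act (br x y) f)
        + const (- ksign p q) * act (br x y) f"
    unfolding b ksign_sym[of q p]
    by (intro S.eqv_add S.eqv_scale commutesD assms f act_scale)
  also have "\<dots> = act y (act x f)"
    by (simp add: distrib_left const_const_mult single_uminus)
  finally show "act y (act x f) \<doteq> const (ksign q p) * act x (act y f) + act (br y x) f"
    by (rule S.eqv_sym)
qed

lemma commutes_add_left:
  assumes "commutes x p y q" "commutes x' p y q"
  shows "commutes (x + x') p y q"
  unfolding commutes_def
proof
  fix f :: "'g list \<Rightarrow>\<^sub>0 'k" assume f: "f \<in> polys V"
  have "act (x + x') (act y f) \<doteq> act x (act y f) + act x' (act y f)"
    by (intro act_add act_polys f)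
  also have "\<dots> \<doteq> (const (ksign p q) * act y (act x f) + act (br x y) f)
      + (const (ksign p q) * act y (act x' f) + act (br x' y) f)"
    by (intro S.eqv_add commutesD assms f)
  also have "\<dots> = const (ksign p q) * act y (act x f + act x' f) + (act (br x y) f + act (br x' y) f)"
    by (simp only: act_linear distrib_left add_ac)
  also have "\<dots> \<doteq> const (ksign p q) * act y (act (x + x') f) + act (br (x + x') y) f"
    unfolding br_simps
    by (intro S.eqv_add S.eqv_scale act_eqv S.eqv_sym[OF act_add] f)
  finally show "act (x + x') (act y f) \<doteq> const (ksign p q) * act y (act (x + x') f) + act (br (x + x') y) f" .
qed

lemma commutes_V:
  assumes "x \<in> V" "x \<in> P p" "y \<in> V" "y \<in> P q"
  shows "commutes x p y q"
  unfolding commutes_def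
proof
  fix f :: "'g list \<Rightarrow>\<^sub>0 'k" assume f: "f \<in> polys V"
  have *: "act u (act v f) \<doteq> monom [u] * monom [v] * f" if "u \<in> V" "v \<in> V" for u v
  proof -
    have "act u (act v f) \<doteq> monom [u] * act v f"
      by (intro act_V act_polys that f)
    also have "\<dots> \<doteq> monom [u] * (monom [v] * f)"
      by (intro S.eqv_mult_left act_V letter_polys that f)
    finally show ?thesis by (simp only: mult.assoc)
  qed
  have "act x (act y f) \<doteq> monom [x] * monom [y] * f"
    by (rule *[OF assms(1,3)])
  also have "\<dots> \<doteq> const (ksign p q) * (monom [y] * monom [x]) * f"
    by (intro S.eqv_mult_right letter_comm assms f)
  also have "\<dots> = const (ksign p q) * (monom [y] * monom [x] * f) + 0"
    by (simp only: mult.assoc add_0_right)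
  also have "\<dots> \<doteq> const (ksign p q) * act y (act x f) + act (br x y) f"
    unfolding br_V[OF assms(1,3)]
    by (intro S.eqv_add S.eqv_scale S.eqv_sym[OF *] S.eqv_sym[OF act_zero_left] assms f)
  finally show "act x (act y f) \<doteq> const (ksign p q) * act y (act x f) + act (br x y) f" .
qed

lemma commutes_letter:
  assumes x: "x \<in> W k" "x \<in> P p" "0 \<le> k" and y: "y \<in> V" "y \<in> P q"
  shows "commutes x p y q"
  unfolding commutes_def
proof
  fix f :: "'g list \<Rightarrow>\<^sub>0 'k" assume f: "f \<in> polys V"
  have "act x (act y f) \<doteq> act x (monom [y] * f)"
    by (intro act_eqv act_V y f)
  also have "\<dots> \<doteq> const (ksign p q) * (monom [y] * act x f) + act (br x y) f"
    by (rule act_letter_homogeneous[OF x y f])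
  also have "\<dots> \<doteq> const (ksign p q) * act y (act x f) + act (br x y) f"
    by (intro S.eqv_add S.eqv_scale S.eqv_sym[OF act_V] act_polys y f S.eqv_refl)
  finally show "act x (act y f) \<doteq> const (ksign p q) * act y (act x f) + act (br x y) f" .
qed

text \<open>The defect of the commutation relation supercommutes with multiplication by \<open>V\<close>, so it
  vanishes as soon as it kills the unit.\<close>

lemma commutes_step:
  assumes x: "x \<in> W k" "x \<in> P p" "0 \<le> k" and y: "y \<in> W l" "y \<in> P q" "0 \<le> l"
    and rx: "\<And>z c. z \<in> V \<Longrightarrow> z \<in> P c \<Longrightarrow> commutes x p (br y z) (q + c)"
    and ry: "\<And>z c. z \<in> V \<Longrightarrow> z \<in> P c \<Longrightarrow> commutes y q (br x z) (p + c)"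
    and unit: "act x (act y 1) \<doteq> const (ksign p q) * act y (act x 1) + act (br x y) 1"
  shows "commutes x p y q"
proof -
  \<comment> \<open>The defect of the relation, as an operator on representatives, so that its
    vanishing means membership in the ideal.\<close>
  define C where "C f = act x (act y f) - const (ksign p q) * act y (act x f) - act (br x y) f" for f
  have C_linear: "C (f + g) = C f + C g" "C (const a * f) = const a * C f" for f g a
    unfolding C_def
    by (simp_all add: act_linear algebra_simps const_left_commute[of "const (ksign p q)" a])
  have C_JS: "C f \<in> JS" if "f \<in> JS" for f
    unfolding C_def by (intro S.J_diff S.J_scale act_JS that)
  have bxy: "br x y \<in> W (k + l)" "br x y \<in> P (p + q)" "0 \<le> k + l"
    using grading_br[OF x(1) y(1)] br_parity[OF x(2) y(2)] x(3) y(3) by simp_all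
  \<comment> \<open>Pulling \<open>z\<close> out of both orders of composition leaves terms with
    [x,z] and [y,z]. Once \<open>rx\<close> and \<open>ry\<close> have reordered them they cancel
    pairwise, and the remaining triple brackets cancel by Jacobi.\<close>
  have C_hom: "C (monom [z] * f) \<doteq> const (ksign (p + q) c) * (monom [z] * C f)"
    if z: "z \<in> V" "z \<in> P c" and f: "f \<in> polys V" for z c f
  proof -
    \<comment> \<open>Named signs are treated as commuting scalars; the only special fact the final
      cancellation draws on is e1 * e1 = 1.\<close>
    define e1 e2 e3 :: 'k where "e1 = ksign p q" and "e2 = ksign p c" and "e3 = ksign q c"
    have e: "ksign p (q + c) = e1 * e2" "ksign q (p + c) = e1 * e3" "ksign (p + q) c = e2 * e3"
      "e1 * e1 = 1"
      by (simp_all only: e1_def e2_def e3_def ksign_add_left ksign_add_right ksign_square ksign_sym[of q p])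
    note F = act_polys(3) f
    have t1: "act x (act y (monom [z] * f)) \<doteq>
        const e3 * (const e2 * (monom [z] * act x (act y f)) + act (br x z) (act y f))
        + (const (e1 * e2) * act (br y z) (act x f) + act (br x (br y z)) f)"
    proof -
      have "act x (act y (monom [z] * f)) \<doteq> act x (const e3 * (monom [z] * act y f) + act (br y z) f)"
        unfolding e3_def by (intro act_eqv act_letter_homogeneous[OF y] z F)
      also have "\<dots> = const e3 * act x (monom [z] * act y f) + act x (act (br y z) f)"
        by (simp only: act_linear)
      also have "\<dots> \<doteq> const e3 * (const e2 * (monom [z] * act x (act y f)) + act (br x z) (act y f))
          + (const (e1 * e2) * act (br y z) (act x f) + act (br x (br y z)) f)"
        unfolding e2_def e(1)[symmetric, unfolded e2_def]
        by (intro S.eqv_add S.eqv_scale act_letter_homogeneous[OF x] z F commutesD rx)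
      finally show ?thesis .
    qed
    have t2: "act y (act x (monom [z] * f)) \<doteq>
        const e2 * (const e3 * (monom [z] * act y (act x f)) + act (br y z) (act x f))
        + (const (e1 * e3) * act (br x z) (act y f) + act (br y (br x z)) f)"
    proof -
      have "act y (act x (monom [z] * f)) \<doteq> act y (const e2 * (monom [z] * act x f) + act (br x z) f)"
        unfolding e2_def by (intro act_eqv act_letter_homogeneous[OF x] z F)
      also have "\<dots> = const e2 * act y (monom [z] * act x f) + act y (act (br x z) f)"
        by (simp only: act_linear)
      also have "\<dots> \<doteq> const e2 * (const e3 * (monom [z] * act y (act x f)) + act (br y z) (act x f))
          + (const (e1 * e3) * act (br x z) (act y f) + act (br y (br x z)) f)"
        unfolding e3_def e(2)[symmetric, unfolded e3_def]
        by (intro S.eqv_add S.eqv_scale act_letter_homogeneous[OF y] z F commutesD ry)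
      finally show ?thesis .
    qed
    have t3: "act (br x y) (monom [z] * f) \<doteq>
        const (e2 * e3) * (monom [z] * act (br x y) f) + act (br (br x y) z) f"
      unfolding e(3)[symmetric] by (intro act_letter_homogeneous[OF bxy(1,2,3)] z F)
    have t4: "act (br x (br y z)) f \<doteq> act (br (br x y) z) f + const e1 * act (br y (br x z)) f"
    proof -
      have "act (br x (br y z)) f \<doteq> act (br (br x y) z) f + act (sc e1 (br y (br x z))) f"
        unfolding br_jacobi[OF x(2) y(2)] e1_def by (rule act_add[OF f])
      also have "\<dots> \<doteq> act (br (br x y) z) f + const e1 * act (br y (br x z)) f"
        by (intro S.eqv_add act_scale f S.eqv_refl)
      finally show ?thesis .
    qed
    have "C (monom [z] * f) \<doteq>
        const e3 * (const e2 * (monom [z] * act x (act y f)) + act (br x z) (act y f))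
        + (const (e1 * e2) * act (br y z) (act x f)
          + (act (br (br x y) z) f + const e1 * act (br y (br x z)) f))
        - const e1 * (const e2 * (const e3 * (monom [z] * act y (act x f)) + act (br y z) (act x f))
        + (const (e1 * e3) * act (br x z) (act y f) + act (br y (br x z)) f))
        - (const (e2 * e3) * (monom [z] * act (br x y) f) + act (br (br x y) z) f)"
      unfolding C_def e1_def[symmetric]
      by (intro S.eqv_diff S.eqv_scale t2 t3
          S.eqv_trans[OF t1 S.eqv_add[OF S.eqv_refl S.eqv_add[OF S.eqv_refl t4]]])
    also have "\<dots> = const (e2 * e3) * (monom [z] * C f)"
    proof -
      have e3: "e1 * (e1 * e3) = e3"
        unfolding mult.assoc[symmetric] e(4) by simp
      show ?thesis
        unfolding C_def e1_def[symmetric]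
        by (simp add: right_diff_distrib distrib_left const_const_mult
            const_left_commute[of "monom [z]"] mult_ac del: single_mult_list)
          (simp only: e3)
    qed
    finally show ?thesis
      unfolding e(3) .
  qed
  \<comment> \<open>Words are built from the unit by multiplying with letters, so the defect is
    removed letter by letter. The leading letter is split by parity because \<open>C_hom\<close>
    concerns homogeneous letters.\<close>
  have C0: "C f \<in> JS" if "f \<in> polys V" for f
    using that
  proof (induction rule: polys_induct)
    case (monom w)
    then show ?case
    proof (induction w)
      case Nil
      then show ?case
        using unit unfolding C_def S.eqv_def by (simp add: algebra_simps)
    next
      case (Cons z w)
      then have z: "z \<in> V" and w: "monom w \<in> polys V" and IH: "C (monom w) \<in> JS"
        by (auto intro: single_polys)
      have hom: "C (monom [ppart c z] * monom w) \<in> JS" for c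
        by (rule S.eqv_J[OF C_hom[OF ppart_W[OF z] ppart_in w]])
          (intro S.J_scale S.J_mult_left IH letter_polys ppart_W z)
      have "monom [z] \<doteq> monom [ppart 0 z] + monom [ppart 1 z]"
        using letter_add[of "ppart 0 z" "ppart 1 z"] ppart_W[OF z] by (simp add: ppart_sum)
      then have "monom (z # w) - (monom [ppart 0 z] + monom [ppart 1 z]) * monom w \<in> JS"
        using S.eqv_mult_right[OF _ w] by (fastforce simp: S.eqv_def)
      from S.J_add[OF C_JS[OF this] S.J_add[OF hom[of 0] hom[of 1]]] show ?case
        by (simp only: C_linear(1)[symmetric] distrib_right diff_add_cancel)
    qed
  qed (simp_all add: C_linear S.J_add S.J_scale)
  show ?thesis
    unfolding commutes_def
    using C0 by (auto simp: C_def S.eqv_def algebra_simps)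
qed

lemma drv_1 [simp]: "drv i 1 = 0"
  by (simp add: drv_def derivation_def)

text \<open>Derivatives kill the unit, so only the scalar term of degree 0 survives; for
  \<open>x\<close> of degree 1 its degree 0 component is zero.\<close>

lemma act_unit:
  assumes "x \<in> W 0 \<or> x \<in> W 1"
  shows "act x 1 \<doteq> const (lam (gpart 0 x))"
  using assms
proof
  assume "x \<in> W 0"
  then show ?thesis
    using act_W0[of x 1] by (simp add: gpart_W act0_def one_polys)
next
  assume "x \<in> W 1"
  then show ?thesis
    using act_W1[of x 1] by (simp add: gpart_W act1_def one_polys drv_linear lam_0)
qed

text \<open>Both elements act on the unit by scalars. These commute with the sign because the
  character is zero on odd elements. The bracket acts by zero: the character kills brackets of
  degree 0, and a bracket of positive degree has no degree 0 component.\<close>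

lemma act_unit_commute:
  assumes x: "x \<in> W k" "x \<in> P p" "k = 0 \<or> k = 1" and y: "y \<in> W l" "y \<in> P q" "l = 0 \<or> l = 1"
  shows "act x (act y 1) \<doteq> const (ksign p q) * act y (act x 1) + act (br x y) 1"
proof -
  have *: "act u (act v 1) \<doteq> const (lam (gpart 0 v) * lam (gpart 0 u))"
    if "u \<in> W 0 \<or> u \<in> W 1" "v \<in> W 0 \<or> v \<in> W 1" for u v
  proof -
    have "act u (act v 1) \<doteq> act u (const (lam (gpart 0 v)) * 1)"
      using act_eqv[OF act_unit[OF that(2)]] by simp
    also have "\<dots> = const (lam (gpart 0 v)) * act u 1"
      by (rule act_linear)
    also have "\<dots> \<doteq> const (lam (gpart 0 v)) * const (lam (gpart 0 u))"
      by (intro S.eqv_scale act_unit that)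
    finally show ?thesis by simp
  qed
  have b: "act (br x y) 1 \<doteq> 0"
  proof -
    have "br x y \<in> W 0 \<or> br x y \<in> W 1" "lam (gpart 0 (br x y)) = 0"
      using x y gpart_W[of 0 0 0] br_W11[of x y] br_V_closed(5-7)[of x y] br_V_closed(7)[of x y]
      by (auto simp: gpart_W lam_br lam_0)
    then show ?thesis
      using act_unit[of "br x y"] by simp
  qed
  have e: "ksign p q * (lam (gpart 0 x) * lam (gpart 0 y)) = lam (gpart 0 y) * lam (gpart 0 x)"
    using lam_odd[of "gpart 0 x"] gpart_P[OF x(2)] gpart_intros(2)[of x]
    by (cases p) (auto simp: ksign_def)
  have "act x (act y 1) \<doteq> const (ksign p q) * const (lam (gpart 0 x) * lam (gpart 0 y)) + 0"
    using *[of x y] x y by (auto simp: e)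
  also have "\<dots> \<doteq> const (ksign p q) * act y (act x 1) + act (br x y) 1"
    using x y by (intro S.eqv_add S.eqv_scale S.eqv_sym[OF b] S.eqv_sym[OF *]) auto
  finally show ?thesis .
qed

text \<open>Bracketing with \<open>z\<close> lands in \<open>V\<close>, where the relation is the
  letter rule.\<close>

lemma commutes_00:
  assumes x: "x \<in> W 0" "x \<in> P p" and y: "y \<in> W 0" "y \<in> P q"
  shows "commutes x p y q"
proof (rule commutes_step[OF x _ y])
  fix z c assume z: "z \<in> V" "z \<in> P c"
  show "commutes x p (br y z) (q + c)"
    by (intro commutes_letter[OF x] br_V_closed(1) br_parity x y z) simp_all
  show "commutes y q (br x z) (p + c)"
    by (intro commutes_letter[OF y] br_V_closed(1) br_parity x y z) simp_all
qed (use act_unit_commute[OF x _ y] in simp_all)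

text \<open>Here [y,z] has degree 0 and [x,z] lies in \<open>V\<close>, so one auxiliary relation is
  \<open>commutes_00\<close> and the other is the letter rule.\<close>

lemma commutes_01:
  assumes x: "x \<in> W 0" "x \<in> P p" and y: "y \<in> W 1" "y \<in> P q"
  shows "commutes x p y q"
proof (rule commutes_step[OF x _ y])
  fix z c assume z: "z \<in> V" "z \<in> P c"
  show "commutes x p (br y z) (q + c)"
    by (intro commutes_00 br_V_closed(3) br_parity x y z)
  show "commutes y q (br x z) (p + c)"
    by (intro commutes_letter[OF y] br_V_closed(1) br_parity x y z) simp_all
qed (use act_unit_commute[OF x _ y] in simp_all)

lemma commutes_10:
  assumes "x \<in> W 1" "x \<in> P p" "y \<in> W 0" "y \<in> P q"
  shows "commutes x p y q"
  by (intro commutes_sym[OF commutes_01] assms)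

text \<open>Both brackets with \<open>z\<close> have degree 0, so the auxiliary relations are those
  between degrees 1 and 0.\<close>

lemma commutes_11:
  assumes x: "x \<in> W 1" "x \<in> P p" and y: "y \<in> W 1" "y \<in> P q"
  shows "commutes x p y q"
proof (rule commutes_step[OF x _ y])
  fix z c assume z: "z \<in> V" "z \<in> P c"
  show "commutes x p (br y z) (q + c)"
    by (intro commutes_10 br_V_closed(3) br_parity x y z)
  show "commutes y q (br x z) (p + c)"
    by (intro commutes_10 br_V_closed(3) br_parity x y z)
qed (use act_unit_commute[OF x _ y] in simp_all)

lemma commutes_homogeneous:
  assumes x: "x \<in> W k" "x \<in> P p" "k \<in> {-1, 0, 1}" and y: "y \<in> W l" "y \<in> P q" "l \<in> {-1, 0, 1}"
  shows "commutes x p y q"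
proof -
  consider "k = -1" "l = -1" | "0 \<le> k" "l = -1" | "k = -1" "0 \<le> l"
    | "k = 0" "l = 0" | "k = 0" "l = 1" | "k = 1" "l = 0" | "k = 1" "l = 1"
    using x(3) y(3) by force
  then show ?thesis
  proof cases
    case 1
    then show ?thesis using commutes_V x y by blast
  next
    case 2
    then show ?thesis using commutes_letter x y by blast
  next
    case 3
    then show ?thesis using commutes_sym[OF commutes_letter] x y by blast
  next
    case 4
    then show ?thesis using commutes_00 x y by blast
  next
    case 5
    then show ?thesis using commutes_01 x y by blast
  next
    case 6
    then show ?thesis using commutes_10 x y by blast
  next
    case 7
    then show ?thesis using commutes_11 x y by blast
  qed
qed

lemma commutes_all:
  assumes x: "x \<in> P p" and y: "y \<in> P q"
  shows "commutes x p y q"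
proof -
  \<comment> \<open>Additivity is available on the left, so \<open>y\<close> is decomposed after
    exchanging the two arguments.\<close>
  have 1: "commutes u p y q" if u: "u \<in> W k" "u \<in> P p" "k \<in> {-1, 0, 1}" for u k
  proof -
    have "commutes (gpart (-1) y + gpart 0 y + gpart 1 y) q u p"
      by (intro commutes_add_left commutes_homogeneous[OF gpart_intros(1) _ _ u]
          commutes_homogeneous[OF gpart_intros(2) _ _ u] commutes_homogeneous[OF gpart_intros(3) _ _ u]
          gpart_P y) auto
    then have "commutes y q u p"
      by (simp only: gpart_sum)
    then show ?thesis
      by (rule commutes_sym[OF _ y u(2)])
  qed
  have "commutes (gpart (-1) x + gpart 0 x + gpart 1 x) p y q"
    by (intro commutes_add_left 1[OF gpart_intros(1)] 1[OF gpart_intros(2)] 1[OF gpart_intros(3)]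
        gpart_P x) auto
  then show ?thesis
    by (simp only: gpart_sum)
qed

section \<open>The action of the enveloping algebra\<close>

lemma subset_polys_UNIV: "R \<subseteq> polys UNIV"
  by (simp add: polys_def)

sublocale U: free_quotient UNIV "env_ideal sc P br UNIV"
  unfolding env_ideal_def by (rule genideal_free_algebra[OF subset_polys_UNIV])

abbreviation JU where "JU \<equiv> env_ideal sc P br UNIV"

text \<open>The free algebra acts on polynomials by composing the letter operators, the last letter
  of a word acting first.\<close>

definition ev where "ev p f = lin (\<lambda>w. foldr act w f) p"

lemma foldr_act_polys: "f \<in> polys V \<Longrightarrow> foldr act w f \<in> polys V"
  by (induction w) (auto intro: act_polys)

lemma foldr_act_linear:
  "foldr act w (p + q) = foldr act w p + foldr act w q"
  "foldr act w (const c * p) = const c * foldr act w p"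
  by (induction w) (auto simp: act_linear)

lemma ev_linear:
  "ev (p + q) f = ev p f + ev q f" "ev (const c * p) f = const c * ev p f"
  "ev (p - q) f = ev p f - ev q f" "ev 0 f = 0" "ev (Poly_Mapping.single w c) f = const c * foldr act w f"
  "ev 1 f = f"
  by (simp_all add: ev_def lin_add lin_scale lin_diff)

lemma ev_add_right: "ev p (f + g) = ev p f + ev p g"
  by (simp add: ev_def lin_def foldr_act_linear distrib_left sum.distrib)

lemma ev_scale_right: "ev p (const c * f) = const c * ev p f"
  by (simp add: ev_def lin_def foldr_act_linear sum_distrib_left const_left_commute[of _ c])

lemma ev_polys: "f \<in> polys V \<Longrightarrow> ev p f \<in> polys V"
  unfolding ev_def by (rule lpolys[OF polys_UNIV]) (rule foldr_act_polys)

lemma ev_JS: "f \<in> JS \<Longrightarrow> ev p f \<in> JS"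
proof -
  assume f: "f \<in> JS"
  have "foldr act w f \<in> JS" for w
    by (induction w) (auto intro: act_JS f)
  then show ?thesis
    unfolding ev_def lin_def by (intro S.J_sum S.J_scale)
qed

lemma ev_mult: "ev (p * q) f = ev p (ev q f)"
proof (induction p rule: poly_mapping_list_induct)
  case (monom u)
  show ?case
  proof (induction q rule: poly_mapping_list_induct)
    case (scale c q)
    then show ?case
      by (simp only: const_left_commute[of "monom u" c q] ev_linear(2) ev_scale_right)
  qed (simp_all add: ev_linear ev_add_right distrib_left)
next
  case (scale c p)
  then show ?case
    by (simp only: mult.assoc ev_linear(2))
qed (simp add: ev_linear distrib_right)

text \<open>This turns the operators into a module over the enveloping algebra: linearity of
  \<open>act\<close> in its first argument handles the linear relations, \<open>commutes_all\<close>
  the bracket relations. The polynomial \<open>f\<close> is arbitrary in the induction because a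
  right factor \<open>q\<close> replaces it by \<open>ev q f\<close>.\<close>

lemma ev_JU:
  assumes "p \<in> JU" "f \<in> polys V"
  shows "ev p f \<in> JS"
  using assms unfolding env_ideal_def
proof (induction arbitrary: f rule: genideal_free_algebra_induct[OF _ subset_polys_UNIV,
      consumes 1, case_names rel zero add left right])
  case (rel p)
  have "ev (monom [x + y] - monom [x] - monom [y]) f \<in> JS" for x y
    using act_add[OF rel(2), of x y] by (simp add: ev_linear S.eqv_def diff_diff_eq)
  moreover have "ev (monom [sc c x] - Poly_Mapping.single [x] c) f \<in> JS" for c x
    using act_scale[OF rel(2), of c x] by (simp add: ev_linear S.eqv_def)
  moreover have "ev (monom [x, y] - Poly_Mapping.single [y, x] (ksign p q) - monom [br x y]) f \<in> JS"
    if "x \<in> P p" "y \<in> P q" for x y p q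
    using commutesD[OF commutes_all[OF that] rel(2)] by (simp add: ev_linear S.eqv_def diff_diff_eq)
  ultimately show ?case
    using rel(1) by (auto simp: linear_rels_def)
qed (auto simp: ev_linear ev_mult intro: S.J_zero S.J_add ev_JS ev_polys)

text \<open>Letters of \<open>V\<close> act by multiplication, so a polynomial in them rebuilds
  itself from the unit. This makes the retraction a left inverse.\<close>

lemma ev_V:
  assumes "p \<in> polys V"
  shows "ev p 1 \<doteq> p"
  using assms
proof (induction rule: polys_induct)
  case (monom w)
  then show ?case
  proof (induction w)
    case (Cons y w)
    then have y: "y \<in> V" and w: "monom w \<in> polys V" and IH: "foldr act w 1 \<doteq> monom w"
      by (auto intro: single_polys simp: ev_linear)
    have "act y (foldr act w 1) \<doteq> act y (monom w)"
      by (rule act_eqv[OF IH])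
    also have "\<dots> \<doteq> monom [y] * monom w"
      by (rule act_V[OF y w])
    finally show ?case
      by (simp add: ev_linear)
  qed (simp add: ev_linear)
qed (auto simp: ev_linear intro: S.eqv_scale S.eqv_add)

end

section \<open>Symmetrisation\<close>

text \<open>A product over inversions, organised by their first entry: the recursion mirrors
  insertion sort, whereas \<open>koszul_sign\<close> ranges over pairs of positions.\<close>

fun inversion_prod :: "('i::linorder \<Rightarrow> 'i \<Rightarrow> 'a::comm_monoid_mult) \<Rightarrow> 'i list \<Rightarrow> 'a" where
  "inversion_prod f [] = 1"
| "inversion_prod f (l # ls) = prod_list (map (\<lambda>j. if j < l then f l j else 1) ls) * inversion_prod f ls"

lemma inversion_prod_eq:
  fixes f :: "'i::linorder \<Rightarrow> 'i \<Rightarrow> 'a::comm_monoid_mult"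
  shows "(\<Prod>(i, j) \<in> {(i, j). i < j \<and> j < length ls \<and> ls ! i > ls ! j}. f (ls ! i) (ls ! j)) = inversion_prod f ls"
proof (induction ls)
  case Nil
  then show ?case by simp
next
  case (Cons l ls)
  let ?S = "\<lambda>ls. {(i, j). i < j \<and> j < length ls \<and> ls ! i > ls ! j}"
  let ?A = "{j. j < length ls \<and> l > ls ! j}"
  have fin: "finite (?S ls)" for ls :: "'i list"
    by (rule finite_subset[of _ "{..length ls} \<times> {..length ls}"]) auto
  \<comment> \<open>An inversion either starts at position 0 or is a shifted inversion of the
    tail.\<close>
  have "?S (l # ls) = (\<lambda>j. (0, Suc j)) ` ?A \<union> map_prod Suc Suc ` ?S ls" (is "?L = ?R")
  proof
    show "?L \<subseteq> ?R"
    proof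
      fix z assume "z \<in> ?L"
      then obtain i j where z: "z = (i, Suc j)" "i < Suc j" "j < length ls" "(l # ls) ! i > ls ! j"
        by (auto simp: less_Suc_eq_0_disj)
      then show "z \<in> ?R"
        by (cases i) auto
    qed
  qed auto
  then have "(\<Prod>(i, j) \<in> ?S (l # ls). f ((l # ls) ! i) ((l # ls) ! j))
      = (\<Prod>(i, j) \<in> (\<lambda>j. (0, Suc j)) ` ?A. f ((l # ls) ! i) ((l # ls) ! j))
        * (\<Prod>(i, j) \<in> map_prod Suc Suc ` ?S ls. f ((l # ls) ! i) ((l # ls) ! j))"
    using fin[of ls] by (simp only:) (rule prod.union_disjoint, auto)
  also have "(\<Prod>(i, j) \<in> map_prod Suc Suc ` ?S ls. f ((l # ls) ! i) ((l # ls) ! j)) = inversion_prod f ls"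
    by (subst prod.reindex) (auto simp: inj_on_def Cons.IH[symmetric] intro!: prod.cong)
  also have "(\<Prod>(i, j) \<in> (\<lambda>j. (0, Suc j)) ` ?A. f ((l # ls) ! i) ((l # ls) ! j)) = (\<Prod>j\<in>?A. f l (ls ! j))"
    by (subst prod.reindex) (auto simp: inj_on_def)
  also have "\<dots> = (\<Prod>j\<in>{j \<in> {0..<length ls}. l > ls ! j}. f l (ls ! j))"
    by (rule prod.cong) auto
  also have "\<dots> = (\<Prod>j\<in>{0..<length ls}. if l > ls ! j then f l (ls ! j) else 1)"
    by (rule prod.inter_filter) simp
  also have "\<dots> = prod_list (map (\<lambda>j. if j < l then f l j else 1) ls)"
    by (subst prod.list_conv_set_nth) simp
  finally show ?case
    by simp
qed

lemma prod_list_map_sort: "prod_list (map g (sort ls)) = (prod_list (map g ls) :: 'a::comm_monoid_mult)"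
  by (metis mset_map mset_sort prod_mset_prod_list)

section \<open>Koszul signs and the reordering of words\<close>

context graded_induction_data
begin

abbreviation homogeneous where "homogeneous \<equiv> homogeneous_list P V"

text \<open>Inserting \<open>l\<close> moves its letter to the right past the smaller entries, one
  supercommutation for each. The signs acquired are cancelled by the product in front, since each
  squares to 1.\<close>

lemma insort_word:
  assumes "sorted ms" "\<And>j. j \<in> insert l (set ms) \<Longrightarrow> x j \<in> V \<and> x j \<in> P (p j)"
  shows "const (prod_list (map (\<lambda>j. if j < l then ksign (p l) (p j) else 1) ms))
      * (monom [x l] * monom (map x ms)) \<doteq> monom (map x (insort l ms))"
  using assms
proof (induction ms)
  case Nil
  then show ?case by simp
next
  case (Cons m ms)
  let ?pr = "\<lambda>ms. prod_list (map (\<lambda>j. if j < l then ksign (p l) (p j) else (1 :: 'k)) ms)"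
  show ?case
  proof (cases "l \<le> m")
    \<comment> \<open>In a sorted list nothing after \<open>m\<close> is smaller than
      \<open>l\<close> either, so no sign is due.\<close>
    case True
    then have "map (\<lambda>j. if j < l then ksign (p l) (p j) else (1 :: 'k)) (m # ms) = map (\<lambda>j. 1) (m # ms)"
      using Cons.prems(1) by (intro map_cong) auto
    moreover have "prod_list (map (\<lambda>j. 1 :: 'k) (m # ms)) = 1"
      by (induction ms) auto
    ultimately have "?pr (m # ms) = 1"
      by (simp only:)
    then show ?thesis
      using True by simp
  next
    case False
    have V: "x l \<in> V" "x l \<in> P (p l)" "x m \<in> V" "x m \<in> P (p m)" "monom (map x ms) \<in> polys V"
      using Cons.prems(2) by (auto intro!: single_polys)
    let ?e = "ksign (p l) (p m) :: 'k"
    have "const (?pr (m # ms)) * (monom [x l] * monom (map x (m # ms)))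
        = const (?pr ms) * (const ?e * (monom [x l] * monom [x m] * monom (map x ms)))"
      using False by (simp add: mult.commute not_le)
    also have "\<dots> \<doteq> const (?pr ms) * (const ?e * (const ?e * (monom [x m] * monom [x l]) * monom (map x ms)))"
      by (intro S.eqv_scale S.eqv_mult_right letter_comm V)
    also have "\<dots> = monom [x m] * (const (?pr ms) * (monom [x l] * monom (map x ms)))"
      by (simp add: mult.commute)
    also have "\<dots> \<doteq> monom [x m] * monom (map x (insort l ms))"
      using Cons by (intro S.eqv_mult_left letter_polys V) auto
    finally show ?thesis
      using False by simp
  qed
qed

lemma sort_word:
  assumes "\<And>j. j \<in> set ls \<Longrightarrow> x j \<in> V \<and> x j \<in> P (p j)"
  shows "const (inversion_prod (\<lambda>l j. ksign (p l) (p j)) ls) * monom (map x ls) \<doteq> monom (map x (sort ls))"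
  using assms
proof (induction ls)
  case Nil
  then show ?case by simp
next
  case (Cons l ls)
  let ?pr = "prod_list (map (\<lambda>j. if j < l then ksign (p l) (p j) else (1 :: 'k)) ls)"
  let ?q = "inversion_prod (\<lambda>l j. ksign (p l) (p j)) ls"
  have "const (inversion_prod (\<lambda>l j. ksign (p l) (p j)) (l # ls)) * monom (map x (l # ls))
      = const ?pr * (monom [x l] * (const ?q * monom (map x ls)))"
    by simp
  also have "\<dots> \<doteq> const ?pr * (monom [x l] * monom (map x (sort ls)))"
    using Cons by (intro S.eqv_scale S.eqv_mult_left letter_polys) auto
  \<comment> \<open>The sign of the head against the tail depends only on the multiset of tail
    entries, so it is unaffected by sorting the tail.\<close>
  also have "?pr = prod_list (map (\<lambda>j. if j < l then ksign (p l) (p j) else 1) (sort ls))"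
    by (rule prod_list_map_sort[symmetric])
  also have "const \<dots> * (monom [x l] * monom (map x (sort ls))) \<doteq> monom (map x (insort l (sort ls)))"
    using Cons.prems by (intro insort_word) auto
  finally show ?case
    by simp
qed

text \<open>The values of \<open>t\<close> at 0, ..., n - 1 form a list whose inversions are those
  in \<open>koszul_sign\<close>, and sorting that list of indices restores the original
  word.\<close>

lemma permuted_word:
  assumes xs: "homogeneous xs ps" and t: "t permutes {..<length xs}"
  shows "Poly_Mapping.single (permute_list t xs) (koszul_sign ps t) \<doteq> monom xs"
proof -
  let ?n = "length xs"
  let ?ls = "map t [0..<?n]"
  have len: "length ps = ?n" and hom: "\<And>j. j < ?n \<Longrightarrow> xs ! j \<in> V \<and> xs ! j \<in> P (ps ! j)"
    using xs by (auto simp: homogeneous_list_def list_all2_conv_all_nth)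
  have set: "set ?ls = {..<?n}"
    using permutes_image[OF t] by (simp add: lessThan_atLeast0)
  have "distinct ?ls"
    using permutes_inj_on[OF t] by (simp add: distinct_map)
  then have sort: "sort ?ls = [0..<?n]"
    using set by (intro sorted_distinct_set_unique) auto
  have "koszul_sign ps t
      = (\<Prod>(i, j) \<in> {(i, j). i < j \<and> j < length ?ls \<and> ?ls ! i > ?ls ! j}. ksign (ps ! (?ls ! i)) (ps ! (?ls ! j)))"
    unfolding koszul_sign_def len by (rule prod.cong) auto
  also have "\<dots> = inversion_prod (\<lambda>l j. ksign (ps ! l) (ps ! j)) ?ls"
    by (rule inversion_prod_eq)
  finally have k: "koszul_sign ps t = (inversion_prod (\<lambda>l j. ksign (ps ! l) (ps ! j)) ?ls :: 'k)" .
  have "const (inversion_prod (\<lambda>l j. ksign (ps ! l) (ps ! j)) ?ls) * monom (map ((!) xs) ?ls)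
      \<doteq> monom (map ((!) xs) (sort ?ls))"
    by (rule sort_word) (use set hom in auto)
  then show ?thesis
    by (simp add: k sort map_nth permute_list_def comp_def)
qed

text \<open>All n! summands are congruent to the word itself, and the factor 1/n! averages
  them.\<close>

lemma symmetrised_word:
  assumes xs: "homogeneous xs ps"
  shows "symmetrised xs ps \<doteq> monom xs"
proof -
  let ?T = "{t. t permutes {..<length xs}}"
  have "symmetrised xs ps \<doteq> const (1 / fact (length xs)) * (\<Sum>t\<in>?T. monom xs)"
    unfolding symmetrised_def by (intro S.eqv_scale S.eqv_sum permuted_word[OF xs]) auto
  also have "(\<Sum>t\<in>?T. monom xs :: 'g list \<Rightarrow>\<^sub>0 'k) = const (fact (length xs)) * monom xs"
  proof -
    have "(of_nat n :: 'g list \<Rightarrow>\<^sub>0 'k) = const (of_nat n)" for n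
      by (induction n) (simp_all add: const_add)
    from this[of "fact (length xs)"] have "of_nat (fact (length xs)) = (const (fact (length xs)) :: 'g list \<Rightarrow>\<^sub>0 'k)"
      by (simp only: of_nat_fact)
    moreover have "card ?T = fact (length xs)"
      by (simp add: card_permutations[OF refl])
    ultimately show ?thesis
      by (simp only: sum_constant)
  qed
  also have "const (1 / fact (length xs) :: 'k) * (const (fact (length xs)) * monom xs) = monom xs"
    by simp
  finally show ?thesis .
qed

lemma word_polys:
  "homogeneous xs ps \<Longrightarrow> Poly_Mapping.single xs c \<in> polys V"
  by (intro single_polys)
    (auto simp: homogeneous_list_def list_all2_conv_all_nth in_set_conv_nth)

text \<open>Words in homogeneous letters span only modulo the ideal, since splitting a letter into
  parity components uses a relation; hence the case \<open>eqv\<close>.\<close>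

lemma homogeneous_word_induct [consumes 1, case_names word scale add eqv]:
  assumes "p \<in> polys V"
    and word: "\<And>xs ps. homogeneous xs ps \<Longrightarrow> Q (monom xs)"
    and scale: "\<And>c q. q \<in> polys V \<Longrightarrow> Q q \<Longrightarrow> Q (const c * q)"
    and add: "\<And>q q'. q \<in> polys V \<Longrightarrow> q' \<in> polys V \<Longrightarrow> Q q \<Longrightarrow> Q q' \<Longrightarrow> Q (q + q')"
    and eqv: "\<And>q q'. q \<in> polys V \<Longrightarrow> q' \<in> polys V \<Longrightarrow> q \<doteq> q' \<Longrightarrow> Q q \<Longrightarrow> Q q'"
  shows "Q p"
  using assms(1)
proof (induction rule: polys_induct)
  case (monom w)
  \<comment> \<open>The prefix \<open>u\<close> collects the letters already split, together with
    their parities.\<close>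
  have "Q (monom (u @ w))" if "homogeneous u ps" for u ps
    using monom that
  proof (induction w arbitrary: u ps rule: list.induct)
    case Nil
    then show ?case by (simp add: word)
  next
    case (Cons z w)
    have u: "u \<in> lists V"
      using Cons.prems(2) by (auto simp: homogeneous_list_def list_all2_conv_all_nth in_set_conv_nth)
    have z: "z \<in> V" and w: "w \<in> lists V"
      using Cons.prems(1) by auto
    have hom: "Q (monom (u @ [ppart c z] @ w))" for c
      using Cons.IH[OF w, of "u @ [ppart c z]" "ps @ [c]"] Cons.prems(2) ppart_in ppart_W[OF z]
      by (auto simp: homogeneous_list_def intro: list_all2_appendI)
    have sup: "monom (u @ [ppart c z] @ w) \<in> polys V" for c
      using u w ppart_W[OF z] by (intro single_polys) auto
    have "(monom [ppart 0 z] + monom [ppart 1 z]) \<doteq> monom [z]"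
      using S.eqv_sym[OF letter_add[of "ppart 0 z" "ppart 1 z"]] ppart_W[OF z] by (simp add: ppart_sum)
    then have "monom u * ((monom [ppart 0 z] + monom [ppart 1 z]) * monom w) \<doteq> monom u * (monom [z] * monom w)"
      by (intro S.eqv_mult_left S.eqv_mult_right single_polys u w)
    then have "monom (u @ [ppart 0 z] @ w) + monom (u @ [ppart 1 z] @ w) \<doteq> monom (u @ z # w)"
      by (simp add: distrib_left distrib_right)
    then show ?case
      by (rule eqv[rotated 2])
        (use sup hom u z w in \<open>auto intro!: add polys_add single_polys ppart_W\<close>)
  qed
  from this[of "[]" "[]"] show ?case
    by (simp add: homogeneous_list_def)
qed (auto intro: scale add)

section \<open>Relations in the enveloping algebra and the map from S(V)\<close>

lemma U_rel:
  assumes "p \<in> linear_rels sc UNIV \<union>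
     {monom [x, y] - Poly_Mapping.single [y, x] (ksign p q) - monom [br x y]
        | x y p q. x \<in> UNIV \<inter> P p \<and> y \<in> UNIV \<inter> P q}"
  shows "p \<in> JU"
  unfolding env_ideal_def using U.R.genideal_self assms subset_polys_UNIV
  by (metis (no_types, lifting) free_algebra_simps(1) subsetD)

lemma U_letter_add: "U.eqv (monom [x + y]) (monom [x] + monom [y])"
  unfolding U.eqv_def diff_diff_eq[symmetric] by (rule U_rel) (auto simp: linear_rels_def)

lemma U_letter_scale: "U.eqv (monom [sc c x]) (const c * monom [x])"
  unfolding U.eqv_def by (rule U_rel) (auto simp: linear_rels_def)

lemma U_letter_br:
  assumes "x \<in> P p" "y \<in> P q"
  shows "U.eqv (monom [x] * monom [y]) (const (ksign p q) * (monom [y] * monom [x]) + monom [br x y])"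
  unfolding U.eqv_def diff_diff_eq[symmetric] by (rule U_rel) (use assms in auto)

text \<open>Brackets inside \<open>V\<close> are zero, so the enveloping relations between elements
  of \<open>V\<close> amount to supercommutation.\<close>

lemma JS_JU: "p \<in> JS \<Longrightarrow> p \<in> JU"
proof (induction rule: JS_induct)
  case (plus x y)
  then show ?case using U_letter_add[of x y] by (simp add: U.eqv_def diff_diff_eq)
next
  case (scale c x)
  then show ?case using U_letter_scale[of c x] by (simp add: U.eqv_def)
next
  case (comm x y p q)
  \<comment> \<open>The enveloping relation carries the letter [x,y] = 0, a nonzero polynomial that
    must be removed separately.\<close>
  have "monom [0] \<in> JU"
    using U_letter_scale[of 0 0] by (simp add: U.eqv_def)
  then show ?case
    using U.J_add[of _ "monom [0]"] U_letter_br[OF comm(2,4)] br_V[OF comm(1,3)]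
    by (fastforce simp: U.eqv_def algebra_simps)
qed (auto intro: U.J_zero U.J_add U.J_mult_left U.J_mult_right polys_UNIV)

lemma eqv_U: "p \<doteq> q \<Longrightarrow> U.eqv p q"
  using JS_JU by (simp add: S.eqv_def U.eqv_def)

lemma sym_algebra_eq: "sym_algebra sc P V = S.A"
  by (simp add: sym_algebra_def)

lemma env_algebra_eq: "env_algebra sc P br UNIV = U.A"
  by (simp add: env_algebra_def)

text \<open>Reading a polynomial in \<open>V\<close> inside the enveloping algebra is well defined
  on classes by \<open>eqv_U\<close> and has the prescribed values by
  \<open>symmetrised_word\<close>, so it satisfies the definite description.\<close>

lemma symmetrisation_cls:
  assumes "p \<in> polys V"
  shows "symmetrisation sc P br V (S.cls p) = U.cls p"
proof -
  let ?Q = "\<lambda>f. f \<in> linear_maps S.A U.A \<and> (\<forall>xs ps. homogeneous xs ps \<longrightarrow>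
      f (S.cls (monom xs)) = U.cls (symmetrised xs ps))"
  define f where "f = (\<lambda>Y\<in>carrier S.A. U.cls (SOME p. p \<in> polys V \<and> Y = S.cls p))"
  have f: "f (S.cls p) = U.cls p" if "p \<in> polys V" for p
  proof -
    have "\<exists>q. q \<in> polys V \<and> S.cls p = S.cls q"
      using that by blast
    from someI_ex[OF this] have "S.cls p = S.cls (SOME q. q \<in> polys V \<and> S.cls p = S.cls q)"
      by blast
    then have "U.cls (SOME q. q \<in> polys V \<and> S.cls p = S.cls q) = U.cls p"
      unfolding S.cls_eq_iff U.cls_eq_iff by (rule U.eqv_sym[OF eqv_U])
    then show ?thesis
      using that by (simp add: f_def)
  qed
  have sym: "U.cls (symmetrised xs ps) = U.cls (monom xs)" if "homogeneous xs ps" for xs ps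
    unfolding U.cls_eq_iff by (rule eqv_U[OF symmetrised_word[OF that]])
  have "f \<in> linear_maps S.A U.A"
    unfolding linear_maps_def
  proof (intro CollectI conjI ballI allI)
    show "f \<in> carrier S.A \<rightarrow>\<^sub>E carrier U.A"
    proof (rule PiE_I)
      show "f Y \<in> carrier U.A" if "Y \<in> carrier S.A" for Y
        using that by (elim S.carrier_AE) (simp add: f polys_UNIV)
      show "f Y = undefined" if "Y \<notin> carrier S.A" for Y
        using that by (simp add: f_def)
    qed
    show "f (Y \<oplus>\<^bsub>S.A\<^esub> Z) = f Y \<oplus>\<^bsub>U.A\<^esub> f Z" if "Y \<in> carrier S.A" "Z \<in> carrier S.A" for Y Z
      using that
      by (elim S.carrier_AE) (simp add: f S.add_A U.add_A polys_UNIV polys_add)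
    show "f (c \<odot>\<^bsub>S.A\<^esub> Y) = c \<odot>\<^bsub>U.A\<^esub> f Y" if "Y \<in> carrier S.A" for c Y
      using that
      by (elim S.carrier_AE)
        (simp add: f S.scale_A U.scale_A polys_UNIV polys_mult const_polys)
  qed
  then have Q: "?Q f"
    using f[OF word_polys] sym by metis
  \<comment> \<open>Homogeneous words span modulo the ideal, so linearity fixes the values on the
    carrier; off the carrier both maps are undefined.\<close>
  have "g = f" if g: "?Q g" for g
  proof
    fix Y
    show "g Y = f Y"
    proof (cases "Y \<in> carrier S.A")
      case True
      then obtain p where p: "p \<in> polys V" "Y = S.cls p"
        by (rule S.carrier_AE)
      have g_add: "g (S.cls (p + q)) = g (S.cls p) \<oplus>\<^bsub>U.A\<^esub> g (S.cls q)"
        and g_scale: "g (S.cls (const c * p)) = c \<odot>\<^bsub>U.A\<^esub> g (S.cls p)"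
        if "p \<in> polys V" "q \<in> polys V" for p q c
      proof -
        have "\<forall>A\<in>carrier S.A. \<forall>B\<in>carrier S.A. g (A \<oplus>\<^bsub>S.A\<^esub> B) = g A \<oplus>\<^bsub>U.A\<^esub> g B"
          "\<forall>c. \<forall>A\<in>carrier S.A. g (c \<odot>\<^bsub>S.A\<^esub> A) = c \<odot>\<^bsub>U.A\<^esub> g A"
          using g unfolding linear_maps_def by blast+
        then show "g (S.cls (p + q)) = g (S.cls p) \<oplus>\<^bsub>U.A\<^esub> g (S.cls q)"
          "g (S.cls (const c * p)) = c \<odot>\<^bsub>U.A\<^esub> g (S.cls p)"
          unfolding S.add_A[OF that, symmetric] S.scale_A[OF that(1), symmetric]
          using that S.cls_in_A by blast+
      qed
      from p(1) have "g (S.cls p) = U.cls p"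
      proof (induction rule: homogeneous_word_induct)
        case (word xs ps)
        have "g (S.cls (monom xs)) = U.cls (symmetrised xs ps)"
          using g word by blast
        then show ?case using sym[OF word] by simp
      next
        case (eqv q q')
        have "S.cls q = S.cls q'" "U.cls q = U.cls q'"
          unfolding S.cls_eq_iff U.cls_eq_iff by (rule eqv(3), rule eqv_U[OF eqv(3)])
        then show ?case using eqv(4) by simp
      next
        case (scale c q)
        then show ?case by (simp only: g_scale[OF scale(1) scale(1)] U.scale_A[OF polys_UNIV] scale(2))
      next
        case (add q q')
        then show ?case by (simp only: g_add[OF add(1,2)] U.add_A[OF polys_UNIV polys_UNIV] add(3,4))
      qed
      then show ?thesis
        using p(2) f[OF p(1)] by simp
    next
      case False
      then show ?thesis
        using PiE_arb[of g "carrier S.A" "\<lambda>_. carrier U.A" Y] PiE_arb[of f "carrier S.A" "\<lambda>_. carrier U.A" Y]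
          g Q unfolding linear_maps_def by fastforce
    qed
  qed
  with Q have "(THE f. ?Q f) = f"
    by (rule the_equality[where P = ?Q])
  then show ?thesis
    unfolding symmetrisation_def sym_algebra_eq env_algebra_eq sym_class_def env_class_def
    using f[OF assms] by simp
qed

end

section \<open>The induced module\<close>

text \<open>Regarding the scalar as a constant polynomial makes the rules for \<open>lin\<close>
  available; injectivity of \<open>single\<close> then leads back to scalars.\<close>

lemma eval_char_lin: "const (eval_char f p) = lin (\<lambda>w. const (prod_list (map f w))) p"
  by (simp add: eval_char_def lin_def const_sum)

lemma eval_char_add:
  fixes p q :: "'g list \<Rightarrow>\<^sub>0 'k::field"
  shows "eval_char f (p + q) = eval_char f p + eval_char f q"
proof -
  have "(const (eval_char f (p + q)) :: 'g list \<Rightarrow>\<^sub>0 'k) = const (eval_char f p + eval_char f q)"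
    by (simp only: eval_char_lin lin_add const_add)
  then show ?thesis by (rule injD[OF inj_single])
qed

lemma eval_char_single: "eval_char f (Poly_Mapping.single (w :: 'g list) c) = (c * prod_list (map f w) :: 'k::field)"
proof -
  have "(const (eval_char f (Poly_Mapping.single w c)) :: 'g list \<Rightarrow>\<^sub>0 'k) = const (c * prod_list (map f w))"
    by (simp add: eval_char_lin)
  then show ?thesis by (rule injD[OF inj_single])
qed

lemma eval_char_scale:
  fixes p :: "'g list \<Rightarrow>\<^sub>0 'k::field"
  shows "eval_char f (const c * p) = c * eval_char f p"
proof -
  have "(const (eval_char f (const c * p)) :: 'g list \<Rightarrow>\<^sub>0 'k) = const c * const (eval_char f p)"
    by (simp only: eval_char_lin lin_scale)
  then have "(const (eval_char f (const c * p)) :: 'g list \<Rightarrow>\<^sub>0 'k) = const (c * eval_char f p)"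
    by simp
  then show ?thesis by (rule injD[OF inj_single])
qed

lemma eval_char_1 [simp]: "eval_char f (1 :: 'g list \<Rightarrow>\<^sub>0 'k::field) = 1"
  using eval_char_single[of f "[]" 1] by simp

lemma eval_char_diff: "eval_char f (p - q) = eval_char f p - (eval_char f q :: 'k::field)"
  using eval_char_add[of f "p - q" q] by simp

lemma eval_char_mult: "eval_char f (p * q) = (eval_char f p * eval_char f q :: 'k::field)"
proof (induction p rule: poly_mapping_list_induct)
  case (monom u)
  show ?case
  proof (induction q rule: poly_mapping_list_induct)
    case (scale c q)
    then show ?case
      by (simp only: const_left_commute[of "monom u" c q] eval_char_scale mult.left_commute)
  qed (simp_all add: eval_char_single eval_char_add distrib_left)
next
  case (scale c p)
  then show ?case
    by (simp only: mult.assoc eval_char_scale)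
qed (simp add: eval_char_add distrib_right)

text \<open>The additive extension of \<open>f\<close> to the free abelian group, with values in a
  ring, here that of polynomials.\<close>

definition frag_sum :: "('b \<Rightarrow> 'a::ring_1) \<Rightarrow> ('b \<Rightarrow>\<^sub>0 int) \<Rightarrow> 'a"
  where "frag_sum f z = (\<Sum>i\<in>Poly_Mapping.keys z. of_int (Poly_Mapping.lookup z i) * f i)"

lemma frag_sum_superset:
  assumes "finite A" "Poly_Mapping.keys z \<subseteq> A"
  shows "frag_sum f z = (\<Sum>i\<in>A. of_int (Poly_Mapping.lookup z i) * f i)"
  unfolding frag_sum_def by (rule sum.mono_neutral_left) (use assms in \<open>auto simp: in_keys_iff\<close>)

lemma frag_sum_add: "frag_sum f (y + z) = frag_sum f y + frag_sum f z"
proof -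
  let ?A = "Poly_Mapping.keys y \<union> Poly_Mapping.keys z"
  have "Poly_Mapping.keys (y + z) \<subseteq> ?A"
    by (rule Poly_Mapping.keys_add)
  then show ?thesis
    by (simp add: frag_sum_superset[of ?A] lookup_add sum.distrib distrib_right)
qed

lemma frag_sum_0 [simp]: "frag_sum f 0 = 0"
  by (simp add: frag_sum_def)

lemma frag_sum_diff: "frag_sum f (y - z) = frag_sum f y - frag_sum f z"
  using frag_sum_add[of f "y - z" z] by simp

lemma frag_sum_of [simp]: "frag_sum f (frag_of i) = f i"
  by (simp add: frag_sum_def)

section \<open>The subalgebra k, its character and its action on the unit\<close>

context graded_induction_data
begin

abbreviation K where "K \<equiv> kpart W"

abbreviation character_K where "character_K \<equiv> extend_char W lam"

abbreviation eval_K where "eval_K \<equiv> eval_char character_K"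

lemma K_iff: "x \<in> K \<longleftrightarrow> gpart (-1) x = 0"
proof
  assume "x \<in> K"
  then obtain a b where "x = a + b" "a \<in> W 0" "b \<in> W 1"
    by (auto simp: kpart_def)
  then show "gpart (-1) x = 0"
    by (simp add: gpart_add gpart_W)
next
  assume "gpart (-1) x = 0"
  then have "x = gpart 0 x + gpart 1 x"
    using gpart_sum[of x] by simp
  then show "x \<in> K"
    using gpart_intros(2,3)[of x] by (auto simp: kpart_def)
qed

text \<open>The degree 0 component is the only candidate in the definite description, because
  \<open>gpart 0\<close> recovers it from any splitting.\<close>

lemma character_K: "x \<in> K \<Longrightarrow> character_K x = lam (gpart 0 x)"
proof -
  assume x: "x \<in> K"
  then have eq: "gpart 0 x + gpart 1 x = x"
    using gpart_sum[of x] by (simp add: K_iff)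
  have "(THE a. a \<in> W 0 \<and> x - a \<in> W 1) = gpart 0 x"
  proof (rule the_equality)
    show "gpart 0 x \<in> W 0 \<and> x - gpart 0 x \<in> W 1"
      using gpart_intros(2,3)[of x] eq by (metis add_diff_cancel_left')
  next
    fix a assume a: "a \<in> W 0 \<and> x - a \<in> W 1"
    have "gpart 0 (a + (x - a)) = a + 0"
      using a gpart_W[of a 0 0] gpart_W[of "x - a" 1 0] by (subst gpart_add) auto
    then show "a = gpart 0 x"
      by simp
  qed
  then show ?thesis
    by (simp add: extend_char_def)
qed

lemma K_closed: "x \<in> K \<Longrightarrow> y \<in> K \<Longrightarrow> x + y \<in> K" "x \<in> K \<Longrightarrow> sc c x \<in> K"
  by (simp_all add: K_iff gpart_add gpart_scale)

lemma K_subspace: "subspace K"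
  using K_closed gpart_W[of 0 0 "-1"] by (auto simp: subspace_def K_iff)

lemma br_decompose_K:
  assumes "x \<in> K" "y \<in> K"
  shows "br x y = br (gpart 0 x) (gpart 0 y) + (br (gpart 0 x) (gpart 1 y) + br (gpart 1 x) (gpart 0 y))"
proof -
  have "x = gpart 0 x + gpart 1 x" "y = gpart 0 y + gpart 1 y"
    using assms gpart_sum[of x] gpart_sum[of y] by (simp_all add: K_iff)
  then have "br x y = br (gpart 0 x + gpart 1 x) (gpart 0 y + gpart 1 y)"
    by simp
  then show ?thesis
    using br_W11[OF gpart_intros(3) gpart_intros(3), of x y] by (simp add: br_simps)
qed

text \<open>The degree 0 part of the bracket is the bracket of the degree 0 parts, on which the
  character vanishes.\<close>

lemma br_K:
  assumes "x \<in> K" "y \<in> K"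
  shows "br x y \<in> K" "character_K (br x y) = 0"
proof -
  note g = gpart_intros[of x] gpart_intros[of y]
  have 0: "br (gpart 0 x) (gpart 0 y) \<in> W 0"
    and 1: "br (gpart 0 x) (gpart 1 y) + br (gpart 1 x) (gpart 0 y) \<in> W 1"
    by (rule br_V_closed(5)[OF g(2,5)])
      (intro W_add br_V_closed(6)[OF g(2,6)] br_V_closed(7)[OF g(3,5)])
  then show K: "br x y \<in> K"
    unfolding br_decompose_K[OF assms] kpart_def by blast
  show "character_K (br x y) = 0"
    unfolding character_K[OF K] unfolding br_decompose_K[OF assms]
    using 0 1 g by (simp add: gpart_add gpart_W lam_br)
qed

lemma env_rels_K_polys: "linear_rels sc K \<union>
     {monom [x, y] - Poly_Mapping.single [y, x] (ksign p q) - monom [br x y]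
        | x y p q. x \<in> K \<inter> P p \<and> y \<in> K \<inter> P q} \<subseteq> polys K"
  using linear_rels_polys[OF K_subspace module_axioms] br_K(1) by (auto intro!: polys_intros)

sublocale E: free_quotient K "env_ideal sc P br K"
  unfolding env_ideal_def by (rule genideal_free_algebra[OF env_rels_K_polys])

text \<open>Inclusion into the large enveloping algebra and evaluation at the extended character
  both respect the relations of the subalgebra. In the bracket relation the two products agree with
  the sign because values at odd elements are zero, and brackets evaluate to zero.\<close>

lemma env_ideal_K:
  assumes "p \<in> env_ideal sc P br K"
  shows "p \<in> JU \<and> eval_K p = 0"
  using assms unfolding env_ideal_def[of sc P br K]
proof (induction rule: genideal_free_algebra_induct[OF _ env_rels_K_polys,
      consumes 1, case_names rel zero add left right])
  case (rel p)
  have "p \<in> JU"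
    by (rule U_rel) (use rel in \<open>auto simp: linear_rels_def\<close>)
  moreover have "eval_K p = 0"
  proof -
    have "character_K (x + y) = character_K x + character_K y" "character_K (sc c x) = c * character_K x"
      if "x \<in> K" "y \<in> K" for x y c
      using that gpart_intros
      by (simp_all add: character_K K_closed gpart_add gpart_scale lam_add lam_scale)
    moreover have "character_K x * character_K y = ksign p q * (character_K y * character_K x)"
      if "x \<in> K" "x \<in> P p" "y \<in> K" "y \<in> P q" for x y p q
      using that lam_odd[OF gpart_intros(2) gpart_P[of x]]
      by (cases p) (auto simp: character_K ksign_def)
    ultimately show ?thesis
      using rel br_K(2)
      by (auto simp: linear_rels_def eval_char_diff eval_char_single)
  qed
  ultimately show ?case by simp
next
  case zero
  then show ?case using eval_char_diff[of character_K 0 0] by (simp add: U.J_zero)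
qed (auto simp: eval_char_add eval_char_mult intro: U.J_add U.J_mult_left U.J_mult_right polys_UNIV)

lemma env_algebra_K_eq: "env_algebra sc P br K = E.A"
  by (simp add: env_algebra_def)

text \<open>Evaluation vanishes on the ideal, so it is constant on a class and
  \<open>the_elem\<close> meets a singleton.\<close>

lemma char_action_cls:
  assumes "b \<in> polys K"
  shows "char_action character_K (E.cls b) v = eval_K b * v"
proof -
  have "eval_K ` E.cls b = {eval_K b}"
    using env_ideal_K E.J_zero by (auto simp: E.cls_eq eval_char_add image_image)
  then show ?thesis
    by (simp add: char_action_def)
qed

lemma env_incl_cls: "env_incl sc P br (E.cls b) = U.cls b"
proof
  show "env_incl sc P br (E.cls b) \<subseteq> U.cls b"
  proof
    fix z assume "z \<in> env_incl sc P br (E.cls b)"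
    then obtain j k where "z = j + (k + b)" "j \<in> JU" "k \<in> env_ideal sc P br K"
      by (auto simp: env_incl_def set_add_def' E.cls_eq)
    then show "z \<in> U.cls b"
      using env_ideal_K[of k] U.J_add[of j k] by (simp add: U.mem_cls U.eqv_def algebra_simps)
  qed
  show "U.cls b \<subseteq> env_incl sc P br (E.cls b)"
  proof
    fix z assume "z \<in> U.cls b"
    then obtain j where "z = j + (0 + b)" "j \<in> JU"
      by (auto simp: U.cls_eq)
    then show "z \<in> env_incl sc P br (E.cls b)"
      using E.J_zero unfolding env_incl_def set_add_def' E.cls_eq free_algebra_simps by blast
  qed
qed

text \<open>In this model the unit plays the role of the canonical generator of the induced module;
  its transformation under the subalgebra by the character is what the balancing relation
  demands.\<close>

lemma ev_K:
  assumes "b \<in> polys K"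
  shows "ev b 1 \<doteq> const (eval_K b)"
  using assms
proof (induction rule: polys_induct)
  case (monom w)
  then show ?case
  proof (induction w)
    case Nil
    then show ?case by (simp add: ev_linear eval_char_single)
  next
    case (Cons x w)
    let ?c = "prod_list (map character_K w)"
    have x: "x \<in> K" and IH: "foldr act w 1 \<doteq> const ?c"
      using Cons by (auto simp: ev_linear eval_char_single)
    have one: "act x 1 \<doteq> const (character_K x)"
    proof -
      have eq: "x = gpart 0 x + gpart 1 x"
        using gpart_sum[of x] x by (simp add: K_iff)
      have "act (gpart 0 x + gpart 1 x) 1 \<doteq> act (gpart 0 x) 1 + act (gpart 1 x) 1"
        by (rule act_add[OF one_polys])
      also have "\<dots> \<doteq> const (lam (gpart 0 (gpart 0 x))) + const (lam (gpart 0 (gpart 1 x)))"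
        using gpart_intros by (intro S.eqv_add act_unit) auto
      also have "\<dots> = const (character_K x)"
        using gpart_intros[of x] by (simp add: character_K[OF x] gpart_W lam_0)
      finally show ?thesis
        by (simp only: eq[symmetric])
    qed
    have "act x (foldr act w 1) \<doteq> act x (const ?c * 1)"
      using act_eqv[OF IH] by simp
    also have "\<dots> = const ?c * act x 1"
      by (rule act_linear)
    also have "\<dots> \<doteq> const ?c * const (character_K x)"
      by (rule S.eqv_scale[OF one])
    finally show ?case
      by (simp add: ev_linear eval_char_single mult.commute)
  qed
next
  case (scale c q)
  then show ?case
    using S.eqv_scale[OF scale(2), of c] by (simp add: ev_linear eval_char_scale)
next
  case (add q q')
  then show ?case
    using S.eqv_add[OF add(3,4)] by (simp add: ev_linear eval_char_add const_add)
qed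

section \<open>The tensor product and the left action on it\<close>

abbreviation TR where "TR \<equiv> tensor_rels sc P br K character_K"

abbreviation TF where "TF \<equiv> tensor_free sc P br"

abbreviation N where "N \<equiv> tensor_sub sc P br K character_K"

abbreviation tens where "tens p v \<equiv> frag_of (U.cls p, v)"

lemma TF_comm_group: "comm_group TF"
  by (simp add: tensor_free_def abelian_free_Abelian_group)

lemma TF_simps [simp]:
  "\<one>\<^bsub>TF\<^esub> = 0" "x \<otimes>\<^bsub>TF\<^esub> y = x + y"
  by (simp_all add: tensor_free_def)

lemma carrier_TF: "z \<in> carrier TF \<longleftrightarrow> Poly_Mapping.keys z \<subseteq> carrier U.A \<times> UNIV"
  by (simp add: tensor_free_def env_algebra_eq)

lemma tens_carrier: "tens p v \<in> carrier TF"
  by (simp add: carrier_TF keys_frag_of polys_UNIV)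

lemma TF_closed: "y \<in> carrier TF \<Longrightarrow> z \<in> carrier TF \<Longrightarrow> y + z \<in> carrier TF"
  "y \<in> carrier TF \<Longrightarrow> z \<in> carrier TF \<Longrightarrow> y - z \<in> carrier TF"
  using Poly_Mapping.keys_add[of y z] keys_diff[of y z] by (auto simp: carrier_TF)

lemma TF_inv: "z \<in> carrier TF \<Longrightarrow> inv\<^bsub>TF\<^esub> z = - z"
  by (simp add: carrier_TF tensor_free_def env_algebra_eq)

text \<open>Every class has a polynomial representative, so the relations can be quantified over
  polynomials, with evaluation in place of the action on scalars.\<close>

lemma tensor_rels_eq: "TR =
    {tens (p + p') v - tens p v - tens p' v | p p' v. True} \<union>
    {tens p (v + v') - tens p v - tens p v' | p v v'. True} \<union>
    {tens (p * b) v - tens p (eval_K b * v) | p b v. b \<in> polys K}" (is "?L = ?R")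
proof
  show "?L \<subseteq> ?R"
  proof
    fix z assume "z \<in> ?L"
    then consider
      (1) u u' v where "z = frag_of (u \<oplus>\<^bsub>U.A\<^esub> u', v) - frag_of (u, v) - frag_of (u', v)"
        "u \<in> carrier U.A" "u' \<in> carrier U.A"
      | (2) u v v' where "z = frag_of (u, v + v') - frag_of (u, v) - frag_of (u, v')" "u \<in> carrier U.A"
      | (3) u a v where "z = frag_of (u \<otimes>\<^bsub>U.A\<^esub> env_incl sc P br a, v) - frag_of (u, char_action character_K a v)"
        "u \<in> carrier U.A" "a \<in> carrier E.A"
      unfolding tensor_rels_def Let_def env_algebra_eq env_algebra_K_eq by blast
    then show "z \<in> ?R"
    proof cases
      case 1
      then obtain p p' where "u = U.cls p" "u' = U.cls p'"
        by (auto simp: U.carrier_A)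
      then have "z = tens (p + p') v - tens p v - tens p' v"
        using 1 by (simp add: U.add_A polys_UNIV)
      then show ?thesis by blast
    next
      case 2
      then obtain p where "u = U.cls p"
        by (auto simp: U.carrier_A)
      then show ?thesis
        using 2 by blast
    next
      case 3
      then obtain p b where "u = U.cls p" "a = E.cls b" "b \<in> polys K"
        by (auto simp: U.carrier_A E.carrier_A)
      then have "z = tens (p * b) v - tens p (eval_K b * v)" "b \<in> polys K"
        using 3 by (simp_all add: U.mult_A polys_UNIV env_incl_cls char_action_cls)
      then show ?thesis by blast
    qed
  qed
  have c: "U.cls p \<in> carrier U.A" for p
    by (simp add: polys_UNIV)
  show "?R \<subseteq> ?L"
  proof
    fix z assume "z \<in> ?R"
    then consider
      (1) p p' v where "z = tens (p + p') v - tens p v - tens p' v"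
      | (2) p v v' where "z = tens p (v + v') - tens p v - tens p v'"
      | (3) p b v where "z = tens (p * b) v - tens p (eval_K b * v)" "b \<in> polys K"
      by blast
    then show "z \<in> ?L"
      unfolding tensor_rels_def Let_def env_algebra_eq env_algebra_K_eq
    proof cases
      case 1
      then have "z = frag_of (U.cls p \<oplus>\<^bsub>U.A\<^esub> U.cls p', v) - frag_of (U.cls p, v) - frag_of (U.cls p', v)"
        by (simp add: U.add_A polys_UNIV)
      then show "z \<in> {frag_of (u \<oplus>\<^bsub>U.A\<^esub> u', v) - frag_of (u, v) - frag_of (u', v) |u u' v.
              u \<in> carrier U.A \<and> u' \<in> carrier U.A} \<union> B \<union> C" for B C
        using c by blast
    next
      case 2
      then show "z \<in> A \<union> {frag_of (u, v + v') - frag_of (u, v) - frag_of (u, v') |u v v'.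
              u \<in> carrier U.A} \<union> C" for A C
        using c by blast
    next
      case 3
      have "z = frag_of (U.cls p \<otimes>\<^bsub>U.A\<^esub> env_incl sc P br (E.cls b), v)
          - frag_of (U.cls p, char_action character_K (E.cls b) v)"
        using 3 by (simp add: U.mult_A polys_UNIV env_incl_cls char_action_cls)
      then show "z \<in> A \<union> B \<union> {frag_of (u \<otimes>\<^bsub>U.A\<^esub> env_incl sc P br a, v)
          - frag_of (u, char_action character_K a v) |u a v. u \<in> carrier U.A \<and> a \<in> carrier E.A}" for A B
        using c E.cls_in_A[OF 3(2)] by blast
    qed
  qed
qed

lemma tensor_rels_cases:
  assumes "z \<in> TR"
  obtains
    (1) p p' v where "z = tens (p + p') v - tens p v - tens p' v"
  | (2) p v v' where "z = tens p (v + v') - tens p v - tens p v'"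
  | (3) p b v where "z = tens (p * b) v - tens p (eval_K b * v)" "b \<in> polys K"
  using assms unfolding tensor_rels_eq by blast

lemma tensor_rels_carrier: "TR \<subseteq> carrier TF"
  unfolding tensor_rels_eq by (auto intro!: TF_closed tens_carrier)

lemma N_subgroup: "subgroup N TF"
proof -
  interpret comm_group TF by (rule TF_comm_group)
  show ?thesis
    unfolding tensor_sub_def by (rule generate_is_subgroup[OF tensor_rels_carrier])
qed

lemma N_carrier: "z \<in> N \<Longrightarrow> z \<in> carrier TF"
  using subgroup.subset[OF N_subgroup] by blast

lemma N_zero: "0 \<in> N"
  using subgroup.one_closed[OF N_subgroup] by simp

lemma N_add: "y \<in> N \<Longrightarrow> z \<in> N \<Longrightarrow> y + z \<in> N"
  using subgroup.m_closed[OF N_subgroup] by simp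

lemma N_uminus: "z \<in> N \<Longrightarrow> - z \<in> N"
  using subgroup.m_inv_closed[OF N_subgroup, of z] by (simp add: TF_inv N_carrier)

lemma N_diff: "y \<in> N \<Longrightarrow> z \<in> N \<Longrightarrow> y - z \<in> N"
  using N_add[of y "- z"] N_uminus[of z] by simp

lemma N_rel: "z \<in> TR \<Longrightarrow> z \<in> N"
  unfolding tensor_sub_def by (rule generate.incl)

lemma N_induct [consumes 1, case_names rel zero add uminus]:
  assumes "z \<in> N"
    and "\<And>z. z \<in> TR \<Longrightarrow> Q z"
    and "Q 0"
    and "\<And>y z. y \<in> N \<Longrightarrow> z \<in> N \<Longrightarrow> Q y \<Longrightarrow> Q z \<Longrightarrow> Q (y + z)"
    and "\<And>z. z \<in> N \<Longrightarrow> Q z \<Longrightarrow> Q (- z)"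
  shows "Q z"
  using assms(1) unfolding tensor_sub_def
proof (induction rule: generate.induct)
  case (inv h)
  then show ?case
    using assms(2,5) N_rel tensor_rels_carrier by (auto simp: TF_inv)
qed (use assms in \<open>auto simp: tensor_sub_def\<close>)

text \<open>Induces the inverse of the isomorphism; the choice of a representative is irrelevant modulo \<open>JS\<close>
  by \<open>ev_JU\<close>.\<close>

definition retraction :: "((('g list \<Rightarrow>\<^sub>0 'k) set \<times> 'k) \<Rightarrow>\<^sub>0 int) \<Rightarrow> 'g list \<Rightarrow>\<^sub>0 'k" where
  "retraction = frag_sum (\<lambda>(u, v). const v * ev (SOME p. U.cls p = u) 1)"

lemma ev_eqv: "U.eqv p q \<Longrightarrow> f \<in> polys V \<Longrightarrow> ev p f \<doteq> ev q f"
  using ev_JU[of "p - q" f] by (simp add: U.eqv_def S.eqv_def ev_linear)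

lemma ev_eqv_right: "f \<doteq> g \<Longrightarrow> ev p f \<doteq> ev p g"
  using ev_JS[of "f - g" p] ev_add_right[of p "f - g" g] by (simp add: S.eqv_def algebra_simps)

lemma retraction_tens: "retraction (tens p v) \<doteq> const v * ev p 1"
proof -
  have "U.cls (SOME q. U.cls q = U.cls p) = U.cls p"
    by (rule someI[of "\<lambda>q. U.cls q = U.cls p"]) (rule refl)
  then have "ev (SOME q. U.cls q = U.cls p) 1 \<doteq> ev p 1"
    unfolding U.cls_eq_iff by (rule ev_eqv) (rule one_polys)
  then show ?thesis
    unfolding retraction_def by (simp add: S.eqv_scale)
qed

text \<open>The biadditivity relations vanish by linearity; the balancing relation does so because
  the subalgebra acts on the unit by its character (\<open>ev_K\<close>).\<close>

lemma retraction_N: "z \<in> N \<Longrightarrow> retraction z \<in> JS"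
proof (induction rule: N_induct)
  case (rel z)
  have d: "retraction (y - z) = retraction y - retraction z" for y z
    by (simp add: retraction_def frag_sum_diff)
  from rel show ?case
  proof (cases rule: tensor_rels_cases)
    case (1 p p' v)
    have "retraction z \<doteq> const v * ev (p + p') 1 - const v * ev p 1 - const v * ev p' 1"
      unfolding 1 d by (intro S.eqv_diff retraction_tens)
    then show ?thesis
      by (simp add: ev_linear distrib_left S.eqv_0)
  next
    case (2 p v v')
    have "retraction z \<doteq> const (v + v') * ev p 1 - const v * ev p 1 - const v' * ev p 1"
      unfolding 2 d by (intro S.eqv_diff retraction_tens)
    then show ?thesis
      by (simp add: const_add distrib_right S.eqv_0)
  next
    case (3 p b v)
    let ?c = "eval_K b"
    have "retraction z \<doteq> const v * ev (p * b) 1 - const (?c * v) * ev p 1"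
      unfolding 3(1) d by (intro S.eqv_diff retraction_tens)
    also have "\<dots> = const v * ev p (ev b 1) - const (?c * v) * ev p 1"
      by (simp only: ev_mult)
    also have "\<dots> \<doteq> const v * ev p (const ?c * 1) - const (?c * v) * ev p 1"
      using ev_K[OF 3(2)] by (intro S.eqv_diff S.eqv_scale ev_eqv_right) auto
    also have "\<dots> = 0"
      unfolding ev_scale_right by (simp add: const_const_mult mult.commute)
    finally show ?thesis
      by (simp add: S.eqv_0)
  qed
next
  case (uminus z)
  have "retraction (- z) = - retraction z"
    using frag_sum_diff[of _ 0 z] by (simp add: retraction_def)
  then show ?case
    using uminus(2) by (simp add: S.J_uminus)
qed (auto simp: retraction_def frag_sum_add S.J_zero S.J_add)

definition tens_act where
  "tens_act p = frag_extend (\<lambda>(u, v). frag_of (U.cls p \<otimes>\<^bsub>U.A\<^esub> u, v))"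

lemma tens_act_tens: "tens_act p (tens q v) = tens (p * q) v"
  by (simp add: tens_act_def U.mult_A polys_UNIV)

text \<open>Left multiplication commutes with right multiplication by the subalgebra, so each
  relation goes to one of the same kind.\<close>

lemma tens_act_N: "z \<in> N \<Longrightarrow> tens_act p z \<in> N"
proof (induction rule: N_induct)
  case (rel z)
  have d: "tens_act p (y - z) = tens_act p y - tens_act p z" for y z
    by (simp add: tens_act_def frag_extend_diff)
  from rel have "tens_act p z \<in> TR"
  proof (cases rule: tensor_rels_cases)
    case (1 q q' v)
    then show ?thesis
      unfolding 1 d tens_act_tens distrib_left tensor_rels_eq by blast
  next
    case (2 q v v')
    then show ?thesis
      unfolding 2 d tens_act_tens distrib_left tensor_rels_eq by blast
  next
    case (3 q b v)
    then show ?thesis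
      unfolding 3(1) d tens_act_tens mult.assoc[symmetric] tensor_rels_eq by blast
  qed
  then show ?case
    by (rule N_rel)
next
  case (add y z)
  then show ?case
    by (simp add: tens_act_def frag_extend_add N_add)
next
  case (uminus z)
  then show ?case
    by (simp add: tens_act_def frag_extend_minus N_uminus)
qed (simp add: tens_act_def N_zero)

abbreviation N_cls where "N_cls z \<equiv> N #>\<^bsub>TF\<^esub> z"

lemma N_cls_eq: "N_cls z = (\<lambda>n. n + z) ` N"
  by (auto simp: r_coset_def)

lemma mem_N_cls: "y \<in> N_cls z \<longleftrightarrow> y - z \<in> N"
  by (auto simp: N_cls_eq image_iff) (metis diff_add_cancel)

lemma N_cls_eq_iff: "N_cls y = N_cls z \<longleftrightarrow> y - z \<in> N"
proof
  assume "N_cls y = N_cls z"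
  then show "y - z \<in> N"
    using mem_N_cls[of y y] N_zero by (simp add: mem_N_cls)
next
  assume *: "y - z \<in> N"
  have "w - y \<in> N \<longleftrightarrow> w - z \<in> N" for w
    using N_add[OF _ *, of "w - y"] N_diff[OF _ *, of "w - z"] by auto
  then show "N_cls y = N_cls z"
    by (auto simp: mem_N_cls)
qed

lemma tensor_action_cls:
  "tensor_action sc P br K character_K (U.cls p) (N_cls z) = N_cls (tens_act p z)"
proof -
  have add: "tens_act p (n + z) = tens_act p n + tens_act p z" for n
    by (simp add: tens_act_def frag_extend_add)
  have "tensor_action sc P br K character_K (U.cls p) (N_cls z) = N <#>\<^bsub>TF\<^esub> (tens_act p ` N_cls z)"
    by (simp add: tensor_action_def tens_act_def env_algebra_eq)
  also have "\<dots> = N_cls (tens_act p z)"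
  proof
    show "N <#>\<^bsub>TF\<^esub> (tens_act p ` N_cls z) \<subseteq> N_cls (tens_act p z)"
      by (auto simp: set_mult_def N_cls_eq add intro!: image_eqI[OF _ N_add[OF _ tens_act_N]])
    show "N_cls (tens_act p z) \<subseteq> N <#>\<^bsub>TF\<^esub> (tens_act p ` N_cls z)"
    proof
      fix y assume "y \<in> N_cls (tens_act p z)"
      then obtain n where n: "n \<in> N" "y = n + tens_act p (0 + z)"
        by (auto simp: N_cls_eq)
      then show "y \<in> N <#>\<^bsub>TF\<^esub> (tens_act p ` N_cls z)"
        using N_zero unfolding set_mult_def N_cls_eq TF_simps by blast
    qed
  qed
  finally show ?thesis .
qed

text \<open>The annihilator of the generator 1 \<otimes> 1, a left ideal.\<close>

definition null where "null p \<longleftrightarrow> tens p 1 \<in> N"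

lemma tens_add: "tens (p + q) v - tens p v - tens q v \<in> N"
  by (rule N_rel) (unfold tensor_rels_eq, blast)

lemma tens_balanced: "b \<in> polys K \<Longrightarrow> tens (p * b) v - tens p (eval_K b * v) \<in> N"
  by (rule N_rel) (unfold tensor_rels_eq, blast)

text \<open>Constants are polynomials over the subalgebra and evaluate to themselves, so balancing
  moves a scalar from the second factor into the first.\<close>

lemma tens_scalar: "tens (const c * p) 1 - tens p c \<in> N"
  using tens_balanced[of "const c" p 1]
  by (simp add: const_polys eval_char_single const_commute)

lemma tens_diff: "tens (p - q) 1 - (tens p 1 - tens q 1) \<in> N"
  using N_uminus[OF tens_add[of "p - q" q 1]] by (simp add: algebra_simps)

lemma null_add: "null p \<Longrightarrow> null q \<Longrightarrow> null (p + q)"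
  unfolding null_def
  using N_add[OF tens_add[of p q 1] N_add[of "tens p 1" "tens q 1"]] by simp

lemma null_diff_iff: "null (p - q) \<longleftrightarrow> tens p 1 - tens q 1 \<in> N"
  unfolding null_def
  using N_diff[OF _ tens_diff[of p q], of "tens (p - q) 1"] N_add[OF tens_diff[of p q], of "tens p 1 - tens q 1"] by auto

lemma null_mult: "null q \<Longrightarrow> null (p * q)"
  unfolding null_def using tens_act_N[of "tens q 1" p] by (simp add: tens_act_tens)

text \<open>For such \<open>p\<close> the polynomials \<open>p\<close> and \<open>p + p\<close> have
  the same class, so with t the tensor of \<open>p\<close> the additivity relation becomes t - t -
  t.\<close>

lemma null_JU: "p \<in> JU \<Longrightarrow> null p"
proof -
  assume "p \<in> JU"
  then have "U.cls p = U.cls (p + p)"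
    using U.J_uminus[of p] by (simp add: U.cls_eq_iff U.eqv_def)
  then have "tens p 1 - tens p 1 - tens p 1 \<in> N"
    using tens_add[of p p 1] by simp
  then show ?thesis
    using N_uminus unfolding null_def by fastforce
qed

lemma null_JS: "p \<in> JS \<Longrightarrow> null p"
  by (rule null_JU[OF JS_JU])

lemma null_K: "x \<in> K \<Longrightarrow> null (monom [x] - const (character_K x))"
proof -
  assume x: "x \<in> K"
  have "tens (1 * monom [x]) 1 - tens 1 (character_K x) \<in> N"
    using tens_balanced[of "monom [x]" 1 1] x by (simp add: single_polys eval_char_single)
  from N_diff[OF this tens_scalar[of "character_K x" 1]] show ?thesis
    by (simp add: null_diff_iff)
qed

text \<open>Congruence modulo the annihilator, hence stable under multiplication from the left. It
  is implied by both \<open>\<doteq>\<close> and \<open>U.eqv\<close>.\<close>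

definition neqv (infix "\<cong>\<^sub>N" 50) where "p \<cong>\<^sub>N q \<longleftrightarrow> null (p - q)"

lemma neqv_trans [trans]: "p \<cong>\<^sub>N q \<Longrightarrow> q \<cong>\<^sub>N t \<Longrightarrow> p \<cong>\<^sub>N t"
  using null_add[of "p - q" "q - t"] by (simp add: neqv_def)

lemma neqv_eq_trans [trans]: "p \<cong>\<^sub>N q \<Longrightarrow> q = t \<Longrightarrow> p \<cong>\<^sub>N t" "p = q \<Longrightarrow> q \<cong>\<^sub>N t \<Longrightarrow> p \<cong>\<^sub>N t"
  by simp_all

lemma null_0: "null 0"
  by (rule null_JU[OF U.J_zero])

lemma neqv_refl [simp]: "p \<cong>\<^sub>N p"
  by (simp add: neqv_def null_0)

lemma neqv_add: "p \<cong>\<^sub>N q \<Longrightarrow> p' \<cong>\<^sub>N q' \<Longrightarrow> p + p' \<cong>\<^sub>N q + q'"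
  using null_add[of "p - q" "p' - q'"] by (simp add: neqv_def algebra_simps)

lemma neqv_mult: "p \<cong>\<^sub>N q \<Longrightarrow> t * p \<cong>\<^sub>N t * q"
  using null_mult[of "p - q" t] by (simp add: neqv_def algebra_simps)

lemma neqv_S: "p \<doteq> q \<Longrightarrow> p \<cong>\<^sub>N q"
  by (simp add: neqv_def S.eqv_def null_JS)

lemma neqv_U: "U.eqv p q \<Longrightarrow> p \<cong>\<^sub>N q"
  by (simp add: neqv_def U.eqv_def null_JU)

text \<open>Induction on the word: the bracket relation carries \<open>x\<close> past the first
  letter exactly as \<open>act_letter_homogeneous\<close> does for the operator, and at the empty
  word both sides give the character. \<open>x\<close> is generalised because [x,y] takes its
  place.\<close>

lemma act_neqv_word:
  assumes "homogeneous xs ps" "x \<in> P p" "x \<in> W 0 \<or> x \<in> W 1"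
  shows "monom [x] * monom xs \<cong>\<^sub>N act x (monom xs)"
  using assms
proof (induction xs arbitrary: ps x p)
  case Nil
  then have x: "x \<in> K"
    by (auto simp: K_iff gpart_W)
  have "monom [x] * monom [] \<cong>\<^sub>N const (lam (gpart 0 x))"
    using null_K[OF x] by (simp add: neqv_def character_K[OF x])
  also have "\<dots> \<cong>\<^sub>N act x (monom [])"
    using neqv_S[OF S.eqv_sym[OF act_unit[OF Nil(3)]]] by simp
  finally show ?case .
next
  case (Cons y ys)
  from Cons.prems(1) obtain c qs where y: "y \<in> V" "y \<in> P c" and ys: "homogeneous ys qs"
    by (auto simp: homogeneous_list_def list_all2_Cons1)
  note sup = word_polys[OF ys, of 1]
  \<comment> \<open>If \<open>x\<close> has degree 0 then [x,y] lies in \<open>V\<close> and acts as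
    a letter; if \<open>x\<close> has degree 1 then [x,y] has degree 0 and the induction hypothesis
    applies to it.\<close>
  have bxy: "monom [br x y] * monom ys \<cong>\<^sub>N act (br x y) (monom ys)"
    using Cons.prems(3)
  proof
    assume "x \<in> W 0"
    then show ?thesis
      by (intro neqv_S S.eqv_sym[OF act_V] br_V_closed(1) y sup)
  next
    assume "x \<in> W 1"
    then show ?thesis
      using Cons.IH[OF ys br_parity[OF Cons.prems(2) y(2)]] br_V_closed(3)[of x y] y by blast
  qed
  obtain k where k: "x \<in> W k" "0 \<le> k"
    using Cons.prems(3) by (metis order_refl zero_le_one)
  have "monom [x] * monom (y # ys) = monom [x] * monom [y] * monom ys"
    by simp
  also have "\<dots> \<cong>\<^sub>N (const (ksign p c) * (monom [y] * monom [x]) + monom [br x y]) * monom ys"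
    by (intro neqv_U U.eqv_mult_right U_letter_br Cons.prems y polys_UNIV)
  also have "\<dots> = const (ksign p c) * (monom [y] * (monom [x] * monom ys)) + monom [br x y] * monom ys"
    by (simp only: distrib_right mult.assoc)
  also have "\<dots> \<cong>\<^sub>N const (ksign p c) * (monom [y] * act x (monom ys)) + act (br x y) (monom ys)"
    by (intro neqv_add neqv_mult bxy Cons.IH[OF ys Cons.prems(2,3)])
  also have "\<dots> \<cong>\<^sub>N act x (monom [y] * monom ys)"
    by (intro neqv_S S.eqv_sym[OF act_letter_homogeneous[OF k(1) Cons.prems(2) k(2) y sup]])
  finally show ?case
    by simp
qed

lemma act_neqv:
  assumes "q \<in> polys V"
  shows "monom [x] * q \<cong>\<^sub>N act x q"
proof -
  have lin: "monom [x + y] * q \<cong>\<^sub>N act (x + y) q"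
    if "monom [x] * q \<cong>\<^sub>N act x q" "monom [y] * q \<cong>\<^sub>N act y q" "q \<in> polys V" for x y q
  proof -
    have "monom [x + y] * q \<cong>\<^sub>N (monom [x] + monom [y]) * q"
      by (intro neqv_U U.eqv_mult_right U_letter_add polys_UNIV)
    also have "\<dots> = monom [x] * q + monom [y] * q"
      by (rule distrib_right)
    also have "\<dots> \<cong>\<^sub>N act x q + act y q"
      by (intro neqv_add that)
    also have "\<dots> \<cong>\<^sub>N act (x + y) q"
      by (rule neqv_S[OF S.eqv_sym[OF act_add[OF that(3)]]])
    finally show ?thesis .
  qed
  have hom: "monom [x] * q \<cong>\<^sub>N act x q"
    if "q \<in> polys V" "x \<in> P p" "x \<in> W 0 \<or> x \<in> W 1" for x p q
    using that(1)
  proof (induction rule: homogeneous_word_induct)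
    case (word xs ps)
    then show ?case by (rule act_neqv_word[OF _ that(2,3)])
  next
    case (scale c q)
    then show ?case by (simp only: const_left_commute[of "monom [x]"] act_linear(2) neqv_mult)
  next
    case (add q q')
    then show ?case by (simp only: distrib_left act_linear(1) neqv_add)
  next
    case (eqv q q')
    have "monom [x] * q' \<cong>\<^sub>N monom [x] * q"
      by (rule neqv_mult[OF neqv_S[OF S.eqv_sym[OF eqv(3)]]])
    also have "\<dots> \<cong>\<^sub>N act x q"
      by (rule eqv)
    also have "\<dots> \<cong>\<^sub>N act x q'"
      by (rule neqv_S[OF act_eqv[OF eqv(3)]])
    finally show ?case .
  qed
  have graded: "monom [x] * q \<cong>\<^sub>N act x q" if x: "x \<in> W 0 \<or> x \<in> W 1" for x
  proof -
    have "monom [ppart c x] * q \<cong>\<^sub>N act (ppart c x) q" for c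
      by (rule hom[OF assms ppart_in]) (use x ppart_W in auto)
    then have "monom [ppart 0 x + ppart 1 x] * q \<cong>\<^sub>N act (ppart 0 x + ppart 1 x) q"
      by (intro lin assms)
    then show ?thesis by (simp only: ppart_sum)
  qed
  have "monom [gpart (-1) x + gpart 0 x + gpart 1 x] * q \<cong>\<^sub>N act (gpart (-1) x + gpart 0 x + gpart 1 x) q"
    by (intro lin graded neqv_S[OF S.eqv_sym[OF act_V]] assms) (use gpart_intros in auto)
  then show ?thesis by (simp only: gpart_sum)
qed

text \<open>The letter rule is iterated along a word. For \<open>q = 1\<close> every polynomial
  becomes congruent to one in letters of \<open>V\<close>, which yields surjectivity.\<close>

lemma ev_neqv:
  assumes "q \<in> polys V"
  shows "p * q \<cong>\<^sub>N ev p q"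
proof (induction p rule: poly_mapping_list_induct)
  case (monom w)
  show ?case
  proof (induction w)
    case (Cons x w)
    have "monom (x # w) * q = monom [x] * (monom w * q)"
      by (simp add: mult.assoc[symmetric])
    also have "\<dots> \<cong>\<^sub>N monom [x] * ev (monom w) q"
      by (rule neqv_mult[OF Cons.IH])
    also have "\<dots> \<cong>\<^sub>N act x (ev (monom w) q)"
      by (rule act_neqv[OF ev_polys[OF assms]])
    finally show ?case
      by (simp add: ev_linear)
  qed (simp add: ev_linear)
next
  case (scale c p)
  then show ?case by (simp only: mult.assoc ev_linear(2) neqv_mult)
next
  case (add p p')
  then show ?case by (simp only: distrib_right ev_linear(1) neqv_add)
qed

section \<open>The isomorphism and the transported action\<close>

abbreviation M where "M \<equiv> induced_module sc P br K character_K"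

abbreviation phi where "phi \<equiv> induced_iso sc P br W lam"

lemma phi_cls: "p \<in> polys V \<Longrightarrow> phi (S.cls p) = N_cls (tens p 1)"
  by (simp add: induced_iso_def sym_algebra_eq pure_tensor_def symmetrisation_cls)

lemma carrier_M: "carrier M = N_cls ` carrier TF"
  by (auto simp: induced_module_def Let_def FactGroup_def RCOSETS_def)

lemma add_M: "N_cls y \<oplus>\<^bsub>M\<^esub> N_cls z = N_cls (y + z)"
proof -
  have "N_cls y <#>\<^bsub>TF\<^esub> N_cls z = N_cls (y + z)"
  proof
    show "N_cls y <#>\<^bsub>TF\<^esub> N_cls z \<subseteq> N_cls (y + z)"
    proof
      fix w assume "w \<in> N_cls y <#>\<^bsub>TF\<^esub> N_cls z"
      then obtain m n where "m \<in> N" "n \<in> N" "w = (m + y) + (n + z)"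
        by (auto simp: set_mult_def N_cls_eq)
      then show "w \<in> N_cls (y + z)"
        using N_add[of m n] by (simp add: mem_N_cls algebra_simps)
    qed
    show "N_cls (y + z) \<subseteq> N_cls y <#>\<^bsub>TF\<^esub> N_cls z"
    proof
      fix w assume "w \<in> N_cls (y + z)"
      then obtain n where "n \<in> N" "w = (n + y) + (0 + z)"
        by (auto simp: N_cls_eq algebra_simps)
      then show "w \<in> N_cls y <#>\<^bsub>TF\<^esub> N_cls z"
        using N_zero unfolding set_mult_def N_cls_eq TF_simps by blast
    qed
  qed
  then show ?thesis
    by (simp add: induced_module_def Let_def FactGroup_def)
qed

lemma scale_M: "c \<odot>\<^bsub>M\<^esub> N_cls z = N_cls (tens_act (const c) z)"
  by (simp add: induced_module_def Let_def env_class_def tensor_action_cls)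

text \<open>Scalars move into the first factor, and differences of tensors with second factor 1
  combine into one such tensor.\<close>

lemma ex_tens: "z \<in> carrier TF \<Longrightarrow> \<exists>p. z - tens p 1 \<in> N"
  unfolding carrier_TF
proof (induction z rule: frag_induction)
  case zero
  then show ?case
    using N_uminus null_0 unfolding null_def by fastforce
next
  case (one x)
  then obtain p v where "x = (U.cls p, v)"
    by (auto simp: U.carrier_A)
  then show ?case
    using N_uminus[OF tens_scalar[of v p]] by auto
next
  case (diff a b)
  then obtain p q where pq: "a - tens p 1 \<in> N" "b - tens q 1 \<in> N"
    by blast
  have "(a - tens p 1) - (b - tens q 1) - (tens (p - q) 1 - (tens p 1 - tens q 1)) \<in> N"
    by (intro N_diff pq tens_diff)
  then have "a - b - tens (p - q) 1 \<in> N"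
    by (simp add: algebra_simps)
  then show ?case by blast
qed

lemma neqv_N_cls: "p \<cong>\<^sub>N q \<Longrightarrow> N_cls (tens p 1) = N_cls (tens q 1)"
  by (simp add: neqv_def N_cls_eq_iff null_diff_iff)

text \<open>The retraction sends \<open>tens p 1\<close> back to \<open>p\<close> modulo the
  symmetric ideal.\<close>

lemma phi_inj: "inj_on phi (carrier S.A)"
proof (rule inj_onI)
  fix Y Z assume "Y \<in> carrier S.A" "Z \<in> carrier S.A" and eq: "phi Y = phi Z"
  then obtain p q where p: "p \<in> polys V" "Y = S.cls p" and q: "q \<in> polys V" "Z = S.cls q"
    by (metis S.carrier_AE)
  have "retraction (tens p 1 - tens q 1) \<in> JS"
    using eq p q by (intro retraction_N) (simp add: phi_cls N_cls_eq_iff)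
  then have "retraction (tens p 1) \<doteq> retraction (tens q 1)"
    by (simp add: S.eqv_def retraction_def frag_sum_diff)
  moreover have "retraction (tens p 1) \<doteq> p" if "p \<in> polys V" for p
    using S.eqv_trans[OF retraction_tens[of p 1]] ev_V[OF that] by simp
  ultimately have "p \<doteq> q"
    using p q by (meson S.eqv_sym S.eqv_trans)
  then show "Y = Z"
    using p q by (simp add: S.cls_eq_iff)
qed

lemma phi_image: "phi ` carrier S.A = carrier M"
proof
  show "phi ` carrier S.A \<subseteq> carrier M"
    by (auto simp: S.carrier_A phi_cls carrier_M intro: tens_carrier)
  show "carrier M \<subseteq> phi ` carrier S.A"
  proof
    fix A assume "A \<in> carrier M"
    then obtain z where z: "z \<in> carrier TF" "A = N_cls z"
      by (auto simp: carrier_M)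
    obtain p where p: "z - tens p 1 \<in> N"
      using ex_tens[OF z(1)] by blast
    have "p \<cong>\<^sub>N ev p 1"
      using ev_neqv[OF one_polys, of p] by simp
    then have "A = N_cls (tens (ev p 1) 1)"
      using p z(2) neqv_N_cls by (metis N_cls_eq_iff)
    also have "\<dots> = phi (S.cls (ev p 1))"
      by (rule phi_cls[symmetric]) (intro ev_polys one_polys)
    finally show "A \<in> phi ` carrier S.A"
      using S.cls_in_A[OF ev_polys[OF one_polys]] by blast
  qed
qed

lemma phi_linear: "phi \<in> linear_maps S.A M"
  unfolding linear_maps_def
proof (intro CollectI conjI ballI allI)
  show "phi \<in> carrier S.A \<rightarrow>\<^sub>E carrier M"
  proof (rule PiE_I)
    show "phi Y \<in> carrier M" if "Y \<in> carrier S.A" for Y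
      using that phi_image by blast
    show "phi Y = undefined" if "Y \<notin> carrier S.A" for Y
      using that by (simp add: induced_iso_def sym_algebra_eq)
  qed
  fix Y assume "Y \<in> carrier S.A"
  then obtain p where p: "p \<in> polys V" "Y = S.cls p"
    by (rule S.carrier_AE)
  show "phi (Y \<oplus>\<^bsub>S.A\<^esub> Z) = phi Y \<oplus>\<^bsub>M\<^esub> phi Z" if Z: "Z \<in> carrier S.A" for Z
  proof -
    obtain q where q: "q \<in> polys V" "Z = S.cls q"
      using Z by (rule S.carrier_AE)
    have "N_cls (tens (p + q) 1) = N_cls (tens p 1 + tens q 1)"
      unfolding N_cls_eq_iff using tens_add[of p q 1] by (simp add: algebra_simps)
    then show ?thesis
      using p q by (simp add: S.add_A phi_cls polys_add add_M)
  qed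
  show "phi (c \<odot>\<^bsub>S.A\<^esub> Y) = c \<odot>\<^bsub>M\<^esub> phi Y" for c
    using p by (simp add: S.scale_A phi_cls polys_mult const_polys scale_M tens_act_tens)
qed

abbreviation rep where "rep \<equiv> induced_rep sc P br W lam"

lemma induced_rep_cls:
  assumes "q \<in> polys V"
  shows "rep x (S.cls q) = S.cls (act x q)"
proof -
  have "tensor_action sc P br K character_K (env_gen sc P br UNIV x) (phi (S.cls q)) = N_cls (tens (monom [x] * q) 1)"
    by (simp only: phi_cls[OF assms] env_gen_def env_class_def tensor_action_cls tens_act_tens)
  also have "\<dots> = N_cls (tens (act x q) 1)"
    by (rule neqv_N_cls[OF act_neqv[OF assms]])
  also have "\<dots> = phi (S.cls (act x q))"
    by (rule phi_cls[symmetric]) (rule act_polys(3)[OF assms])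
  finally show ?thesis
    using assms act_polys(3)[OF assms]
    by (simp add: induced_rep_def sym_algebra_eq the_inv_into_f_f[OF phi_inj])
qed

end

section \<open>Super derivations\<close>

context graded_induction_data
begin

lemma tw_0: "tw 0 a = a"
proof -
  have "map (twist 0) w = w" for w
    by (induction w) (auto simp: twist_0)
  then have w: "tw 0 (monom w) = monom w" for w
    by (simp add: tw_def substitute_def)
  show ?thesis
    by (induction a rule: poly_mapping_list_induct) (simp_all add: tw_linear w)
qed

lemma tw_word:
  assumes "homogeneous xs ps"
  shows "tw p (monom xs) \<doteq> const (ksign p (sum_list ps)) * monom xs"
  using assms
proof (induction xs arbitrary: ps)
  case Nil
  then show ?case by (simp add: tw_def substitute_def homogeneous_list_def)
next
  case (Cons y ys)
  from Cons.prems obtain c qs where y: "y \<in> V" "y \<in> P c" and ys: "homogeneous ys qs"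
    and ps: "ps = c # qs"
    by (auto simp: homogeneous_list_def list_all2_Cons1)
  note sup = word_polys[OF ys, of 1]
  have "tw p (monom (y # ys)) = monom [twist p y] * tw p (monom ys)"
    by (simp add: tw_def substitute_def)
  also have "\<dots> \<doteq> monom [twist p y] * (const (ksign p (sum_list qs)) * monom ys)"
    by (intro S.eqv_mult_left Cons.IH[OF ys] letter_polys twist_W y)
  also have "\<dots> \<doteq> const (ksign p c) * monom [y] * (const (ksign p (sum_list qs)) * monom ys)"
    unfolding twist_P[OF y(2)]
    by (intro S.eqv_mult_right letter_scale y polys_mult const_polys sup)
  also have "\<dots> = const (ksign p (sum_list ps)) * monom (y # ys)"
    by (simp add: ps ksign_add_right mult.commute del: add_bit_eq_xor)
  finally show ?case .
qed

text \<open>On a letter the coordinate supplies the sign, and twists commute, so the identity is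
  exact. It expresses that the i-th partial derivative has parity \<open>ip i\<close>.\<close>

lemma tw_drv:
  assumes "a \<in> polys V" "i \<in> I"
  shows "tw p (drv i a) = const (ksign p (ip i)) * drv i (tw p a)"
  using assms(1)
proof (induction rule: polys_induct)
  case (monom w)
  then show ?case
  proof (induction w)
    case Nil
    then show ?case by (simp add: tw_linear tw_def substitute_def)
  next
    case (Cons y w)
    then have y: "y \<in> V" and IH: "tw p (drv i (monom w)) = const (ksign p (ip i)) * drv i (tw p (monom w))"
      by auto
    have tw1: "tw p (monom [y] * q) = monom [twist p y] * tw p q" for y q
      unfolding tw_mult by (simp add: tw_def substitute_def)
    have "tw p (drv i (monom [y] * monom w))
        = const (coord i y) * tw p (monom w)
          + monom [twist p (twist (ip i) y)] * (const (ksign p (ip i)) * drv i (tw p (monom w)))"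
      by (simp only: drv_letter tw_linear tw1 IH)
    also have "\<dots> = const (ksign p (ip i)) * (const (coord i (twist p y)) * tw p (monom w)
          + monom [twist (ip i) (twist p y)] * drv i (tw p (monom w)))"
    proof -
      have "twist p (twist (ip i) y) = twist (ip i) (twist p y)"
        by (simp add: twist_twist add.commute del: add_bit_eq_xor)
      then show ?thesis
        by (simp only: coord_twist[OF y assms(2)] distrib_left const_const_mult ksign_square'
            const_left_commute[of "monom [twist (ip i) (twist p y)]"])
    qed
    also have "\<dots> = const (ksign p (ip i)) * drv i (tw p (monom [y] * monom w))"
      by (simp only: tw1 drv_letter)
    finally show ?case by simp
  qed
next
  case (scale c q)
  then show ?case
    by (simp only: tw_linear drv_linear const_const_mult mult.commute)
next
  case (add q q')
  then show ?case
    by (simp only: tw_linear drv_linear distrib_left)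
qed

lemma sym_ring: "ring S.A"
  by (rule S.ring_A)

abbreviation part where "part \<equiv> sym_part sc P V"

lemma part_eq: "part q = generate (add_monoid S.A)
    {S.cls (Poly_Mapping.single xs c) | xs ps c. homogeneous xs ps \<and> sum_list ps = q}"
  by (simp add: sym_part_def sym_algebra_eq sym_class_def)

lemma a_inv_cls: "a \<in> polys V \<Longrightarrow> \<ominus>\<^bsub>S.A\<^esub> S.cls a = S.cls (- a)"
proof -
  assume a: "a \<in> polys V"
  interpret ring S.A by (rule sym_ring)
  show ?thesis
    using a by (intro minus_equality) (auto simp: S.add_A S.zero_A polys_uminus)
qed

lemma part_tw:
  assumes "A \<in> part q"
  shows "\<exists>a\<in>polys V. A = S.cls a \<and> (\<forall>p. tw p a \<doteq> const (ksign p q) * a)"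
  using assms unfolding part_eq
proof (induction rule: generate.induct)
  case one
  then show ?case
    by (intro bexI[of _ 0]) (auto simp: S.zero_A tw_linear zero_polys)
next
  have *: "\<exists>a\<in>polys V. h = S.cls a \<and> (\<forall>p. tw p a \<doteq> const (ksign p q) * a)"
    if h: "h \<in> {S.cls (Poly_Mapping.single xs c) | xs ps c. homogeneous xs ps \<and> sum_list ps = q}"
    for h
  proof -
    obtain xs ps c where h: "h = S.cls (Poly_Mapping.single xs c)" "homogeneous xs ps" "sum_list ps = q"
      using h by blast
    have "tw p (const c * monom xs) \<doteq> const (ksign p q) * (const c * monom xs)" for p
      using S.eqv_scale[OF tw_word[OF h(2), of p], of c] h(3)
      by (simp only: tw_linear const_left_commute[of "const c"])
    then show ?thesis
      using h word_polys[OF h(2), of c] by auto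
  qed
  case (incl h)
  then show ?case by (rule *)
next
  case (inv h)
  then obtain xs ps c where h: "h = S.cls (Poly_Mapping.single xs c)" "homogeneous xs ps" "sum_list ps = q"
    by blast
  have "tw p (const (- c) * monom xs) \<doteq> const (ksign p q) * (const (- c) * monom xs)" for p
    using S.eqv_scale[OF tw_word[OF h(2), of p], of "- c"] h(3)
    by (simp only: tw_linear const_left_commute[of "const (- c)"])
  moreover have "inv\<^bsub>add_monoid S.A\<^esub> h = S.cls (- Poly_Mapping.single xs c)"
    using a_inv_cls[OF word_polys[OF h(2)], of c] h(1) by (simp add: a_inv_def)
  ultimately show ?case
    using h(1) word_polys[OF h(2), of "- c"] by (auto simp: single_uminus)
next
  case (eng h1 h2)
  then obtain a b where ab: "a \<in> polys V" "b \<in> polys V" "h1 = S.cls a" "h2 = S.cls b"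
    "\<And>p. tw p a \<doteq> const (ksign p q) * a" "\<And>p. tw p b \<doteq> const (ksign p q) * b"
    by blast
  then have "tw p (a + b) \<doteq> const (ksign p q) * (a + b)" for p
    unfolding tw_linear distrib_left by (intro S.eqv_add ab)
  then show ?case
    using ab polys_add[of a V b] by (auto simp: S.add_A)
qed

lemma part_closed:
  shows "S.cls 0 \<in> part q"
    and "A \<in> part q \<Longrightarrow> B \<in> part q \<Longrightarrow> A \<oplus>\<^bsub>S.A\<^esub> B \<in> part q"
proof -
  show "S.cls 0 \<in> part q"
    using generate.one[of "add_monoid S.A"] unfolding part_eq by (simp add: S.zero_A)
  show "A \<oplus>\<^bsub>S.A\<^esub> B \<in> part q" if "A \<in> part q" "B \<in> part q"
    using generate.eng[of A "add_monoid S.A" _ B] that unfolding part_eq by simp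
qed

text \<open>The parity components are the eigenspaces of the twist, which is easier to test than membership in
  a generated subgroup.\<close>

lemma part_iff:
  assumes a: "a \<in> polys V"
  shows "S.cls a \<in> part q \<longleftrightarrow> tw 1 a \<doteq> const (ksign 1 q) * a"
proof
  assume "S.cls a \<in> part q"
  then obtain b where b: "b \<in> polys V" "a \<doteq> b" "tw 1 b \<doteq> const (ksign 1 q) * b"
    using part_tw by (metis S.cls_eq_iff)
  have "tw 1 a \<doteq> tw 1 b"
    using tw_JS[of "a - b" 1] b(2) by (simp add: S.eqv_def tw_linear)
  also have "\<dots> \<doteq> const (ksign 1 q) * b"
    by (rule b)
  also have "\<dots> \<doteq> const (ksign 1 q) * a"
    by (rule S.eqv_scale[OF S.eqv_sym[OF b(2)]])
  finally show "tw 1 a \<doteq> const (ksign 1 q) * a" .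
next
  \<comment> \<open>The projection onto the eigenspace of the involution \<open>tw 1\<close>
    belonging to parity \<open>q\<close>; modulo the ideal it fixes or kills each homogeneous
    word.\<close>
  let ?proj = "\<lambda>a. const (1 / 2) * (a + const (ksign 1 q) * tw 1 a)"
  have proj_eqv: "?proj a \<doteq> ?proj b" if "a \<doteq> b" for a b
  proof -
    have "tw 1 a \<doteq> tw 1 b"
      using tw_JS[of "a - b" 1] that by (simp add: S.eqv_def tw_linear)
    then show ?thesis
      by (intro S.eqv_scale S.eqv_add that)
  qed
  have half: "const (1 / 2) * (x + x) = x" for x :: "'g list \<Rightarrow>\<^sub>0 'k"
  proof -
    have "const (1 / 2) * (x + x) = (const (1 / 2) + const (1 / 2)) * x"
      by (simp only: distrib_left distrib_right)
    then show ?thesis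
      by (simp add: single_add[symmetric])
  qed
  \<comment> \<open>The free scalar \<open>d\<close> serves the scaling case: \<open>part\<close> is
    generated as an additive group, so closure under scalars has to be part of the claim.\<close>
  have "\<forall>d. S.cls (const d * ?proj a) \<in> part q"
    using a
  proof (induction rule: homogeneous_word_induct)
    case (word xs ps)
    show ?case
    proof
      fix d
      have eq: "const d * ?proj (monom xs) \<doteq> const d * (const (1 / 2) *
          (monom xs + const (ksign 1 q) * (const (ksign 1 (sum_list ps)) * monom xs)))"
        by (intro S.eqv_scale S.eqv_add S.eqv_refl tw_word[OF word])
      show "S.cls (const d * ?proj (monom xs)) \<in> part q"
      proof (cases "sum_list ps = q")
        case True
        then have "S.cls (const d * ?proj (monom xs)) = S.cls (Poly_Mapping.single xs d)"
          unfolding S.cls_eq_iff using eq half[of "monom xs"] by (simp add: const_const_mult)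
        then show ?thesis
          unfolding part_eq using word True by (auto intro!: generate.incl)
      next
        case False
        then have "ksign 1 q * ksign 1 (sum_list ps) = (- 1 :: 'k)"
          by (cases q; cases "sum_list ps") (auto simp: ksign_def)
        then have "S.cls (const d * ?proj (monom xs)) = S.cls 0"
          unfolding S.cls_eq_iff using eq by (simp add: const_const_mult del: single_mult_list)
        then show ?thesis
          using part_closed(1) by simp
      qed
    qed
  next
    case (scale c b)
    have "const d * ?proj (const c * b) = const (d * c) * ?proj b" for d
      by (simp only: tw_linear distrib_left const_const_mult mult_ac)
    then show ?case
      using scale(2) by simp
  next
    case (add b b')
    have "const d * ?proj (b + b') = const d * ?proj b + const d * ?proj b'" for d
      by (simp only: tw_linear distrib_left add_ac)
    moreover have "S.cls (const d * ?proj b + const d * ?proj b')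
        = S.cls (const d * ?proj b) \<oplus>\<^bsub>S.A\<^esub> S.cls (const d * ?proj b')" for d
      using add(1,2) by (intro S.add_A[symmetric] polys_intros tw_polys)
    ultimately show ?case
      using part_closed(2) add(3,4) by simp
  next
    case (eqv b b')
    have "S.cls (const d * ?proj b) = S.cls (const d * ?proj b')" for d
      unfolding S.cls_eq_iff by (intro S.eqv_scale proj_eqv eqv(3))
    then show ?case
      using eqv(4) by simp
  qed
  then have "S.cls (?proj a) \<in> part q"
    by (metis const_one mult_1)
  moreover assume "tw 1 a \<doteq> const (ksign 1 q) * a"
  then have "?proj a \<doteq> const (1 / 2) * (a + const (ksign 1 q) * (const (ksign 1 q) * a))"
    by (intro S.eqv_scale S.eqv_add S.eqv_refl)
  then have "S.cls (?proj a) = S.cls a"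
    unfolding S.cls_eq_iff using half[of a] by (simp add: const_const_mult)
  ultimately show "S.cls a \<in> part q"
    by simp
qed

text \<open>The operator on classes induced by \<open>T\<close> through a chosen representative; the
  choice is immaterial once \<open>T\<close> descends.\<close>

definition lift :: "(('g list \<Rightarrow>\<^sub>0 'k) \<Rightarrow> 'g list \<Rightarrow>\<^sub>0 'k) \<Rightarrow> ('g list \<Rightarrow>\<^sub>0 'k) set \<Rightarrow> ('g list \<Rightarrow>\<^sub>0 'k) set" where
  "lift T = (\<lambda>Y\<in>carrier S.A. S.cls (T (SOME p. p \<in> polys V \<and> S.cls p = Y)))"

definition descends :: "(('g list \<Rightarrow>\<^sub>0 'k) \<Rightarrow> 'g list \<Rightarrow>\<^sub>0 'k) \<Rightarrow> bool" where
  "descends T \<longleftrightarrow> (\<forall>a\<in>polys V. T a \<in> polys V) \<and>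
     (\<forall>a\<in>polys V. \<forall>b\<in>polys V. a \<doteq> b \<longrightarrow> T a \<doteq> T b)"

lemma lift_cls:
  assumes "descends T" "p \<in> polys V"
  shows "lift T (S.cls p) = S.cls (T p)"
proof -
  let ?q = "SOME q. q \<in> polys V \<and> S.cls q = S.cls p"
  have q: "?q \<in> polys V \<and> S.cls ?q = S.cls p"
    by (rule someI[of _ p]) (simp add: assms)
  then have "T ?q \<doteq> T p"
    using assms unfolding descends_def S.cls_eq_iff by blast
  then have "S.cls (T ?q) = S.cls (T p)"
    by (simp only: S.cls_eq_iff)
  then show ?thesis
    using assms(2) by (simp add: lift_def)
qed

lemma lift_eqI:
  assumes "descends T" "f \<in> extensional (carrier S.A)"
    and "\<And>p. p \<in> polys V \<Longrightarrow> f (S.cls p) = S.cls (T p)"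
  shows "f = lift T"
proof
  fix Y
  show "f Y = lift T Y"
  proof (cases "Y \<in> carrier S.A")
    case True
    then obtain p where "p \<in> polys V" "Y = S.cls p"
      by (rule S.carrier_AE)
    then show ?thesis
      using lift_cls[OF assms(1)] assms(3) by simp
  next
    case False
    then show ?thesis
      using assms(2) by (simp add: lift_def extensional_def)
  qed
qed

section \<open>Partial derivatives as super derivations of the quotient\<close>

lemma descends_drv: "i \<in> I \<Longrightarrow> descends (drv i)"
  unfolding descends_def
proof (intro conjI ballI impI)
  show "drv i a \<in> polys V" if "a \<in> polys V" for a
    by (rule drv_polys[OF that])
  show "drv i a \<doteq> drv i b" if "i \<in> I" "a \<doteq> b" for a b
    using drv_JS[OF that(1), of "a - b"] that(2) by (simp add: S.eqv_def drv_linear)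
qed

lemma tw_parity:
  assumes "a \<in> polys V" "S.cls a \<in> part q"
  shows "tw p a \<doteq> const (ksign p q) * a"
proof (cases "p = 0")
  case True
  then show ?thesis by (simp add: tw_0)
next
  case False
  then have "p = 1" by simp
  then show ?thesis
    using assms by (simp add: part_iff)
qed

lemma drv_sym_part:
  assumes a: "a \<in> polys V" "S.cls a \<in> part q" and i: "i \<in> I"
  shows "S.cls (drv i a) \<in> part (ip i + q)"
proof -
  have "tw 1 a \<doteq> const (ksign 1 q) * a"
    using a by (simp add: part_iff)
  then have "drv i (tw 1 a) \<doteq> drv i (const (ksign 1 q) * a)"
    using drv_JS[OF i, of "tw 1 a - const (ksign 1 q) * a"] by (simp add: S.eqv_def drv_linear)
  from S.eqv_scale[OF this, of "ksign 1 (ip i)"]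
  have "tw 1 (drv i a) \<doteq> const (ksign 1 (ip i)) * (const (ksign 1 q) * drv i a)"
    by (simp only: tw_drv[OF a(1) i] drv_linear)
  then show ?thesis
    unfolding part_iff[OF drv_polys[OF a(1)]]
    by (simp only: const_const_mult ksign_add_right)
qed

lemma part_carrier: "A \<in> part q \<Longrightarrow> A \<in> carrier S.A"
  using part_tw by (metis S.cls_in_A)

lemma super_derivation_drv:
  assumes i: "i \<in> I"
  shows "super_derivation sc P V (ip i) (lift (drv i))"
proof -
  note L = lift_cls[OF descends_drv[OF i]]
  have lin: "lift (drv i) \<in> linear_maps S.A S.A"
    unfolding linear_maps_def
  proof (intro CollectI conjI ballI allI)
    show "lift (drv i) \<in> carrier S.A \<rightarrow>\<^sub>E carrier S.A"
    proof (rule PiE_I)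
      show "lift (drv i) Y \<in> carrier S.A" if "Y \<in> carrier S.A" for Y
        using that by (elim S.carrier_AE) (simp add: L drv_polys)
      show "lift (drv i) Y = undefined" if "Y \<notin> carrier S.A" for Y
        using that by (simp add: lift_def)
    qed
    show "lift (drv i) (Y \<oplus>\<^bsub>S.A\<^esub> Z) = lift (drv i) Y \<oplus>\<^bsub>S.A\<^esub> lift (drv i) Z"
      if "Y \<in> carrier S.A" "Z \<in> carrier S.A" for Y Z
      using that
      by (elim S.carrier_AE) (simp add: L S.add_A drv_polys polys_add drv_linear)
    show "lift (drv i) (c \<odot>\<^bsub>S.A\<^esub> Y) = c \<odot>\<^bsub>S.A\<^esub> lift (drv i) Y" if "Y \<in> carrier S.A" for c Y
      using that
      by (elim S.carrier_AE)
        (simp add: L S.scale_A drv_polys polys_mult const_polys drv_linear)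
  qed
  have par: "lift (drv i) A \<in> part (ip i + q)" if A: "A \<in> part q" for A q
  proof -
    obtain a where a: "a \<in> polys V" "A = S.cls a"
      using part_carrier[OF A] by (rule S.carrier_AE)
    then show ?thesis
      using drv_sym_part[OF a(1) _ i] A by (simp add: L del: add_bit_eq_xor)
  qed
  have leib: "lift (drv i) (A \<otimes>\<^bsub>S.A\<^esub> B) = lift (drv i) A \<otimes>\<^bsub>S.A\<^esub> B
      \<oplus>\<^bsub>S.A\<^esub> ksign (ip i) q \<odot>\<^bsub>S.A\<^esub> (A \<otimes>\<^bsub>S.A\<^esub> lift (drv i) B)"
    if A: "A \<in> part q" and B: "B \<in> carrier S.A" for A B q
  proof -
    obtain a where a: "a \<in> polys V" "A = S.cls a"
      using part_carrier[OF A] by (rule S.carrier_AE)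
    obtain b where b: "b \<in> polys V" "B = S.cls b"
      using B by (rule S.carrier_AE)
    have "drv i (a * b) = drv i a * b + tw (ip i) a * drv i b"
      by (rule drv_mult)
    also have "\<dots> \<doteq> drv i a * b + const (ksign (ip i) q) * a * drv i b"
      using A a b by (intro S.eqv_add S.eqv_refl S.eqv_mult_right tw_parity drv_polys) auto
    finally have "S.cls (drv i (a * b)) = S.cls (drv i a * b + const (ksign (ip i) q) * (a * drv i b))"
      by (simp only: S.cls_eq_iff mult.assoc)
    then show ?thesis
      using a b by (simp add: L S.mult_A S.add_A S.scale_A polys_mult drv_polys const_polys)
  qed
  show ?thesis
    unfolding super_derivation_def Let_def sym_algebra_eq using lin par leib by blast
qed

text \<open>The zero character reads off the constant term, and no relation has one. So the unit is
  nonzero in the symmetric algebra, which pins down the parity of a derivation dual to a basis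
  vector.\<close>

lemma eval_char_JS: "p \<in> JS \<Longrightarrow> eval_char (\<lambda>_. 0) p = (0 :: 'k)"
proof (induction rule: JS_induct)
  case zero
  show ?case
    using eval_char_diff[of "\<lambda>_. 0" "0 :: 'g list \<Rightarrow>\<^sub>0 'k" 0] by simp
qed (simp_all add: eval_char_diff eval_char_single eval_char_add eval_char_mult)

lemma one_notin_JS: "1 \<notin> JS"
  using eval_char_JS[of 1] by auto

lemma X_part: "i \<in> I \<Longrightarrow> S.cls (monom [X i]) \<in> part (ip i)"
  unfolding part_eq using basis_facts(4,5)[of i]
  by (intro generate.incl CollectI exI[of _ "[X i]"] exI[of _ "[ip i]"] exI[of _ 1])
    (auto simp: homogeneous_list_def)

text \<open>Linearity extends the values on the basis to \<open>V\<close>, the Leibniz rule extends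
  them to homogeneous words, and these span modulo the ideal.\<close>

lemma super_derivation_unique:
  assumes i: "i \<in> I" and D: "super_derivation sc P V p D"
    and X: "\<And>j. j \<in> I \<Longrightarrow> D (S.cls (monom [X j])) = (if i = j then S.cls 1 else S.cls 0)"
  shows "D = lift (drv i)"
proof -
  from D have lin: "D \<in> linear_maps S.A S.A"
    and par: "\<And>q A. A \<in> part q \<Longrightarrow> D A \<in> part (p + q)"
    and leib: "\<And>q A B. A \<in> part q \<Longrightarrow> B \<in> carrier S.A \<Longrightarrow>
      D (A \<otimes>\<^bsub>S.A\<^esub> B) = D A \<otimes>\<^bsub>S.A\<^esub> B \<oplus>\<^bsub>S.A\<^esub> ksign p q \<odot>\<^bsub>S.A\<^esub> (A \<otimes>\<^bsub>S.A\<^esub> D B)"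
    unfolding super_derivation_def Let_def sym_algebra_eq by blast+
  have ext: "D \<in> extensional (carrier S.A)" and closed: "\<And>A. A \<in> carrier S.A \<Longrightarrow> D A \<in> carrier S.A"
    and D_add': "\<And>A B. A \<in> carrier S.A \<Longrightarrow> B \<in> carrier S.A \<Longrightarrow> D (A \<oplus>\<^bsub>S.A\<^esub> B) = D A \<oplus>\<^bsub>S.A\<^esub> D B"
    and D_scale': "\<And>c A. A \<in> carrier S.A \<Longrightarrow> D (c \<odot>\<^bsub>S.A\<^esub> A) = c \<odot>\<^bsub>S.A\<^esub> D A"
    using lin unfolding linear_maps_def by (auto simp: PiE_def)
  have D_add: "D (S.cls (a + b)) = S.cls (a' + b')"
    if "D (S.cls a) = S.cls a'" "D (S.cls b) = S.cls b'" "a \<in> polys V" "b \<in> polys V"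
      "a' \<in> polys V" "b' \<in> polys V" for a b a' b'
    using D_add'[of "S.cls a" "S.cls b"] that by (simp add: S.add_A)
  have D_scale: "D (S.cls (const c * a)) = S.cls (const c * a')"
    if "D (S.cls a) = S.cls a'" "a \<in> polys V" "a' \<in> polys V" for c a a'
    using D_scale'[of "S.cls a" c] that by (simp add: S.scale_A)
  have D_eqv: "D (S.cls a) = D (S.cls b)" if "a \<doteq> b" for a b
    using that S.cls_eq_iff[of a b] by simp
  \<comment> \<open>With the wrong parity the unit, being the image of \<open>X i\<close>, would be
    odd as well as even. Then 1 + 1 and hence 1 would lie in the ideal.\<close>
  have p: "p = ip i"
  proof (rule ccontr)
    assume "p \<noteq> ip i"
    have "S.cls 1 \<in> part (p + ip i)"
      using par[OF X_part[OF i]] X[OF i] by (simp del: add_bit_eq_xor)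
    then have "tw 1 1 \<doteq> const (ksign 1 (p + ip i)) * 1"
      by (simp only: part_iff[OF one_polys])
    moreover have "ksign 1 (p + ip i) = (- 1 :: 'k)"
      using \<open>p \<noteq> ip i\<close> by (cases p; cases "ip i") (auto simp: ksign_def)
    ultimately have "1 + 1 \<in> JS"
      by (simp add: S.eqv_def tw_def substitute_def single_uminus)
    from S.J_scale[OF this, of "1 / 2"] have "const (1 / 2 + 1 / 2) \<in> JS"
      by (simp only: distrib_left mult_1_right const_add)
    then show False
      using one_notin_JS by simp
  qed
  have D_0: "D (S.cls 0) = S.cls 0"
    using D_scale'[of "S.cls 0" 0] closed[of "S.cls 0"]
    by (auto simp: S.scale_A zero_polys elim!: S.carrier_AE)
  have D_letter: "D (S.cls (monom [y])) = S.cls (const (coord i y))" if y: "y \<in> V" for y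
  proof -
    have "D (S.cls (\<Sum>j\<in>J. const (coord j y) * monom [X j]))
        = S.cls (\<Sum>j\<in>J. const (coord j y) * (if i = j then 1 else 0))" if "finite J" "J \<subseteq> I" for J
      using that
    proof (induction J rule: finite_induct)
      case empty
      then show ?case by (simp add: D_0)
    next
      case (insert j J)
      have j: "monom [X j] \<in> polys V" "D (S.cls (monom [X j])) = S.cls (if i = j then 1 else 0)"
        using insert.prems X[of j] basis_facts(5)[of j] by (auto intro: letter_polys)
      have J: "monom [X k] \<in> polys V" if "k \<in> J" for k
      proof -
        have "k \<in> I"
          using insert.prems that by blast
        then show ?thesis
          by (intro letter_polys basis_facts(5))
      qed
      let ?d = "\<lambda>j. if i = j then 1 else 0 :: 'g list \<Rightarrow>\<^sub>0 'k"
      have d: "?d k \<in> polys V" for k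
        by (simp add: one_polys zero_polys)
      have IH: "D (S.cls (\<Sum>j\<in>J. const (coord j y) * monom [X j])) = S.cls (\<Sum>j\<in>J. const (coord j y) * ?d j)"
        using insert.IH insert.prems by blast
      have Dj: "D (S.cls (const (coord j y) * monom [X j])) = S.cls (const (coord j y) * ?d j)"
        by (rule D_scale[OF _ j(1) d]) (use j(2) in simp)
      have "D (S.cls (const (coord j y) * monom [X j] + (\<Sum>j\<in>J. const (coord j y) * monom [X j])))
          = S.cls (const (coord j y) * ?d j + (\<Sum>j\<in>J. const (coord j y) * ?d j))"
        by (rule D_add[OF Dj IH])
          (intro polys_mult polys_sum const_polys j(1) J d; assumption)+
      then show ?case
        using insert.hyps by simp
    qed
    from this[of I] have "D (S.cls (\<Sum>j\<in>I. const (coord j y) * monom [X j])) = S.cls (const (coord i y))"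
      using i by (simp add: if_distrib[of "(*) _"] cong: if_cong)
    moreover have "(\<Sum>j\<in>I. const (coord j y) * monom [X j]) \<doteq> monom [y]"
      using S.eqv_sym[OF letter_sum[of I X "\<lambda>j. coord j y"]] basis_facts(5)
      unfolding coord_expand[OF y] by blast
    ultimately show ?thesis
      by (simp only: D_eqv)
  qed
  \<comment> \<open>Leibniz applied to 1 times 1 gives D 1 = D 1 + D 1.\<close>
  have D_1: "D (S.cls 1) = S.cls 0"
  proof -
    obtain d where d: "d \<in> polys V" "D (S.cls 1) = S.cls d"
      using closed[OF S.cls_in_A[OF one_polys]] by (rule S.carrier_AE)
    have "S.cls 1 \<in> part 0"
      by (simp add: part_iff one_polys tw_def substitute_def)
    from leib[OF this S.cls_in_A[OF one_polys]] d
    have "S.cls d = S.cls (d + d)"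
      by (simp add: S.mult_A S.add_A S.scale_A one_polys)
    then show ?thesis
      unfolding d(2) S.cls_eq_iff using S.J_uminus[of "- d"] by (simp add: S.eqv_def)
  qed
  have "D (S.cls a) = S.cls (drv i a)" if "a \<in> polys V" for a
    using that
  proof (induction rule: homogeneous_word_induct)
    case (word xs ps)
    then show ?case
    proof (induction xs arbitrary: ps)
      case Nil
      then show ?case using D_1 by simp
    next
      case (Cons y ys)
      from Cons.prems obtain c qs where y: "y \<in> V" "y \<in> P c" and ys: "homogeneous ys qs"
        by (auto simp: homogeneous_list_def list_all2_Cons1)
      note s = letter_polys[OF y(1)] word_polys[OF ys, of 1]
      note d = drv_polys[OF s(2), of i]
      have "S.cls (monom [y]) \<in> part c"
        unfolding part_iff[OF s(1)]
        using tw_word[of "[y]" "[c]" 1] y by (simp add: homogeneous_list_def del: add_bit_eq_xor)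
      from leib[OF this S.cls_in_A[OF s(2)]]
      have "D (S.cls (monom [y] * monom ys))
          = S.cls (const (coord i y) * monom ys + const (ksign (ip i) c) * (monom [y] * drv i (monom ys)))"
        unfolding Cons.IH[OF ys] D_letter[OF y(1)] p S.mult_A[OF s] S.mult_A[OF const_polys s(2)]
          S.mult_A[OF s(1) d] S.scale_A[OF polys_mult[OF s(1) d]]
          S.add_A[OF polys_mult[OF const_polys s(2)]
            polys_mult[OF const_polys polys_mult[OF s(1) d]]] .
      also have "\<dots> = S.cls (drv i (monom [y] * monom ys))"
        unfolding S.cls_eq_iff drv_letter mult.assoc[symmetric] twist_P[OF y(2)]
        by (intro S.eqv_add S.eqv_refl S.eqv_mult_right S.eqv_sym[OF letter_scale] y d)
      finally show ?case
        by simp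
    qed
  next
    case (scale c a)
    then show ?case
      by (simp only: drv_linear D_scale[OF scale(2,1) drv_polys[OF scale(1)]])
  next
    case (add a b)
    then show ?case
      by (simp only: drv_linear D_add[OF add(3,4,1,2) drv_polys[OF add(1)] drv_polys[OF add(2)]])
  next
    case (eqv a b)
    have "S.cls (drv i a) = S.cls (drv i b)"
      using descends_drv[OF i] eqv unfolding descends_def S.cls_eq_iff by blast
    then show ?case
      using D_eqv[OF eqv(3)] eqv(4) by simp
  qed
  then show ?thesis
    by (rule lift_eqI[OF descends_drv[OF i] ext])
qed

lemma lift_drv_X:
  assumes "i \<in> I" "j \<in> I"
  shows "lift (drv i) (S.cls (monom [X j])) = (if i = j then S.cls 1 else S.cls 0)"
proof -
  have "drv i (monom [X j]) = const (if i = j then 1 else 0)"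
    using drv_letter[of i "X j" 1] coord_X[OF assms] by simp
  then show ?thesis
    using lift_cls[OF descends_drv[OF assms(1)] letter_polys[OF basis_facts(5)[OF assms(2)]]]
    by simp
qed

abbreviation del where "del \<equiv> partial_deriv sc P V (r + s) X"

lemma partial_deriv_eq:
  assumes i: "i \<in> I"
  shows "del i = lift (drv i)"
  unfolding partial_deriv_def sym_gen_def sym_class_def sym_algebra_eq S.one_A S.zero_A
proof (rule the_equality)
  show "(\<exists>p. super_derivation sc P V p (lift (drv i))) \<and> (\<forall>j\<in>I. lift (drv i) (S.cls (monom [X j]))
      = (if i = j then S.cls 1 else S.cls 0))"
    using super_derivation_drv[OF i] lift_drv_X[OF i] by blast
next
  fix D
  assume "(\<exists>p. super_derivation sc P V p D) \<and> (\<forall>j\<in>I. D (S.cls (monom [X j]))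
      = (if i = j then S.cls 1 else S.cls 0))"
  then show "D = lift (drv i)"
    using super_derivation_unique[OF i] by blast
qed

section \<open>The Weyl superalgebra\<close>

text \<open>Well-definedness on classes is bundled with membership of the induced operator, so that
  membership follows the syntax of a formula on representatives.\<close>

definition weyl where "weyl T \<longleftrightarrow> descends T \<and> lift T \<in> weyl_algebra sc P V"

lemma weylI:
  assumes "f \<in> weyl_algebra sc P V" "descends T" "f \<in> extensional (carrier S.A)"
    and "\<And>p. p \<in> polys V \<Longrightarrow> f (S.cls p) = S.cls (T p)"
  shows "weyl T"
  using lift_eqI[OF assms(2,3,4)] assms(1,2) by (simp add: weyl_def)

lemma weylD:
  assumes "weyl T"
  shows "descends T" "lift T \<in> weyl_algebra sc P V" "\<And>p. p \<in> polys V \<Longrightarrow> T p \<in> polys V"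
    "\<And>p. p \<in> polys V \<Longrightarrow> lift T (S.cls p) = S.cls (T p)"
  using assms lift_cls[of T] by (auto simp: weyl_def descends_def)

lemma weyl_id: "weyl (\<lambda>q. q)"
  by (rule weylI[OF weyl_algebra.ident]) (auto simp: sym_algebra_eq descends_def)

lemma weyl_letter: "x \<in> V \<Longrightarrow> weyl (\<lambda>q. monom [x] * q)"
  by (rule weylI[OF weyl_algebra.mult[of x]])
    (auto simp: sym_algebra_eq descends_def sym_gen_def sym_class_def S.mult_A letter_polys
      intro: polys_mult S.eqv_mult_left)

lemma weyl_drv: "i \<in> I \<Longrightarrow> weyl (drv i)"
  unfolding weyl_def using weyl_algebra.deriv[OF super_derivation_drv[of i]] descends_drv by blast

lemma weyl_add:
  assumes "weyl S" "weyl T"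
  shows "weyl (\<lambda>q. S q + T q)"
proof (rule weylI[OF weyl_algebra.add[OF weylD(2)[OF assms(1)] weylD(2)[OF assms(2)]]])
  show "descends (\<lambda>q. S q + T q)"
    using weylD(1)[OF assms(1)] weylD(1)[OF assms(2)]
    unfolding descends_def by (blast intro: polys_add S.eqv_add)
qed (use weylD[OF assms(1)] weylD[OF assms(2)] in \<open>auto simp: sym_algebra_eq S.add_A\<close>)

lemma weyl_scale:
  assumes "weyl T"
  shows "weyl (\<lambda>q. const c * T q)"
proof (rule weylI[OF weyl_algebra.smult[OF weylD(2)[OF assms], where c = c]])
  show "descends (\<lambda>q. const c * T q)"
    using weylD(1)[OF assms]
    unfolding descends_def by (blast intro: polys_mult const_polys S.eqv_scale)
qed (use weylD[OF assms] in \<open>auto simp: sym_algebra_eq S.scale_A\<close>)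

lemma weyl_comp:
  assumes "weyl S" "weyl T"
  shows "weyl (\<lambda>q. S (T q))"
proof (rule weylI[OF weyl_algebra.comp[OF weylD(2)[OF assms(1)] weylD(2)[OF assms(2)]]])
  show "descends (\<lambda>q. S (T q))"
    using weylD(1)[OF assms(1)] weylD(1)[OF assms(2)] unfolding descends_def by blast
qed (use weylD[OF assms(1)] weylD[OF assms(2)] in \<open>auto simp: sym_algebra_eq compose_def\<close>)

lemma weyl_sum: "(\<And>i. i \<in> J \<Longrightarrow> weyl (T i)) \<Longrightarrow> weyl (\<lambda>q. \<Sum>i\<in>J. T i q)"
proof (induction J rule: infinite_finite_induct)
  case (insert i J)
  then show ?case by (simp add: weyl_add)
qed (use weyl_scale[OF weyl_id, of 0] in auto)

lemma weyl_act: "weyl (act x)"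
proof -
  have "weyl (act0 x)" if "x \<in> W 0" for x
    unfolding act0_def[abs_def] using that
    by (intro weyl_add weyl_scale weyl_id weyl_sum weyl_comp[OF weyl_letter weyl_drv] br_V_closed(1)
        basis_facts(5))
  moreover have "weyl (act1 x)" if "x \<in> W 1" for x
    unfolding act1_def[abs_def] using that
    by (intro weyl_add weyl_scale weyl_sum weyl_drv weyl_comp[OF weyl_letter weyl_comp[OF weyl_drv weyl_drv]]
        br_V_closed(1,3) basis_facts(5))
  ultimately show ?thesis
    unfolding act_def[abs_def] using gpart_intros by (intro weyl_add weyl_letter) auto
qed

lemma induced_rep_weyl: "rep x \<in> weyl_algebra sc P V"
proof -
  have "rep x = lift (act x)"
    using weylD(1)[OF weyl_act[of x]]
    by (rule lift_eqI) (simp_all add: induced_rep_cls, simp add: induced_rep_def sym_algebra_eq)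
  then show ?thesis
    using weylD(2)[OF weyl_act[of x]] by simp
qed

section \<open>The three formulas in the quotient\<close>

lemma partial_deriv_cls:
  "i \<in> I \<Longrightarrow> q \<in> polys V \<Longrightarrow> del i (S.cls q) = S.cls (drv i q)"
  by (simp add: partial_deriv_eq lift_cls descends_drv)

lemma gen_mult_cls:
  "x \<in> V \<Longrightarrow> q \<in> polys V \<Longrightarrow> sym_gen sc P V x \<otimes>\<^bsub>S.A\<^esub> S.cls q = S.cls (monom [x] * q)"
  by (simp add: sym_gen_def sym_class_def S.mult_A letter_polys)

lemma induced_rep_V:
  assumes "x \<in> V" "Y \<in> carrier S.A"
  shows "rep x Y = sym_gen sc P V x \<otimes>\<^bsub>S.A\<^esub> Y"
proof -
  obtain q where q: "q \<in> polys V" "Y = S.cls q"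
    using assms(2) by (rule S.carrier_AE)
  then show ?thesis
    using act_V[OF assms(1) q(1)] assms(1) by (simp add: induced_rep_cls gen_mult_cls S.cls_eq_iff)
qed

text \<open>The sum in the quotient ring is first collected into the class of a sum of polynomials;
  together with the scalar term this is the class of \<open>act0 x q\<close>.\<close>

lemma induced_rep_W0:
  assumes x: "x \<in> W 0" and "Y \<in> carrier S.A"
  shows "rep x Y = lam x \<odot>\<^bsub>S.A\<^esub> Y \<oplus>\<^bsub>S.A\<^esub>
    (\<Oplus>\<^bsub>S.A\<^esub>i\<in>I. sym_gen sc P V (br x (X i)) \<otimes>\<^bsub>S.A\<^esub> del i Y)"
proof -
  obtain q where q: "q \<in> polys V" "Y = S.cls q"
    using assms(2) by (rule S.carrier_AE)
  interpret SA: ring S.A by (rule sym_ring)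
  have b: "br x (X i) \<in> V" if "i \<in> I" for i
    by (intro br_V_closed(1) basis_facts(5) x that)
  have t: "monom [br x (X i)] * drv i q \<in> polys V" if "i \<in> I" for i
    by (intro polys_mult letter_polys b drv_polys q that)
  have "(\<Oplus>\<^bsub>S.A\<^esub>i\<in>I. sym_gen sc P V (br x (X i)) \<otimes>\<^bsub>S.A\<^esub> del i Y)
      = (\<Oplus>\<^bsub>S.A\<^esub>i\<in>I. S.cls (monom [br x (X i)] * drv i q))"
    unfolding q(2) by (rule SA.finsum_cong'[OF refl])
      (rule Pi_I, rule S.cls_in_A, erule t, simp only: partial_deriv_cls q gen_mult_cls b drv_polys)
  also have "\<dots> = S.cls (\<Sum>i\<in>I. monom [br x (X i)] * drv i q)"
    by (rule S.finsum_A) (use t in auto)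
  finally have sum: "(\<Oplus>\<^bsub>S.A\<^esub>i\<in>I. sym_gen sc P V (br x (X i)) \<otimes>\<^bsub>S.A\<^esub> del i Y)
      = S.cls (\<Sum>i\<in>I. monom [br x (X i)] * drv i q)" .
  have c: "const (lam x) * q \<in> polys V"
    by (rule polys_mult[OF const_polys q(1)])
  have m: "(\<Sum>i\<in>I. monom [br x (X i)] * drv i q) \<in> polys V"
    by (rule polys_sum) (rule t)
  have "lam x \<odot>\<^bsub>S.A\<^esub> Y \<oplus>\<^bsub>S.A\<^esub>
    (\<Oplus>\<^bsub>S.A\<^esub>i\<in>I. sym_gen sc P V (br x (X i)) \<otimes>\<^bsub>S.A\<^esub> del i Y)
      = S.cls (act0 x q)"
    unfolding sum unfolding q(2) S.scale_A[OF q(1)] act0_def by (rule S.add_A[OF c m])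
  also have "\<dots> = S.cls (act x q)"
    unfolding S.cls_eq_iff by (rule S.eqv_sym[OF act_W0[OF x q(1)]])
  finally show ?thesis
    using q by (simp add: induced_rep_cls)
qed

lemma induced_rep_W1:
  assumes x: "x \<in> W 1" and "Y \<in> carrier S.A"
  shows "rep x Y =
    (\<Oplus>\<^bsub>S.A\<^esub>i\<in>I. lam (br x (X i)) \<odot>\<^bsub>S.A\<^esub> del i Y) \<oplus>\<^bsub>S.A\<^esub>
      (1 / 2) \<odot>\<^bsub>S.A\<^esub> (\<Oplus>\<^bsub>S.A\<^esub>i\<in>I. \<Oplus>\<^bsub>S.A\<^esub>j\<in>I. sym_gen sc P V (br (br x (X i)) (X j)) \<otimes>\<^bsub>S.A\<^esub>
        del j (del i Y))"
    (is "_ = ?L \<oplus>\<^bsub>S.A\<^esub> (1 / 2) \<odot>\<^bsub>S.A\<^esub> ?Q")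
proof -
  obtain q where q: "q \<in> polys V" "Y = S.cls q"
    using assms(2) by (rule S.carrier_AE)
  let ?t = "\<lambda>i j. monom [br (br x (X i)) (X j)] * drv j (drv i q)"
  let ?u = "\<lambda>i. const (lam (br x (X i))) * drv i q"
  interpret SA: ring S.A by (rule sym_ring)
  note d = drv_polys[OF q(1)] drv_polys[OF drv_polys[OF q(1)]]
  have b: "br (br x (X i)) (X j) \<in> V" if "i \<in> I" "j \<in> I" for i j
    by (intro br_V_closed(1,3) basis_facts(5) x that)
  have t: "?t i j \<in> polys V" if "i \<in> I" "j \<in> I" for i j
    by (intro polys_mult letter_polys b d that)
  have u: "?u i \<in> polys V" for i
    by (intro polys_mult const_polys d)
  have "?L = (\<Oplus>\<^bsub>S.A\<^esub>i\<in>I. S.cls (?u i))"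
    unfolding q(2) by (rule SA.finsum_cong'[OF refl])
      (rule Pi_I, rule S.cls_in_A, rule u, simp only: partial_deriv_cls q S.scale_A d)
  also have "\<dots> = S.cls (\<Sum>i\<in>I. ?u i)"
    by (rule S.finsum_A) (use u in auto)
  finally have L: "?L = S.cls (\<Sum>i\<in>I. ?u i)" .
  have inner: "(\<Oplus>\<^bsub>S.A\<^esub>j\<in>I. sym_gen sc P V (br (br x (X i)) (X j)) \<otimes>\<^bsub>S.A\<^esub>
        del j (del i Y))
      = S.cls (\<Sum>j\<in>I. ?t i j)" if i: "i \<in> I" for i
  proof -
    have "(\<Oplus>\<^bsub>S.A\<^esub>j\<in>I. sym_gen sc P V (br (br x (X i)) (X j)) \<otimes>\<^bsub>S.A\<^esub>
        del j (del i Y))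
      = (\<Oplus>\<^bsub>S.A\<^esub>j\<in>I. S.cls (?t i j))"
      unfolding q(2) by (rule SA.finsum_cong'[OF refl])
        (rule Pi_I, rule S.cls_in_A, erule t[OF i], simp only: i partial_deriv_cls q gen_mult_cls b d)
    also have "\<dots> = S.cls (\<Sum>j\<in>I. ?t i j)"
      by (rule S.finsum_A) (use t i in auto)
    finally show ?thesis .
  qed
  have v: "(\<Sum>j\<in>I. ?t i j) \<in> polys V" if "i \<in> I" for i
    by (intro polys_sum t that)
  have "?Q = (\<Oplus>\<^bsub>S.A\<^esub>i\<in>I. S.cls (\<Sum>j\<in>I. ?t i j))"
    by (rule SA.finsum_cong'[OF refl])
      (rule Pi_I, rule S.cls_in_A, erule v, simp only: inner)
  also have "\<dots> = S.cls (\<Sum>i\<in>I. \<Sum>j\<in>I. ?t i j)"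
    by (rule S.finsum_A) (use v in auto)
  finally have Q: "?Q = S.cls (\<Sum>i\<in>I. \<Sum>j\<in>I. ?t i j)" .
  have "?L \<oplus>\<^bsub>S.A\<^esub> (1 / 2) \<odot>\<^bsub>S.A\<^esub> ?Q = S.cls (act1 x q)"
  proof -
    have s: "(\<Sum>i\<in>I. ?u i) \<in> polys V"
      "(\<Sum>i\<in>I. \<Sum>j\<in>I. ?t i j) \<in> polys V"
      by (intro polys_sum u v)+
    show ?thesis
      unfolding L Q act1_def S.scale_A[OF s(2)] by (intro S.add_A s polys_mult const_polys)
  qed
  also have "\<dots> = S.cls (act x q)"
    unfolding S.cls_eq_iff by (rule S.eqv_sym[OF act_W1[OF x q(1)]])
  finally show ?thesis
    using q by (simp add: induced_rep_cls)
qed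

end

(* A real normed field is isomorphic to the field of real or of complex numbers (Gelfand-Mazur),
   so the type class of 'k expresses that the ground field is one of these two. *)
theorem mainTheorem5:
  fixes sc :: "'k::real_normed_field \<Rightarrow> 'g::ab_group_add \<Rightarrow> 'g"
    and P :: "bit \<Rightarrow> 'g set"
    and br :: "'g \<Rightarrow> 'g \<Rightarrow> 'g"
    and W :: "int \<Rightarrow> 'g set"
    and r s :: nat
    and X :: "nat \<Rightarrow> 'g"
    and lam :: "'g \<Rightarrow> 'k"
  assumes "three_graded_lie_superalgebra sc P br W"
    and "\<exists>B. finite B \<and> module.span sc B = UNIV"
    and "homogeneous_basis sc P (W (-1)) r s X"
    and "lie_character sc P br (W 0) lam"
  shows
    "let V = W (-1);
         S = sym_algebra sc P V;
         \<iota> = sym_gen sc P V;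
         M = induced_module sc P br (kpart W) (extend_char W lam);
         \<phi> = induced_iso sc P br W lam;
         \<pi> = induced_rep sc P br W lam;
         D = partial_deriv sc P V (r + s) X
     in
       \<phi> \<in> linear_maps S M \<and> bij_betw \<phi> (carrier S) (carrier M) \<and>
       (\<forall>x. \<pi> x \<in> weyl_algebra sc P V) \<and>
       (\<forall>x\<in>W (-1). \<forall>Y\<in>carrier S. \<pi> x Y = \<iota> x \<otimes>\<^bsub>S\<^esub> Y) \<and>
       (\<forall>x\<in>W 0. \<forall>Y\<in>carrier S.
          \<pi> x Y = lam x \<odot>\<^bsub>S\<^esub> Y \<oplus>\<^bsub>S\<^esub>
            (\<Oplus>\<^bsub>S\<^esub>i\<in>{1..r + s}. \<iota> (br x (X i)) \<otimes>\<^bsub>S\<^esub> D i Y)) \<and>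
       (\<forall>x\<in>W 1. \<forall>Y\<in>carrier S.
          \<pi> x Y = (\<Oplus>\<^bsub>S\<^esub>i\<in>{1..r + s}. lam (br x (X i)) \<odot>\<^bsub>S\<^esub> D i Y) \<oplus>\<^bsub>S\<^esub>
            (1 / 2) \<odot>\<^bsub>S\<^esub>
              (\<Oplus>\<^bsub>S\<^esub>i\<in>{1..r + s}. \<Oplus>\<^bsub>S\<^esub>j\<in>{1..r + s}.
                 \<iota> (br (br x (X i)) (X j)) \<otimes>\<^bsub>S\<^esub> D j (D i Y)))"
proof -
  interpret graded_induction_data sc P br W r s X lam
    using assms(1,3,4) by (simp add: graded_induction_data_def graded_induction_data_axioms_def)
  have "bij_betw phi (carrier S.A) (carrier M)"
    using phi_inj phi_image by (rule bij_betw_imageI)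
  then show ?thesis
    unfolding Let_def sym_algebra_eq
    using phi_linear induced_rep_weyl induced_rep_V induced_rep_W0 induced_rep_W1 by blast
qed

end
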